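(* Let $a,b$ be relatively prime integers with $ab\neq 0$, and let $c_p,\widetilde c_p$ be the local Tamagawa numbers at a prime $p$ of $E_{C_5}(a,b)$ and $\widetilde E_{C_5}(a,b)$. The primes of bad reduction are exactly: the primes $p\mid ab$; the primes $p\geq 7$ dividing $a^2+11ab-b^2$; and $p=5$ when $5\mid a+18b$. Moreover: (i) if $n=v_p(ab)>0$ then $c_p=5n$ and $\widetilde c_p=n$; (ii) if $p\ge 7$ and $n=v_p(a^2+11ab-b^2)>0$: when $\left(\frac{-5(a^2+b^2)}{p}\right)=1$ we have $c_p=n$ and $\widetilde c_p=5n$; when $\left(\frac{-5(a^2+b^2)}{p}\right)=-1$ we have $c_p=\widetilde c_p=2$ if $n$ is even and $c_p=\widetilde c_p=1$ if $n$ is odd; (iii) if $v_5(a+18b)=1$ then $c_5=\widetilde c_5=1$, and if $v_5(a+18b)\ge 2$ then $c_5=\widetilde c_5=2$.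
   Context: For integers $a,b$, $E_{C_5}(a,b)$ is the curve $y^2+(a-b)xy-a^2by=x^3-abx^2$ over $\mathbb{Q}$ (with $(0,0)$ of order $5$), and $\widetilde E_{C_5}(a,b)$ is the curve $y^2+(a-b)xy-a^2by=x^3-abx^2+5ab(a^2-2ab-b^2)x+ab(a^4-15a^3b+5a^2b^2-10ab^3-b^4)$, a model of $E_{C_5}(a,b)/\langle(0,0)\rangle$. $\left(\frac{\cdot}{p}\right)$ is the Legendre symbol. The local Tamagawa number at $p$ of an elliptic curve $E/\mathbb{Q}$ is $c_p=[E(\mathbb{Q}_p):E_0(\mathbb{Q}_p)]$, computed with respect to a $p$-minimal model. *)

theory Defs
  imports "HOL-Number_Theory.Number_Theory"
begin

definition vrat :: "int \<Rightarrow> rat \<Rightarrow> int" where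
  "vrat p q = int (multiplicity p (fst (quotient_of q))) - int (multiplicity p (snd (quotient_of q)))"

definition pclose :: "int \<Rightarrow> int \<Rightarrow> rat \<Rightarrow> bool" where
  "pclose p k q \<longleftrightarrow> q = 0 \<or> vrat p q \<ge> k"

section \<open>The field Q_p, represented by p-adically Cauchy sequences of rationals\<close>

type_synonym qseq = "nat \<Rightarrow> rat"

definition padic_cauchy :: "int \<Rightarrow> qseq \<Rightarrow> bool" where
  "padic_cauchy p x \<longleftrightarrow> (\<forall>k. \<exists>N. \<forall>m\<ge>N. \<forall>n\<ge>N. pclose p k (x m - x n))"

definition padic_null :: "int \<Rightarrow> qseq \<Rightarrow> bool" where
  "padic_null p x \<longleftrightarrow> (\<forall>k. \<exists>N. \<forall>n\<ge>N. pclose p k (x n))"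

definition padic_eq :: "int \<Rightarrow> qseq \<Rightarrow> qseq \<Rightarrow> bool" where
  "padic_eq p x y \<longleftrightarrow> padic_null p (\<lambda>n. x n - y n)"

text \<open>limit lies in p^k Z_p (k = 0: in Z_p; k = 1: in the maximal ideal)\<close>
definition padic_in :: "int \<Rightarrow> int \<Rightarrow> qseq \<Rightarrow> bool" where
  "padic_in p k x \<longleftrightarrow> (\<exists>N. \<forall>n\<ge>N. pclose p k (x n))"

datatype wcurve = WC (wa1: rat) (wa2: rat) (wa3: rat) (wa4: rat) (wa6: rat)

definition wb2 :: "wcurve \<Rightarrow> rat" where "wb2 E = wa1 E ^ 2 + 4 * wa2 E"
definition wb4 :: "wcurve \<Rightarrow> rat" where "wb4 E = 2 * wa4 E + wa1 E * wa3 E"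
definition wb6 :: "wcurve \<Rightarrow> rat" where "wb6 E = wa3 E ^ 2 + 4 * wa6 E"
definition wb8 :: "wcurve \<Rightarrow> rat" where
  "wb8 E = wa1 E ^ 2 * wa6 E + 4 * wa2 E * wa6 E - wa1 E * wa3 E * wa4 E
           + wa2 E * wa3 E ^ 2 - wa4 E ^ 2"
definition wdisc :: "wcurve \<Rightarrow> rat" where
  "wdisc E = - (wb2 E ^ 2 * wb8 E) - 8 * wb4 E ^ 3 - 27 * wb6 E ^ 2 + 9 * wb2 E * wb4 E * wb6 E"

definition elliptic :: "wcurve \<Rightarrow> bool" where "elliptic E \<longleftrightarrow> wdisc E \<noteq> 0"

text \<open>Change of variables x = u^2 x' + r, y = u^3 y' + s u^2 x' + t (Silverman, Table 3.1).\<close>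
definition wtransform :: "rat \<Rightarrow> rat \<Rightarrow> rat \<Rightarrow> rat \<Rightarrow> wcurve \<Rightarrow> wcurve" where
  "wtransform u r s t E = WC
     ((wa1 E + 2 * s) / u)
     ((wa2 E - s * wa1 E + 3 * r - s ^ 2) / u ^ 2)
     ((wa3 E + r * wa1 E + 2 * t) / u ^ 3)
     ((wa4 E - s * wa3 E + 2 * r * wa2 E - (t + r * s) * wa1 E + 3 * r ^ 2 - 2 * s * t) / u ^ 4)
     ((wa6 E + r * wa4 E + r ^ 2 * wa2 E + r ^ 3 - t * wa3 E - t ^ 2 - r * t * wa1 E) / u ^ 6)"

definition q_isomorphic :: "wcurve \<Rightarrow> wcurve \<Rightarrow> bool" where
  "q_isomorphic E E' \<longleftrightarrow> (\<exists>u r s t. u \<noteq> 0 \<and> E' = wtransform u r s t E)"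

definition p_integral :: "int \<Rightarrow> wcurve \<Rightarrow> bool" where
  "p_integral p E \<longleftrightarrow> pclose p 0 (wa1 E) \<and> pclose p 0 (wa2 E) \<and> pclose p 0 (wa3 E)
                      \<and> pclose p 0 (wa4 E) \<and> pclose p 0 (wa6 E)"

definition p_minimal_model :: "int \<Rightarrow> wcurve \<Rightarrow> wcurve \<Rightarrow> bool" where
  "p_minimal_model p E E' \<longleftrightarrow> q_isomorphic E E' \<and> p_integral p E' \<and>
     (\<forall>E''. q_isomorphic E E'' \<and> p_integral p E'' \<longrightarrow> vrat p (wdisc E') \<le> vrat p (wdisc E''))"

definition minimal_model :: "int \<Rightarrow> wcurve \<Rightarrow> wcurve" where
  "minimal_model p E = (SOME E'. p_minimal_model p E E')"

definition bad_reduction :: "int \<Rightarrow> wcurve \<Rightarrow> bool" where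
  "bad_reduction p E \<longleftrightarrow> vrat p (wdisc (minimal_model p E)) > 0"

type_synonym qp_point = "(qseq \<times> qseq) option"  \<comment> \<open>None = point at infinity\<close>

definition cst :: "rat \<Rightarrow> qseq" where "cst c = (\<lambda>n. c)"

definition weq_seq :: "wcurve \<Rightarrow> qseq \<Rightarrow> qseq \<Rightarrow> qseq" where
  "weq_seq E x y = (\<lambda>n. y n ^ 2 + wa1 E * x n * y n + wa3 E * y n
                        - x n ^ 3 - wa2 E * x n ^ 2 - wa4 E * x n - wa6 E)"

definition qp_points :: "int \<Rightarrow> wcurve \<Rightarrow> qp_point set" where
  "qp_points p E = {None} \<union> {Some (x, y) | x y. padic_cauchy p x \<and> padic_cauchy p y
                                         \<and> padic_null p (weq_seq E x y)}"

definition qp_neg :: "wcurve \<Rightarrow> qp_point \<Rightarrow> qp_point" where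
  "qp_neg E P = (case P of None \<Rightarrow> None
     | Some (x, y) \<Rightarrow> Some (x, \<lambda>n. - y n - wa1 E * x n - wa3 E))"

definition qp_add :: "int \<Rightarrow> wcurve \<Rightarrow> qp_point \<Rightarrow> qp_point \<Rightarrow> qp_point" where
  "qp_add p E P Q = (case P of None \<Rightarrow> Q | Some (x1, y1) \<Rightarrow>
     (case Q of None \<Rightarrow> P | Some (x2, y2) \<Rightarrow>
       (if padic_eq p x1 x2 \<and> padic_null p (\<lambda>n. y1 n + y2 n + wa1 E * x2 n + wa3 E) then None
        else
          let lam = (if padic_eq p x1 x2
                     then (\<lambda>n. (3 * x1 n ^ 2 + 2 * wa2 E * x1 n + wa4 E - wa1 E * y1 n)
                               / (2 * y1 n + wa1 E * x1 n + wa3 E))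
                     else (\<lambda>n. (y2 n - y1 n) / (x2 n - x1 n)));
              nu = (\<lambda>n. y1 n - lam n * x1 n);
              x3 = (\<lambda>n. lam n ^ 2 + wa1 E * lam n - wa2 E - x1 n - x2 n);
              y3 = (\<lambda>n. - (lam n + wa1 E) * x3 n - nu n - wa3 E)
          in Some (x3, y3))))"

text \<open>E_0(Q_p): points whose reduction (w.r.t. the given model, assumed p-integral)
  is a nonsingular point of the reduced curve.\<close>
definition qp_points0 :: "int \<Rightarrow> wcurve \<Rightarrow> qp_point set" where
  "qp_points0 p E = {P \<in> qp_points p E. case P of None \<Rightarrow> True | Some (x, y) \<Rightarrow>
      \<not> padic_in p 0 x \<or>
      \<not> (padic_in p 1 (\<lambda>n. 2 * y n + wa1 E * x n + wa3 E) \<and>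
         padic_in p 1 (\<lambda>n. 3 * x n ^ 2 + 2 * wa2 E * x n + wa4 E - wa1 E * y n))}"

definition coset_rel :: "int \<Rightarrow> wcurve \<Rightarrow> (qp_point \<times> qp_point) set" where
  "coset_rel p E = {(P, Q). P \<in> qp_points p E \<and> Q \<in> qp_points p E \<and>
                            qp_add p E P (qp_neg E Q) \<in> qp_points0 p E}"

definition index_E0 :: "int \<Rightarrow> wcurve \<Rightarrow> nat" where
  "index_E0 p E = card (qp_points p E // coset_rel p E)"

definition tamagawa :: "int \<Rightarrow> wcurve \<Rightarrow> nat" where
  "tamagawa p E = index_E0 p (minimal_model p E)"

definition EC5 :: "int \<Rightarrow> int \<Rightarrow> wcurve" where
  "EC5 a b = WC (of_int (a - b)) (of_int (- a * b)) (of_int (- (a ^ 2 * b))) 0 0"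

definition EC5t :: "int \<Rightarrow> int \<Rightarrow> wcurve" where
  "EC5t a b = WC (of_int (a - b)) (of_int (- a * b)) (of_int (- (a ^ 2 * b)))
     (of_int (5 * a * b * (a ^ 2 - 2 * a * b - b ^ 2)))
     (of_int (a * b * (a ^ 4 - 15 * a ^ 3 * b + 5 * a ^ 2 * b ^ 2 - 10 * a * b ^ 3 - b ^ 4)))"

end

theory Submission
  imports Defs
begin

text \<open>
  The component group \<open>E(Q_p)/E_0(Q_p)\<close> is computed without the group law being known to be
  associative: it suffices to find a map \<open>\<phi>\<close> on points such that \<open>P - Q\<close> has nonsingular
  reduction exactly when \<open>\<phi> P = \<phi> Q\<close>. Move the singular point of the reduction to the origin.
  A chord through a point reducing to the singular point contains a second such point, and if \<open>P\<close>
  and \<open>Q\<close> both reduce to it, then so does the third point if and only if the slope of the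
  chord reduces to a tangent direction.

  For split multiplicative reduction an integral change of variables makes the equation
  \<open>u v = x^3 + c\<close> up to terms divisible by \<open>p^n\<close>, where \<open>n\<close> is the valuation of the
  discriminant and of \<open>c\<close>, and \<open>\<phi>\<close> is read off the valuations of \<open>u\<close> and \<open>v\<close>. In the
  nonsplit and additive cases at most one nontrivial component can occur, because a tangent
  direction would not be rational or would contradict the valuations of the coefficients; whether it
  does occur is decided by the parity of a valuation or by Hensel lifting.

  For \<open>p >= 5\<close> the model is controlled by \<open>c4\<close> and \<open>c6\<close>: modulo \<open>a^2 + 11ab - b^2\<close> the
  product \<open>- c4 c6\<close> of either curve is \<open>-5(a^2 + b^2)\<close> times a square, which gives the Legendre
  symbol. At \<open>p = 5\<close> the valuations of \<open>c4\<close> and \<open>c6\<close> yield the types II, II* and III; in the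
  last case the given model of the isogenous curve is not minimal.
\<close>

section \<open>Valuations and Cauchy sequences\<close>

text \<open>Points have sequences as coordinates, not classes of sequences, and the addition law
  divides termwise, so identities between points hold only up to null sequences and from some index
  on. The geometry is therefore done on single rational terms, modulo a fixed power of p, and
  carried to the limit by the fact that membership of a Cauchy sequence in p^k Z_p is eventually
  constant. The obstacle is the slope between two nearby points, where x2 - x1 may have any
  valuation or vanish. The factored difference of the two equations gives a second expression for
  the slope, with denominator y1 + y2 + a1 x2 + a3, whose valuation is known in the cases where that
  of x2 - x1 is not. The factor 5 moving between the two curves comes from their discriminants
  -(ab)^5 q and -ab q^5, where q = a^2 + 11ab - b^2: for split multiplicative reduction the index is
  the valuation of the discriminant.\<close>

lemma vrat_divide_of_int:
  fixes p a b :: int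
  assumes p: "prime p" and a: "a \<noteq> 0" and b: "b \<noteq> 0"
  shows "vrat p (of_int a / of_int b) = int (multiplicity p a) - int (multiplicity p b)"
proof -
  obtain n d where nd: "quotient_of (of_int a / of_int b :: rat) = (n, d)"
    by fastforce
  have eq: "(of_int a / of_int b :: rat) = of_int n / of_int d" and d: "d > 0"
    using quotient_of_div[OF nd] quotient_of_denom_pos[OF nd] by auto
  have "(of_int (a * d) :: rat) = of_int (n * b)"
    using eq b d by (simp add: field_simps)
  hence ad: "a * d = n * b" by (simp only: of_int_eq_iff)
  hence n: "n \<noteq> 0" using a d by auto
  have pe: "prime_elem p" using p by (rule prime_imp_prime_elem)
  have "multiplicity p a + multiplicity p d = multiplicity p n + multiplicity p b"
    using prime_elem_multiplicity_mult_distrib[OF pe a, of d]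
      prime_elem_multiplicity_mult_distrib[OF pe n b] ad d by simp
  thus ?thesis unfolding vrat_def nd by simp
qed

locale padic =
  fixes p :: int
  assumes prime_p: "prime p"
begin

abbreviation D :: "int \<Rightarrow> rat \<Rightarrow> bool" where "D \<equiv> pclose p"

lemma rat_fracE:
  fixes x :: rat
  obtains a b :: int where "x = of_int a / of_int b" "b \<noteq> 0"
proof -
  obtain n d where nd: "quotient_of x = (n, d)" by fastforce
  show ?thesis
    using that[of n d] quotient_of_div[OF nd] quotient_of_denom_pos[OF nd] by auto
qed

lemma p_gt1: "p > 1"
  using prime_p by (simp add: prime_gt_1_int)

lemma p_nz [simp]: "p \<noteq> 0"
  using p_gt1 by simp

lemma vrat_mult:
  assumes "x \<noteq> 0" "y \<noteq> 0"
  shows "vrat p (x * y) = vrat p x + vrat p y"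
proof -
  obtain a b c d :: int where e: "x = of_int a / of_int b" "b \<noteq> 0" "y = of_int c / of_int d" "d \<noteq> 0"
    by (metis rat_fracE)
  have nz: "a \<noteq> 0" "c \<noteq> 0" using assms e by auto
  have pe: "prime_elem p" using prime_p by (rule prime_imp_prime_elem)
  have xy: "x * y = of_int (a * c) / of_int (b * d)" using e by simp
  show ?thesis
    unfolding xy unfolding e
    using nz e by (subst (1 2 3) vrat_divide_of_int[OF prime_p])
      (simp_all add: prime_elem_multiplicity_mult_distrib[OF pe])
qed

lemma vrat_of_int: "a \<noteq> 0 \<Longrightarrow> vrat p (of_int a) = int (multiplicity p a)"
  using vrat_divide_of_int[OF prime_p, of a 1] by simp

lemma vrat_1 [simp]: "vrat p 1 = 0"
  using vrat_of_int[of 1] by simp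

lemma vrat_p [simp]: "vrat p (of_int p) = 1"
  proof -
  have "multiplicity p p = 1" using prime_p by (intro multiplicity_self) auto
  thus ?thesis using vrat_of_int[of p] by simp
qed

lemma vrat_minus [simp]: "vrat p (- x) = vrat p x"
proof (cases "x = 0")
  case False
  have "vrat p (-1) = 0" using vrat_of_int[of "-1"] prime_p not_dvd_imp_multiplicity_0[of p "-1"] by auto
  thus ?thesis using vrat_mult[of "-1" x] False by simp
qed simp

lemma vrat_inverse: "x \<noteq> 0 \<Longrightarrow> vrat p (inverse x) = - vrat p x"
  using vrat_mult[of x "inverse x"] by simp

lemma vrat_divide: "x \<noteq> 0 \<Longrightarrow> y \<noteq> 0 \<Longrightarrow> vrat p (x / y) = vrat p x - vrat p y"
  using vrat_mult[of x "inverse y"] vrat_inverse[of y] by (simp add: field_simps)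

lemma vrat_power: "x \<noteq> 0 \<Longrightarrow> vrat p (x ^ n) = int n * vrat p x"
  by (induction n) (simp_all add: vrat_mult algebra_simps)

lemma vrat_power_int: "vrat p (of_int p powi k) = k"
proof (cases "k \<ge> 0")
  case True
  thus ?thesis by (simp add: power_int_def vrat_power)
next
  case False
  have "vrat p (inverse (of_int p) ^ nat (- k)) = int (nat (- k)) * vrat p (inverse (of_int p))"
    by (rule vrat_power) simp
  thus ?thesis using False by (simp add: power_int_def vrat_inverse)
qed

lemma pclose_0 [simp]: "D k 0"
  by (simp add: pclose_def)

lemma pclose_minus [simp]: "D k (- x) \<longleftrightarrow> D k x"
  by (simp add: pclose_def)

lemma pclose_mono: "D k x \<Longrightarrow> j \<le> k \<Longrightarrow> D j x"
  by (auto simp: pclose_def)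

lemma pclose_add:
  assumes "D k x" "D k y"
  shows "D k (x + y)"
proof (cases "x = 0 \<or> y = 0 \<or> x + y = 0")
  case True
  thus ?thesis using assms by auto
next
  case False
  obtain a b c d :: int where e: "x = of_int a / of_int b" "b \<noteq> 0" "y = of_int c / of_int d" "d \<noteq> 0"
    by (metis rat_fracE)
  have xe: "x = of_int (a * d) / of_int (b * d)" and ye: "y = of_int (c * b) / of_int (b * d)"
    and xye: "x + y = of_int (a * d + c * b) / of_int (b * d)"
    using e by (simp_all add: field_simps)
  have nz: "a * d \<noteq> 0" "c * b \<noteq> 0" "a * d + c * b \<noteq> 0" "b * d \<noteq> 0"
    using False e xye by (auto simp del: of_int_add of_int_mult)
  \<comment> \<open>Over the common denominator \<open>b * d\<close> the claim is a divisibility of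
    numerators. If \<open>k\<close> plus the multiplicity of the denominator is negative,
    \<open>nat\<close> truncates to 0, which is harmless because multiplicities are
    nonnegative.\<close>
  define j where "j = nat (k + int (multiplicity p (b * d)))"
  have kx: "k \<le> vrat p x" and ky: "k \<le> vrat p y" using assms False by (auto simp: pclose_def)
  have nu: "\<not> is_unit p" using prime_p by auto
  have "j \<le> multiplicity p (a * d)"
    using kx unfolding xe vrat_divide_of_int[OF prime_p nz(1,4)] j_def by linarith
  moreover have "j \<le> multiplicity p (c * b)"
    using ky unfolding ye vrat_divide_of_int[OF prime_p nz(2,4)] j_def by linarith
  ultimately have "p ^ j dvd a * d + c * b"
    using multiplicity_dvd' by (metis dvd_add)
  hence "j \<le> multiplicity p (a * d + c * b)"
    using nz(3) nu by (simp add: power_dvd_iff_le_multiplicity)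
  hence "k \<le> vrat p (x + y)"
    unfolding xye vrat_divide_of_int[OF prime_p nz(3,4)] j_def by linarith
  thus ?thesis by (simp add: pclose_def)
qed

lemma pclose_diff: "D k x \<Longrightarrow> D k y \<Longrightarrow> D k (x - y)"
  using pclose_add[of k x "- y"] by simp

lemma pclose_add_cancel: "D k x \<Longrightarrow> D k (x + y) \<longleftrightarrow> D k y"
  using pclose_add[of k x y] pclose_diff[of k "x + y" x] by auto

lemma pclose_diff_cancel: "D k x \<Longrightarrow> D k (y - x) \<longleftrightarrow> D k y"
  using pclose_add[of k x "y - x"] pclose_diff[of k y x] by auto

lemma pclose_commute: "D k (x - y) \<longleftrightarrow> D k (y - x)"
  using pclose_minus[of k "x - y"] by simp

lemma pclose_mult: "D j x \<Longrightarrow> D k y \<Longrightarrow> D (j + k) (x * y)"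
  by (cases "x = 0 \<or> y = 0") (auto simp: pclose_def vrat_mult)

lemma pclose_mult': "D j x \<Longrightarrow> D k y \<Longrightarrow> l \<le> j + k \<Longrightarrow> D l (x * y)"
  using pclose_mult pclose_mono by blast

text \<open>The off-by-one: failing \<open>D j\<close> means valuation at most \<open>j - 1\<close>,
  so the product has valuation at most \<open>j + k - 2\<close>, which has to stay below
  \<open>l\<close>.\<close>

lemma not_pclose_mult: "\<not> D j x \<Longrightarrow> \<not> D k y \<Longrightarrow> j + k \<le> l + 1 \<Longrightarrow> \<not> D l (x * y)"
  by (auto simp: pclose_def vrat_mult)

lemma pclose_of_int [simp]: "D 0 (of_int a)"
  by (cases "a = 0") (auto simp: pclose_def vrat_of_int)

lemma pclose_numeral [simp]: "D 0 (numeral a)" "D 0 1"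
  using pclose_of_int[of "numeral a"] pclose_of_int[of 1] by simp_all

lemma pclose_of_int_iff:
  assumes "a \<noteq> 0"
  shows "D (int k) (of_int a) \<longleftrightarrow> p ^ k dvd a"
proof -
  have "\<not> is_unit p" using prime_p by auto
  thus ?thesis
    using assms power_dvd_iff_le_multiplicity[of a p k] by (simp add: pclose_def vrat_of_int)
qed

lemma pclose_of_int_dvd: "D (int k) (of_int a) \<longleftrightarrow> p ^ k dvd a"
  using pclose_of_int_iff by (cases "a = 0") auto

lemma pclose_1_of_int: "D 1 (of_int a) \<longleftrightarrow> p dvd a"
  using pclose_of_int_dvd[of 1 a] by simp

lemma pclose_0_mult: "D 0 x \<Longrightarrow> D k y \<Longrightarrow> D k (x * y)" "D 0 x \<Longrightarrow> D k y \<Longrightarrow> D k (y * x)"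
  using pclose_mult[of 0 x k y] by (simp_all add: mult.commute)

lemma pclose_power: "D k x \<Longrightarrow> D (int n * k) (x ^ n)"
proof (induction n)
  case (Suc n)
  thus ?case using pclose_mult[of k x "int n * k" "x ^ n"] by (simp add: algebra_simps)
qed simp

lemma pclose_power': "D k x \<Longrightarrow> l \<le> int n * k \<Longrightarrow> D l (x ^ n)"
  using pclose_power pclose_mono by blast

lemma not_pclose_power: "\<not> D k x \<Longrightarrow> int n * (k - 1) < l \<Longrightarrow> \<not> D l (x ^ n)"
proof -
  assume a: "\<not> D k x" "int n * (k - 1) < l"
  hence x: "x \<noteq> 0" and v: "vrat p x \<le> k - 1" by (auto simp: pclose_def)
  have "int n * vrat p x \<le> int n * (k - 1)" using v by (intro mult_left_mono) auto
  thus ?thesis using a x by (simp add: pclose_def vrat_power)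
qed

text \<open>The two hypotheses pin the valuation of \<open>x\<close> at exactly
  \<open>j\<close>.\<close>

lemma pclose_mult_iff:
  assumes "D j x" "\<not> D (j + 1) x"
  shows "D k (x * y) \<longleftrightarrow> D (k - j) y"
  using assms by (cases "y = 0") (auto simp: pclose_def vrat_mult)

lemma pclose_divide_iff:
  assumes "D j x" "\<not> D (j + 1) x"
  shows "D k (y / x) \<longleftrightarrow> D (k + j) y"
  using assms by (cases "y = 0") (auto simp: pclose_def vrat_divide)

definition punit :: "rat \<Rightarrow> bool" where "punit x \<longleftrightarrow> D 0 x \<and> \<not> D 1 x"

lemma punit_mult_iff: "punit x \<Longrightarrow> D k (x * y) \<longleftrightarrow> D k y" "punit x \<Longrightarrow> D k (y * x) \<longleftrightarrow> D k y"
  using pclose_mult_iff[of 0 x k y] by (simp_all add: punit_def mult.commute)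

lemma punit_divide_iff: "punit x \<Longrightarrow> D k (y / x) \<longleftrightarrow> D k y"
  using pclose_divide_iff[of 0 x k y] by (simp add: punit_def)

lemma punit_iff: "punit x \<longleftrightarrow> x \<noteq> 0 \<and> vrat p x = 0"
  by (auto simp: punit_def pclose_def)

lemma punit_nz: "punit x \<Longrightarrow> x \<noteq> 0"
  by (auto simp: punit_iff)

lemma punit_mult: "punit x \<Longrightarrow> punit y \<Longrightarrow> punit (x * y)"
  by (simp add: punit_iff vrat_mult)

lemma punit_divide: "punit x \<Longrightarrow> punit y \<Longrightarrow> punit (x / y)"
  by (simp add: punit_iff vrat_divide)

lemma punit_power: "punit x \<Longrightarrow> punit (x ^ n)"
  by (simp add: punit_iff vrat_power)

lemma punit_minus [simp]: "punit (- x) \<longleftrightarrow> punit x"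
  by (simp add: punit_iff)

lemma punit_1 [simp]: "punit 1"
  by (simp add: punit_iff)

lemma punit_of_int: "punit (of_int a) \<longleftrightarrow> \<not> p dvd a"
  by (simp add: punit_def pclose_1_of_int)

lemma punit_add: "punit x \<Longrightarrow> D 1 y \<Longrightarrow> punit (x + y)"
  unfolding punit_def
  using pclose_add_cancel[of 1 y x] pclose_add[of 0 x y] pclose_mono[of 1 y 0] by (simp add: add.commute)

lemma pclose_p_powi: "D k (of_int p powi j) \<longleftrightarrow> k \<le> j"
  by (simp add: pclose_def vrat_power_int)

text \<open>The residue field of the p-integral rationals is Z/p: the denominator \<open>d\<close>
  is prime to \<open>p\<close>, and \<open>n * c\<close> works for any inverse \<open>c\<close> of
  \<open>d\<close> modulo \<open>p\<close>.\<close>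

lemma int_approx:
  assumes "D 0 x"
  obtains m :: int where "D 1 (x - of_int m)"
proof -
  obtain n d where nd: "quotient_of x = (n, d)" by fastforce
  have e: "x = of_int n / of_int d" and d: "d > 0" and cop: "coprime n d"
    using quotient_of_div[OF nd] quotient_of_denom_pos[OF nd] quotient_of_coprime[OF nd] by auto
  have nd': "\<not> p dvd d"
  proof
    assume pd: "p dvd d"
    hence "\<not> p dvd n" using cop prime_p by (meson coprime_common_divisor not_prime_unit)
    hence n: "n \<noteq> 0" "multiplicity p n = 0" by (auto simp: not_dvd_imp_multiplicity_0)
    have "multiplicity p d > 0"
      using pd d prime_p
      by (metis less_numeral_extra(3) multiplicity_eq_zero_iff not_prime_unit bot_nat_0.not_eq_extremum)
    hence "vrat p x < 0" unfolding e using vrat_divide_of_int[OF prime_p n(1), of d] d n by simp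
    thus False using assms n d e by (auto simp: pclose_def)
  qed
  hence "coprime d p" using prime_p prime_imp_coprime coprime_commute by blast
  then obtain c where c: "[d * c = 1] (mod p)" using cong_solve_coprime_int by blast
  hence "p dvd 1 - d * c" by (metis cong_iff_dvd_diff cong_sym)
  hence 1: "D 1 (of_int (n * (1 - d * c)))" by (subst pclose_1_of_int) simp
  have "of_int (n * (1 - d * c)) / of_int d = x - of_int (n * c)"
    using e d by (simp add: field_simps)
  thus ?thesis using that[of "n * c"] 1 nd' punit_divide_iff punit_of_int by metis
qed

section \<open>Arithmetic of p-adic limits\<close>

lemma padic_null_iff: "padic_null p x \<longleftrightarrow> (\<forall>k. \<forall>\<^sub>F n in sequentially. D k (x n))"
  by (simp add: padic_null_def eventually_sequentially)

lemma padic_in_iff: "padic_in p k x \<longleftrightarrow> (\<forall>\<^sub>F n in sequentially. D k (x n))"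
  by (simp add: padic_in_def eventually_sequentially)

lemma padic_null_in: "padic_null p x \<Longrightarrow> padic_in p k x"
  by (simp add: padic_null_iff padic_in_iff)

lemma padic_null_cong:
  "\<forall>\<^sub>F n in sequentially. x n = y n \<Longrightarrow> padic_null p x \<longleftrightarrow> padic_null p y"
  unfolding padic_null_iff
  by (intro arg_cong[of _ _ All] ext eventually_cong) (auto elim: eventually_mono)

lemma padic_in_cong:
  "\<forall>\<^sub>F n in sequentially. x n = y n \<Longrightarrow> padic_in p k x \<longleftrightarrow> padic_in p k y"
  unfolding padic_in_iff by (intro eventually_cong) (auto elim: eventually_mono)

lemma padic_in_mono: "padic_in p k x \<Longrightarrow> j \<le> k \<Longrightarrow> padic_in p j x"
  unfolding padic_in_iff by (auto elim!: eventually_mono intro: pclose_mono)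

lemma padic_null_add: "padic_null p x \<Longrightarrow> padic_null p y \<Longrightarrow> padic_null p (\<lambda>n. x n + y n)"
  unfolding padic_null_iff
proof
  fix k assume a: "\<forall>k. \<forall>\<^sub>F n in sequentially. D k (x n)" "\<forall>k. \<forall>\<^sub>F n in sequentially. D k (y n)"
  show "\<forall>\<^sub>F n in sequentially. D k (x n + y n)"
    using a[rule_format, of k] by eventually_elim (rule pclose_add)
qed

lemma padic_null_minus: "padic_null p x \<Longrightarrow> padic_null p (\<lambda>n. - x n)"
  by (simp add: padic_null_iff)

lemma padic_null_diff: "padic_null p x \<Longrightarrow> padic_null p y \<Longrightarrow> padic_null p (\<lambda>n. x n - y n)"
  using padic_null_add[OF _ padic_null_minus, of x y] by simp

lemma padic_null_0 [simp]: "padic_null p (\<lambda>n. 0)"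
  by (simp add: padic_null_iff)

lemma padic_cauchyD:
  assumes "padic_cauchy p x"
  obtains N where "\<And>m n. m \<ge> N \<Longrightarrow> n \<ge> N \<Longrightarrow> D k (x m - x n)"
  using assms unfolding padic_cauchy_def by blast

lemma cauchy_const [simp]: "padic_cauchy p (\<lambda>n. c)"
  by (simp add: padic_cauchy_def)

lemma cauchy_add: "padic_cauchy p x \<Longrightarrow> padic_cauchy p y \<Longrightarrow> padic_cauchy p (\<lambda>n. x n + y n)"
  unfolding padic_cauchy_def
proof
  fix k assume a: "\<forall>k. \<exists>N. \<forall>m\<ge>N. \<forall>n\<ge>N. D k (x m - x n)" "\<forall>k. \<exists>N. \<forall>m\<ge>N. \<forall>n\<ge>N. D k (y m - y n)"
  obtain M N where "\<forall>m\<ge>M. \<forall>n\<ge>M. D k (x m - x n)" "\<forall>m\<ge>N. \<forall>n\<ge>N. D k (y m - y n)"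
    using a by meson
  hence "\<forall>m\<ge>max M N. \<forall>n\<ge>max M N. D k ((x m - x n) + (y m - y n))"
    by (auto intro!: pclose_add)
  thus "\<exists>N. \<forall>m\<ge>N. \<forall>n\<ge>N. D k (x m + y m - (x n + y n))"
    by (intro exI[of _ "max M N"]) (simp add: algebra_simps)
qed

lemma cauchy_minus: "padic_cauchy p x \<Longrightarrow> padic_cauchy p (\<lambda>n. - x n)"
  unfolding padic_cauchy_def using pclose_commute by (simp add: add.commute)

lemma cauchy_diff: "padic_cauchy p x \<Longrightarrow> padic_cauchy p y \<Longrightarrow> padic_cauchy p (\<lambda>n. x n - y n)"
  using cauchy_add[OF _ cauchy_minus, of x y] by simp

lemma cauchy_bounded:
  assumes "padic_cauchy p x"
  obtains k where "k \<le> 0" "\<forall>\<^sub>F n in sequentially. D k (x n)"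
proof -
  obtain N where N: "\<And>m n. m \<ge> N \<Longrightarrow> n \<ge> N \<Longrightarrow> D 0 (x m - x n)"
    using assms padic_cauchyD by metis
  define k where "k = min 0 (vrat p (x N))"
  have "D k (x n)" if "n \<ge> N" for n
  proof -
    have "D k (x N)" by (simp add: pclose_def k_def)
    moreover have "D k (x n - x N)" using pclose_mono[OF N[OF that order.refl], of k] by (simp add: k_def)
    ultimately show ?thesis using pclose_add[of k "x n - x N" "x N"] by simp
  qed
  thus ?thesis using that[of k] unfolding eventually_sequentially k_def by auto
qed

text \<open>Cauchy sequences are bounded, so null sequences form an ideal among them.\<close>

lemma null_mult_cauchy:
  assumes "padic_null p x" "padic_cauchy p y"
  shows "padic_null p (\<lambda>n. x n * y n)" "padic_null p (\<lambda>n. y n * x n)"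
proof -
  obtain k where k: "\<forall>\<^sub>F n in sequentially. D k (y n)" using cauchy_bounded[OF assms(2)] by blast
  show 1: "padic_null p (\<lambda>n. x n * y n)"
    unfolding padic_null_iff
  proof
    fix l
    have "\<forall>\<^sub>F n in sequentially. D (l - k) (x n)" using assms(1) by (simp add: padic_null_iff)
    thus "\<forall>\<^sub>F n in sequentially. D l (x n * y n)"
      using k by eventually_elim (erule (1) pclose_mult', simp)
  qed
  thus "padic_null p (\<lambda>n. y n * x n)" by (simp add: mult.commute)
qed

lemma cauchy_mult:
  assumes "padic_cauchy p x" "padic_cauchy p y"
  shows "padic_cauchy p (\<lambda>n. x n * y n)"
  unfolding padic_cauchy_def
proof
  fix l
  obtain j where j: "\<forall>\<^sub>F n in sequentially. D j (x n)" using cauchy_bounded[OF assms(1)] by blast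
  obtain k where k: "\<forall>\<^sub>F n in sequentially. D k (y n)" using cauchy_bounded[OF assms(2)] by blast
  obtain N where N: "\<And>n. n \<ge> N \<Longrightarrow> D j (x n)" "\<And>n. n \<ge> N \<Longrightarrow> D k (y n)"
    using eventually_conj[OF j k] unfolding eventually_sequentially by blast
  obtain Nx where Nx: "\<And>m n. m \<ge> Nx \<Longrightarrow> n \<ge> Nx \<Longrightarrow> D (l - k) (x m - x n)"
    using assms padic_cauchyD by metis
  obtain Ny where Ny: "\<And>m n. m \<ge> Ny \<Longrightarrow> n \<ge> Ny \<Longrightarrow> D (l - j) (y m - y n)"
    using assms padic_cauchyD by metis
  have "D l (x m * y m - x n * y n)" if "m \<ge> max N (max Nx Ny)" "n \<ge> max N (max Nx Ny)" for m n
  proof -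
    have "D l ((x m - x n) * y m + x n * (y m - y n))"
      using that N[of n] N[of m] Nx[of m n] Ny[of m n]
      by (intro pclose_add) (auto intro: pclose_mult')
    thus ?thesis by (simp add: algebra_simps)
  qed
  thus "\<exists>N. \<forall>m\<ge>N. \<forall>n\<ge>N. D l (x m * y m - x n * y n)" by blast
qed

lemma cauchy_power: "padic_cauchy p x \<Longrightarrow> padic_cauchy p (\<lambda>n. x n ^ k)"
  by (induction k) (auto intro: cauchy_mult)

text \<open>The set p^k Z_p is open and closed, so a Cauchy sequence cannot enter and leave it
  forever. This is the bridge by which statements about single late terms become statements about
  the limit.\<close>

lemma cauchy_stable:
  assumes "padic_cauchy p x"
  shows "\<forall>\<^sub>F n in sequentially. D k (x n) \<longleftrightarrow> padic_in p k x"
proof -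
  obtain N where N: "\<And>m n. m \<ge> N \<Longrightarrow> n \<ge> N \<Longrightarrow> D k (x m - x n)"
    using assms padic_cauchyD by metis
  have eq: "D k (x n) \<longleftrightarrow> D k (x N)" if "n \<ge> N" for n
    using pclose_diff_cancel[of k "x N" "x n"] N[of n N] pclose_add[of k "x n - x N" "x N"]
      pclose_diff[of k "x n" "x n - x N"] that by auto
  have "padic_in p k x \<longleftrightarrow> D k (x N)"
    unfolding padic_in_def using eq by (metis nle_le)
  thus ?thesis unfolding eventually_sequentially using eq by blast
qed

text \<open>Late terms agree modulo p^k while none of them lies in p^k, so the ultrametric
  inequality freezes their valuation. This makes termwise inversion legitimate.\<close>

lemma not_null_stable:
  assumes "padic_cauchy p x" "\<not> padic_null p x"
  obtains d where "\<forall>\<^sub>F n in sequentially. x n \<noteq> 0 \<and> vrat p (x n) = d"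
proof -
  obtain k where "\<not> padic_in p k x"
    using assms(2) by (auto simp: padic_null_iff padic_in_iff)
  hence "\<forall>\<^sub>F n in sequentially. \<not> D k (x n)"
    using cauchy_stable[OF assms(1), of k] by simp
  then obtain M where M: "\<And>n. n \<ge> M \<Longrightarrow> \<not> D k (x n)" unfolding eventually_sequentially by blast
  obtain N where N: "\<And>m n. m \<ge> N \<Longrightarrow> n \<ge> N \<Longrightarrow> D k (x m - x n)"
    using assms padic_cauchyD by metis
  define L where "L = max M N"
  have "x n \<noteq> 0 \<and> vrat p (x n) = vrat p (x L)" if "n \<ge> L" for n
  proof -
    have n: "\<not> D k (x n)" "\<not> D k (x L)" "D k (x n - x L)"
      using that M[of n] M[of L] N[of n L] by (auto simp: L_def)
    let ?d = "vrat p (x L)"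
    have dk: "?d + 1 \<le> k" and L0: "x L \<noteq> 0" using n(2) by (auto simp: pclose_def)
    have "D ?d (x n) \<longleftrightarrow> D ?d (x L)" "D (?d + 1) (x n) \<longleftrightarrow> D (?d + 1) (x L)"
      using pclose_add_cancel[of ?d "x n - x L" "x L"] pclose_add_cancel[of "?d + 1" "x n - x L" "x L"]
        pclose_mono[OF n(3), of ?d] pclose_mono[OF n(3), of "?d + 1"] dk by auto
    thus ?thesis using L0 n(1) by (auto simp: pclose_def)
  qed
  thus ?thesis using that unfolding eventually_sequentially by blast
qed

lemma not_null_nonzero:
  assumes "padic_cauchy p x" "\<not> padic_null p x"
  shows "\<forall>\<^sub>F n in sequentially. x n \<noteq> 0"
  using not_null_stable[OF assms] by (metis (mono_tags, lifting) eventually_mono)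

lemma cauchy_inverse:
  assumes "padic_cauchy p x" "\<not> padic_null p x"
  shows "padic_cauchy p (\<lambda>n. inverse (x n))"
  unfolding padic_cauchy_def
proof
  fix k
  obtain d where "\<forall>\<^sub>F n in sequentially. x n \<noteq> 0 \<and> vrat p (x n) = d"
    using not_null_stable[OF assms] by blast
  then obtain M where M: "\<And>n. n \<ge> M \<Longrightarrow> x n \<noteq> 0 \<and> vrat p (x n) = d"
    unfolding eventually_sequentially by blast
  \<comment> \<open>Passing to reciprocals divides the difference by \<open>x m * x n\<close>, which
    costs \<open>2 * d\<close> digits of precision.\<close>
  obtain N where N: "\<And>m n. m \<ge> N \<Longrightarrow> n \<ge> N \<Longrightarrow> D (k + 2 * d) (x m - x n)"
    using assms padic_cauchyD by metis
  have "D k (inverse (x m) - inverse (x n))" if mn: "m \<ge> max M N" "n \<ge> max M N" for m n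
  proof -
    have nz: "x m \<noteq> 0" "x n \<noteq> 0" and v: "vrat p (x m) = d" "vrat p (x n) = d"
      using M[of m] M[of n] mn by auto
    have e: "inverse (x m) - inverse (x n) = inverse (x m) * inverse (x n) * (x n - x m)"
      using nz by (simp add: field_simps)
    have "D (-d) (inverse (x m))" "D (-d) (inverse (x n))"
      using nz v by (simp_all add: pclose_def vrat_inverse)
    hence "D (- 2 * d) (inverse (x m) * inverse (x n))" by (rule pclose_mult') simp
    thus ?thesis unfolding e by (rule pclose_mult'[of _ _ "k + 2 * d"]) (use N[of n m] mn in auto)
  qed
  thus "\<exists>N. \<forall>m\<ge>N. \<forall>n\<ge>N. D k (inverse (x m) - inverse (x n))" by blast
qed

lemma cauchy_divide:
  assumes "padic_cauchy p x" "padic_cauchy p y" "\<not> padic_null p y"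
  shows "padic_cauchy p (\<lambda>n. x n / y n)"
  using cauchy_mult[OF assms(1) cauchy_inverse[OF assms(2,3)]] by (simp add: field_simps)

lemma null_divide:
  assumes "padic_null p x" "padic_cauchy p y" "\<not> padic_null p y"
  shows "padic_null p (\<lambda>n. x n / y n)"
  using null_mult_cauchy(1)[OF assms(1) cauchy_inverse[OF assms(2,3)]] by (simp add: field_simps)

text \<open>Q_p has no zero divisors: \<open>y\<close> is eventually nonzero and may be divided out
  termwise.\<close>

lemma null_mult_cancel:
  assumes "padic_null p (\<lambda>n. x n * y n)" "padic_cauchy p y" "\<not> padic_null p y"
  shows "padic_null p x"
proof -
  have "\<forall>\<^sub>F n in sequentially. x n * y n / y n = x n"
    using not_null_nonzero[OF assms(2,3)] by eventually_elim simp
  from padic_null_cong[OF this] show ?thesis using null_divide[OF assms] by simp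
qed

lemma null_const_mult_iff: "c \<noteq> 0 \<Longrightarrow> padic_null p (\<lambda>n. c * x n) \<longleftrightarrow> padic_null p x"
  using null_mult_cauchy(2)[OF _ cauchy_const, of x c]
    null_mult_cauchy(2)[OF _ cauchy_const, of "\<lambda>n. c * x n" "inverse c"] by (auto simp flip: mult.assoc)

lemma in_punit_mult_iff:
  assumes "punit c"
  shows "padic_in p k (\<lambda>n. c * x n) \<longleftrightarrow> padic_in p k x" "padic_in p k (\<lambda>n. x n / c) \<longleftrightarrow> padic_in p k x"
  using assms by (simp_all add: padic_in_iff punit_mult_iff punit_divide_iff)

lemmas cauchy_intros = cauchy_const cauchy_add cauchy_minus cauchy_diff cauchy_mult cauchy_power

text \<open>Stands in for Hensel's lemma.\<close>

lemma contraction_fixpoint: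
  assumes int: "\<And>x. D 0 x \<Longrightarrow> D 0 (G x)"
    and contr: "\<And>x y k. D 0 x \<Longrightarrow> D 0 y \<Longrightarrow> k \<ge> 0 \<Longrightarrow> D k (x - y) \<Longrightarrow> D (k + 1) (G x - G y)"
  obtains x where "padic_cauchy p x" "\<And>n. D 0 (x n)" "padic_null p (\<lambda>n. x n - G (x n))"
proof -
  define x where "x n = (G ^^ n) 0" for n
  have S: "x (Suc n) = G (x n)" for n by (simp add: x_def)
  have i: "D 0 (x n)" for n
    by (induction n) (simp_all add: x_def int)
  have step: "D (int n) (x m - x (n + j))" if "m \<ge> n" for m n j
    using that
  proof (induction n arbitrary: m)
    case 0
    show ?case using i by (simp add: pclose_diff)
  next
    case (Suc n)
    then obtain m' where m: "m = Suc m'" "m' \<ge> n" by (cases m) auto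
    show ?case using contr[OF i i _ Suc.IH[OF m(2)]] by (simp add: m(1) S add.commute)
  qed
  have "padic_cauchy p x"
    unfolding padic_cauchy_def
  proof
    fix k
    have "D k (x m - x n)" if "m \<ge> nat k" "n \<ge> nat k" for m n
      using step[OF that(1), of "n - nat k"] that by (auto intro: pclose_mono)
    thus "\<exists>N. \<forall>m\<ge>N. \<forall>n\<ge>N. D k (x m - x n)" by blast
  qed
  moreover have "padic_null p (\<lambda>n. x n - G (x n))"
    unfolding padic_null_def
  proof
    fix k
    have "D k (x n - G (x n))" if "n \<ge> nat k" for n
      using step[OF that(1), of "Suc n - nat k"] that by (auto simp flip: S intro: pclose_mono)
    thus "\<exists>N. \<forall>n\<ge>N. D k (x n - G (x n))" by blast
  qed
  ultimately show ?thesis using that i by blast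
qed

end

section \<open>Chords and tangents\<close>

definition weq :: "wcurve \<Rightarrow> rat \<Rightarrow> rat \<Rightarrow> rat" where
  "weq E x y = y ^ 2 + wa1 E * x * y + wa3 E * y - x ^ 3 - wa2 E * x ^ 2 - wa4 E * x - wa6 E"

definition weq_dy :: "wcurve \<Rightarrow> rat \<Rightarrow> rat \<Rightarrow> rat" where
  "weq_dy E x y = 2 * y + wa1 E * x + wa3 E"

definition weq_mdx :: "wcurve \<Rightarrow> rat \<Rightarrow> rat \<Rightarrow> rat" where
  "weq_mdx E x y = 3 * x ^ 2 + 2 * wa2 E * x + wa4 E - wa1 E * y"

definition third_x :: "wcurve \<Rightarrow> rat \<Rightarrow> rat \<Rightarrow> rat \<Rightarrow> rat" where
  "third_x E l x1 x2 = l ^ 2 + wa1 E * l - wa2 E - x1 - x2"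

text \<open>Both defects vanish exactly when \<open>l\<close> is the slope of the line through the two points
  (the tangent, if they coincide). The second stays meaningful for \<open>x1 = x2\<close>.\<close>

definition slope_defect :: "rat \<Rightarrow> rat \<Rightarrow> rat \<Rightarrow> rat \<Rightarrow> rat \<Rightarrow> rat" where
  "slope_defect l x1 y1 x2 y2 = y2 - y1 - l * (x2 - x1)"

definition slope_defect' :: "wcurve \<Rightarrow> rat \<Rightarrow> rat \<Rightarrow> rat \<Rightarrow> rat \<Rightarrow> rat \<Rightarrow> rat" where
  "slope_defect' E l x1 y1 x2 y2 = l * (y1 + y2 + wa1 E * x2 + wa3 E)
     - (x1 ^ 2 + x1 * x2 + x2 ^ 2 + wa2 E * (x1 + x2) + wa4 E - wa1 E * y1)"

text \<open>Origin of both slope expressions: for two points on the curve the left side vanishes, so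
  the chord slope is (y1 - y2) / (x1 - x2) and also the quotient of the other two factors.\<close>

lemma weq_diff:
  "weq E x1 y1 - weq E x2 y2 = (y1 - y2) * (y1 + y2 + wa1 E * x2 + wa3 E)
     - (x1 - x2) * (x1 ^ 2 + x1 * x2 + x2 ^ 2 + wa2 E * (x1 + x2) + wa4 E - wa1 E * y1)"
  unfolding weq_def by (simp add: algebra_simps power2_eq_square power3_eq_cube)

text \<open>Vieta: on the line of slope \<open>l\<close> through the first point, with abscissa
  measured from \<open>x1\<close>, the equation becomes a cubic with root 0 whose other two roots
  have product \<open>weq_mdx - l * weq_dy\<close>, up to the defects.\<close>

lemma third_root_product:
  "(x2 - x1) * (third_x E l x1 x2 - x1) + l * weq_dy E x1 y1 - weq_mdx E x1 y1
     = slope_defect' E l x1 y1 x2 y2 - l * slope_defect l x1 y1 x2 y2"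
  unfolding third_x_def weq_dy_def weq_mdx_def slope_defect_def slope_defect'_def by (simp add: algebra_simps power2_eq_square power3_eq_cube)

text \<open>The \<open>wa1\<close> term makes the second defect asymmetric in the two points; the
  asymmetry is a multiple of the first defect, so it disappears in the limit.\<close>

lemma slope_defect'_swap:
  "slope_defect' E l x2 y2 x1 y1 = slope_defect' E l x1 y1 x2 y2 + wa1 E * slope_defect l x1 y1 x2 y2"
  unfolding slope_defect_def slope_defect'_def by (simp add: algebra_simps power2_eq_square power3_eq_cube)

lemma slope_defect'_third:
  assumes "x3 = third_x E l x1 x2" "y3 = y1 + l * (x3 - x1)"
  shows "slope_defect' E l x1 y1 x3 y3
    = slope_defect' E l x1 y1 x2 y2 - l * slope_defect l x1 y1 x2 y2"
  unfolding assms third_x_def slope_defect_def slope_defect'_def by (simp add: algebra_simps power2_eq_square power3_eq_cube)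

lemma weq_third:
  assumes "x3 = third_x E l x1 x2"
  shows "weq E x3 (y1 + l * (x3 - x1)) = weq E x1 y1
    + (x3 - x1) * (slope_defect' E l x1 y1 x2 y2 - l * slope_defect l x1 y1 x2 y2)"
  unfolding assms third_x_def slope_defect_def slope_defect'_def weq_def by (simp add: algebra_simps power2_eq_square power3_eq_cube)

lemma weq_neg: "weq E x (- y - wa1 E * x - wa3 E) = weq E x y"
  unfolding weq_def by (simp add: algebra_simps power2_eq_square power3_eq_cube)

text \<open>Residual intersection of the line with the curve, not yet reflected: the sum of the two
  points is its negative.\<close>

definition third_point :: "wcurve \<Rightarrow> qseq \<Rightarrow> qseq \<Rightarrow> qseq \<Rightarrow> qseq \<Rightarrow> qp_point" where
  "third_point E l x1 y1 x2 = (let x3 = (\<lambda>n. third_x E (l n) (x1 n) (x2 n))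
     in Some (x3, \<lambda>n. y1 n + l n * (x3 n - x1 n)))"

context padic
begin

definition on_curve :: "wcurve \<Rightarrow> qseq \<Rightarrow> qseq \<Rightarrow> bool" where
  "on_curve E x y \<longleftrightarrow> padic_cauchy p x \<and> padic_cauchy p y \<and> padic_null p (\<lambda>n. weq E (x n) (y n))"

definition is_slope :: "wcurve \<Rightarrow> qseq \<Rightarrow> qseq \<Rightarrow> qseq \<Rightarrow> qseq \<Rightarrow> qseq \<Rightarrow> bool" where
  "is_slope E l x1 y1 x2 y2 \<longleftrightarrow> padic_cauchy p l
     \<and> padic_null p (\<lambda>n. slope_defect (l n) (x1 n) (y1 n) (x2 n) (y2 n))
     \<and> padic_null p (\<lambda>n. slope_defect' E (l n) (x1 n) (y1 n) (x2 n) (y2 n))"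

definition opposite :: "wcurve \<Rightarrow> qseq \<Rightarrow> qseq \<Rightarrow> qseq \<Rightarrow> qseq \<Rightarrow> bool" where
  "opposite E x1 y1 x2 y2 \<longleftrightarrow>
     padic_eq p x1 x2 \<and> padic_null p (\<lambda>n. y1 n + y2 n + wa1 E * x2 n + wa3 E)"

lemma qp_points_Some [simp]: "Some (x, y) \<in> qp_points p E \<longleftrightarrow> on_curve E x y"
  by (auto simp: qp_points_def on_curve_def weq_seq_def weq_def)

lemma qp_points_None [simp]: "None \<in> qp_points p E"
  by (simp add: qp_points_def)

lemma qp_neg_simps [simp]:
  "qp_neg E None = None"
  "qp_neg E (Some (x, y)) = Some (x, \<lambda>n. - y n - wa1 E * x n - wa3 E)"
  by (simp_all add: qp_neg_def)

lemma qp_neg_neg [simp]: "qp_neg E (qp_neg E P) = P"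
  by (cases P) auto

lemma qp_neg_points [simp]: "qp_neg E P \<in> qp_points p E \<longleftrightarrow> P \<in> qp_points p E"
proof -
  have "qp_neg E P \<in> qp_points p E" if "P \<in> qp_points p E" for P
    using that
    by (cases P) (auto simp: on_curve_def weq_neg intro!: cauchy_intros)
  thus ?thesis by (metis qp_neg_neg)
qed

lemmas null_intros = padic_null_add padic_null_diff padic_null_minus null_mult_cauchy

lemma qp_add_eq:
  assumes "\<not> opposite E x1 y1 x2 y2"
  defines "l \<equiv> if padic_eq p x1 x2 then (\<lambda>n. weq_mdx E (x1 n) (y1 n) / weq_dy E (x1 n) (y1 n))
      else (\<lambda>n. (y2 n - y1 n) / (x2 n - x1 n))"
  shows "qp_add p E (Some (x1, y1)) (Some (x2, y2)) = qp_neg E (third_point E l x1 y1 x2)"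
proof -
  have 1: "(\<lambda>n. - (l n + wa1 E) * (l n ^ 2 + wa1 E * l n - wa2 E - x1 n - x2 n)
           - (y1 n - l n * x1 n) - wa3 E)
       = (\<lambda>n. - (y1 n + l n * (third_x E (l n) (x1 n) (x2 n) - x1 n))
           - wa1 E * third_x E (l n) (x1 n) (x2 n) - wa3 E)"
    by (rule ext) (simp add: third_x_def algebra_simps)
  have l: "l = (if padic_eq p x1 x2
                     then (\<lambda>n. (3 * x1 n ^ 2 + 2 * wa2 E * x1 n + wa4 E - wa1 E * y1 n)
                               / (2 * y1 n + wa1 E * x1 n + wa3 E))
                     else (\<lambda>n. (y2 n - y1 n) / (x2 n - x1 n)))"
    by (simp add: l_def weq_mdx_def weq_dy_def)
  show ?thesis
    unfolding third_point_def Let_def qp_neg_simps 1[symmetric]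
    unfolding third_x_def
    using assms(1) unfolding opposite_def
    by (simp only: qp_add_def l option.case prod.case Let_def if_False)
qed

lemma qp_add_opposite:
  "opposite E x1 y1 x2 y2 \<Longrightarrow> qp_add p E (Some (x1, y1)) (Some (x2, y2)) = None"
  by (simp add: qp_add_def opposite_def)

lemma qp_add_None [simp]: "qp_add p E None Q = Q" "qp_add p E P None = P"
  by (auto simp: qp_add_def split: option.splits)

text \<open>With equal abscissas \<open>weq_diff\<close> leaves (y1 - y2) w = 0, and
  \<open>w\<close> is nonzero because the points are not opposite. So the points coincide,
  \<open>w\<close> becomes \<open>weq_dy\<close>, and the tangent slope has a nonzero
  denominator.\<close>

lemma same_abscissa_not_opposite:
  assumes P: "on_curve E x1 y1" and Q: "on_curve E x2 y2" and no: "\<not> opposite E x1 y1 x2 y2"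
    and eq: "padic_eq p x1 x2"
  shows "padic_null p (\<lambda>n. y1 n - y2 n)" "\<not> padic_null p (\<lambda>n. weq_dy E (x1 n) (y1 n))"
proof -
  define w where "w n = y1 n + y2 n + wa1 E * x2 n + wa3 E" for n
  define s where "s n = x1 n ^ 2 + x1 n * x2 n + x2 n ^ 2 + wa2 E * (x1 n + x2 n) + wa4 E - wa1 E * y1 n" for n
  have c: "padic_cauchy p x1" "padic_cauchy p y1" "padic_cauchy p x2" "padic_cauchy p y2"
    and z: "padic_null p (\<lambda>n. weq E (x1 n) (y1 n))" "padic_null p (\<lambda>n. weq E (x2 n) (y2 n))"
    using P Q by (auto simp: on_curve_def)
  have cw: "padic_cauchy p w" and cs: "padic_cauchy p s"
    unfolding w_def s_def by (intro cauchy_intros c)+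
  have nx: "padic_null p (\<lambda>n. x1 n - x2 n)" using eq by (simp add: padic_eq_def)
  have nw: "\<not> padic_null p w"
    using no eq by (simp add: opposite_def w_def[abs_def])
  have "padic_null p (\<lambda>n. weq E (x1 n) (y1 n) - weq E (x2 n) (y2 n) + (x1 n - x2 n) * s n)"
    by (intro null_intros z nx cs)
  hence "padic_null p (\<lambda>n. (y1 n - y2 n) * w n)" by (simp add: weq_diff w_def s_def)
  thus ny: "padic_null p (\<lambda>n. y1 n - y2 n)" by (rule null_mult_cancel) (fact cw nw)+
  have wv: "w n = weq_dy E (x1 n) (y1 n) - ((y1 n - y2 n) + wa1 E * (x1 n - x2 n))" for n
    by (simp add: w_def weq_dy_def algebra_simps)
  show "\<not> padic_null p (\<lambda>n. weq_dy E (x1 n) (y1 n))"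
  proof
    assume "padic_null p (\<lambda>n. weq_dy E (x1 n) (y1 n))"
    hence "padic_null p (\<lambda>n. weq_dy E (x1 n) (y1 n) - ((y1 n - y2 n) + wa1 E * (x1 n - x2 n)))"
      by (intro null_intros nx ny cauchy_intros)
    with nw show False by (simp add: wv[abs_def])
  qed
qed

text \<open>Hides the branch of the addition law: chord slope and tangent slope satisfy the same two
  defect conditions, so the reduction arguments can treat them together.\<close>

lemma qp_add_slope:
  assumes P: "on_curve E x1 y1" and Q: "on_curve E x2 y2" and no: "\<not> opposite E x1 y1 x2 y2"
  obtains l where "is_slope E l x1 y1 x2 y2"
    "qp_add p E (Some (x1, y1)) (Some (x2, y2)) = qp_neg E (third_point E l x1 y1 x2)"
proof -
  define l where "l = (if padic_eq p x1 x2 then (\<lambda>n. weq_mdx E (x1 n) (y1 n) / weq_dy E (x1 n) (y1 n))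
      else (\<lambda>n. (y2 n - y1 n) / (x2 n - x1 n)))"
  define w where "w n = y1 n + y2 n + wa1 E * x2 n + wa3 E" for n
  define s where "s n = x1 n ^ 2 + x1 n * x2 n + x2 n ^ 2 + wa2 E * (x1 n + x2 n) + wa4 E - wa1 E * y1 n" for n
  have c: "padic_cauchy p x1" "padic_cauchy p y1" "padic_cauchy p x2" "padic_cauchy p y2"
    and z: "padic_null p (\<lambda>n. weq E (x1 n) (y1 n))" "padic_null p (\<lambda>n. weq E (x2 n) (y2 n))"
    using P Q by (auto simp: on_curve_def)
  have cw: "padic_cauchy p w" and cs: "padic_cauchy p s"
    unfolding w_def s_def by (intro cauchy_intros c)+
  have "padic_null p (\<lambda>n. weq E (x1 n) (y1 n) - weq E (x2 n) (y2 n))"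
    by (intro null_intros z)
  hence z': "padic_null p (\<lambda>n. (y1 n - y2 n) * w n - (x1 n - x2 n) * s n)"
    by (simp only: weq_diff w_def s_def)
  have "is_slope E l x1 y1 x2 y2"
  proof (cases "padic_eq p x1 x2")
    case False
    have cx: "padic_cauchy p (\<lambda>n. x2 n - x1 n)" and cx': "padic_cauchy p (\<lambda>n. x1 n - x2 n)"
      by (intro cauchy_intros c)+
    have nx': "\<not> padic_null p (\<lambda>n. x1 n - x2 n)" using False by (simp add: padic_eq_def)
    hence nx: "\<not> padic_null p (\<lambda>n. x2 n - x1 n)"
      using padic_null_minus[of "\<lambda>n. x2 n - x1 n"] by auto
    have l: "l = (\<lambda>n. (y2 n - y1 n) / (x2 n - x1 n))" using False by (simp add: l_def)
    have ev: "\<forall>\<^sub>F n in sequentially. x2 n - x1 n \<noteq> 0" by (rule not_null_nonzero[OF cx nx])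
    have "padic_cauchy p l" unfolding l by (intro cauchy_divide cx nx cauchy_intros c)
    moreover have "padic_null p (\<lambda>n. slope_defect (l n) (x1 n) (y1 n) (x2 n) (y2 n))"
    proof -
      have "\<forall>\<^sub>F n in sequentially. slope_defect (l n) (x1 n) (y1 n) (x2 n) (y2 n) = 0"
        using ev by eventually_elim (simp add: slope_defect_def l)
      from padic_null_cong[OF this] show ?thesis by simp
    qed
    moreover have "padic_null p (\<lambda>n. slope_defect' E (l n) (x1 n) (y1 n) (x2 n) (y2 n))"
    proof -
      have "\<forall>\<^sub>F n in sequentially. ((y1 n - y2 n) * w n - (x1 n - x2 n) * s n) / (x1 n - x2 n)
          = slope_defect' E (l n) (x1 n) (y1 n) (x2 n) (y2 n)"
        using ev
      proof eventually_elim
        case (elim n)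
        hence nz: "x1 n - x2 n \<noteq> 0" by simp
        have "l n = (y1 n - y2 n) / (x1 n - x2 n)" unfolding l
          using minus_divide_divide[of "y1 n - y2 n" "x1 n - x2 n"] by simp
        moreover have "slope_defect' E (l n) (x1 n) (y1 n) (x2 n) (y2 n) = l n * w n - s n"
          by (simp add: slope_defect'_def w_def s_def)
        ultimately show ?case using nz
          by (simp add: diff_divide_distrib[of "(y1 n - y2 n) * w n"])
      qed
      from padic_null_cong[OF this] show ?thesis using null_divide[OF z' cx' nx'] by simp
    qed
    ultimately show ?thesis by (simp add: is_slope_def)
  next
    case True
    hence nx: "padic_null p (\<lambda>n. x1 n - x2 n)" by (simp add: padic_eq_def)
    have ny: "padic_null p (\<lambda>n. y1 n - y2 n)"
      by (rule same_abscissa_not_opposite(1)[OF P Q no True])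
    define v where "v n = weq_dy E (x1 n) (y1 n)" for n
    define b where "b n = weq_mdx E (x1 n) (y1 n)" for n
    have l: "l = (\<lambda>n. b n / v n)" using True by (simp add: l_def b_def v_def)
    have cv: "padic_cauchy p v" and cb: "padic_cauchy p b"
      unfolding v_def b_def weq_dy_def weq_mdx_def by (intro cauchy_intros c)+
    have nv: "\<not> padic_null p v"
      using same_abscissa_not_opposite(2)[OF P Q no True] by (simp add: v_def[abs_def])
    have cl: "padic_cauchy p l" unfolding l by (intro cauchy_divide cb cv nv)
    have 2: "padic_null p (\<lambda>n. slope_defect (l n) (x1 n) (y1 n) (x2 n) (y2 n))"
    proof -
      have "padic_null p (\<lambda>n. - (y1 n - y2 n) + l n * (x1 n - x2 n))"
        by (intro null_intros nx ny cl)
      thus ?thesis by (simp add: slope_defect_def algebra_simps)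
    qed
    have "padic_null p (\<lambda>n. slope_defect' E (l n) (x1 n) (y1 n) (x2 n) (y2 n))"
    proof -
      have "\<forall>\<^sub>F n in sequentially. - l n * ((y1 n - y2 n) + wa1 E * (x1 n - x2 n))
           + (x1 n - x2 n) * (2 * x1 n + x2 n + wa2 E)
          = slope_defect' E (l n) (x1 n) (y1 n) (x2 n) (y2 n)"
        using not_null_nonzero[OF cv nv]
      proof eventually_elim
        case (elim n)
        have "l n * v n = b n" using elim by (simp add: l)
        moreover have "slope_defect' E (l n) (x1 n) (y1 n) (x2 n) (y2 n)
           = l n * v n - l n * ((y1 n - y2 n) + wa1 E * (x1 n - x2 n))
             - b n + (x1 n - x2 n) * (2 * x1 n + x2 n + wa2 E)"
          unfolding slope_defect'_def v_def b_def weq_dy_def weq_mdx_def by (simp add: algebra_simps power2_eq_square power3_eq_cube)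
        ultimately show ?case by simp
      qed
      moreover have "padic_null p (\<lambda>n. - l n * ((y1 n - y2 n) + wa1 E * (x1 n - x2 n))
           + (x1 n - x2 n) * (2 * x1 n + x2 n + wa2 E))"
        by (intro null_intros nx ny cauchy_intros cl c)
      ultimately show ?thesis by (simp only: padic_null_cong)
    qed
    with cl 2 show ?thesis by (simp add: is_slope_def)
  qed
  moreover have "qp_add p E (Some (x1, y1)) (Some (x2, y2)) = qp_neg E (third_point E l x1 y1 x2)"
    unfolding l_def by (rule qp_add_eq[OF no])
  ultimately show ?thesis using that by blast
qed

lemma is_slope_swap: "is_slope E l x1 y1 x2 y2 \<Longrightarrow> is_slope E l x2 y2 x1 y1"
proof -
  assume a: "is_slope E l x1 y1 x2 y2"
  have e: "slope_defect l x2 y2 x1 y1 = - slope_defect l x1 y1 x2 y2" for l x1 y1 x2 y2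
    by (simp add: slope_defect_def algebra_simps)
  show ?thesis
    using a unfolding is_slope_def slope_defect'_swap[of E _ "x2 _" "y2 _" "x1 _" "y1 _"]
      e[of _ "x2 _" "y2 _" "x1 _" "y1 _"]
    by (auto intro!: null_intros cauchy_intros)
qed

text \<open>The three intersections of a line with the curve play interchangeable roles, which later
  allows the line to be reread starting from the third point.\<close>

lemma is_slope_third:
  assumes "is_slope E l x1 y1 x2 y2" "third_point E l x1 y1 x2 = Some (x3, y3)"
  shows "is_slope E l x1 y1 x3 y3" "x2 = (\<lambda>n. third_x E (l n) (x1 n) (x3 n))"
proof -
  have x3: "x3 n = third_x E (l n) (x1 n) (x2 n)" and y3: "y3 n = y1 n + l n * (x3 n - x1 n)" for n
    using assms(2) by (auto simp: third_point_def Let_def)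
  have e: "slope_defect (l n) (x1 n) (y1 n) (x3 n) (y3 n) = 0" for n
    by (simp add: slope_defect_def y3)
  have e': "slope_defect' E (l n) (x1 n) (y1 n) (x3 n) (y3 n) = slope_defect' E (l n) (x1 n) (y1 n) (x2 n) (y2 n)
      - l n * slope_defect (l n) (x1 n) (y1 n) (x2 n) (y2 n)" for n
    by (rule slope_defect'_third[OF x3 y3])
  show "is_slope E l x1 y1 x3 y3"
    using assms(1) unfolding is_slope_def e e' by (auto intro!: null_intros)
  show "x2 = (\<lambda>n. third_x E (l n) (x1 n) (x3 n))"
    by (simp add: fun_eq_iff x3 third_x_def)
qed

lemma third_point_on_curve:
  assumes P: "on_curve E x1 y1" and Q: "on_curve E x2 y2" and "is_slope E l x1 y1 x2 y2"
  shows "third_point E l x1 y1 x2 \<in> qp_points p E"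
proof -
  define x3 where "x3 n = third_x E (l n) (x1 n) (x2 n)" for n
  have c: "padic_cauchy p x1" "padic_cauchy p y1" "padic_cauchy p x2" "padic_cauchy p y2" "padic_cauchy p l"
    using assms by (auto simp: on_curve_def is_slope_def)
  have cx3: "padic_cauchy p x3" unfolding x3_def third_x_def by (intro cauchy_intros c)
  have e: "weq E (x3 n) (y1 n + l n * (x3 n - x1 n)) = weq E (x1 n) (y1 n) + (x3 n - x1 n) *
      (slope_defect' E (l n) (x1 n) (y1 n) (x2 n) (y2 n) - l n * slope_defect (l n) (x1 n) (y1 n) (x2 n) (y2 n))" for n
    by (rule weq_third) (simp add: x3_def)
  have "padic_null p (\<lambda>n. weq E (x3 n) (y1 n + l n * (x3 n - x1 n)))"
    unfolding e using assms by (auto simp: on_curve_def is_slope_def intro!: null_intros cauchy_intros c cx3)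
  moreover have "padic_cauchy p (\<lambda>n. y1 n + l n * (x3 n - x1 n))" by (intro cauchy_intros c cx3)
  ultimately show ?thesis
    using cx3 by (simp add: third_point_def Let_def on_curve_def x3_def[abs_def])
qed

lemma qp_add_points:
  assumes "P \<in> qp_points p E" "Q \<in> qp_points p E"
  shows "qp_add p E P Q \<in> qp_points p E"
proof (cases "P = None \<or> Q = None")
  case True
  thus ?thesis using assms by auto
next
  case False
  then obtain x1 y1 x2 y2 where PQ: "P = Some (x1, y1)" "Q = Some (x2, y2)" by auto
  show ?thesis
  proof (cases "opposite E x1 y1 x2 y2")
    case True
    thus ?thesis by (simp add: PQ qp_add_opposite)
  next
    case False
    have P: "on_curve E x1 y1" and Q: "on_curve E x2 y2" using assms by (simp_all add: PQ)
    obtain l where "is_slope E l x1 y1 x2 y2"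
      "qp_add p E (Some (x1, y1)) (Some (x2, y2)) = qp_neg E (third_point E l x1 y1 x2)"
      using qp_add_slope[OF P Q False] by blast
    thus ?thesis using third_point_on_curve[OF P Q] by (simp add: PQ)
  qed
qed

lemma index_E0_eq_card:
  assumes "\<And>P Q. P \<in> qp_points p E \<Longrightarrow> Q \<in> qp_points p E \<Longrightarrow>
    qp_add p E P (qp_neg E Q) \<in> qp_points0 p E \<longleftrightarrow> \<phi> P = \<phi> Q"
  shows "index_E0 p E = card (\<phi> ` qp_points p E)"
proof -
  let ?S = "qp_points p E"
  have cls: "coset_rel p E `` {P} = {Q \<in> ?S. \<phi> Q = \<phi> P}" if "P \<in> ?S" for P
    using assms that by (auto simp: coset_rel_def)
  have "?S // coset_rel p E = (\<lambda>v. {Q \<in> ?S. \<phi> Q = v}) ` \<phi> ` ?S"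
    unfolding quotient_def image_image using cls by auto
  moreover have "inj_on (\<lambda>v. {Q \<in> ?S. \<phi> Q = v}) (\<phi> ` ?S)"
    by (auto simp: inj_on_def)
  ultimately show ?thesis unfolding index_E0_def by (simp add: card_image)
qed

lemma padic_in_add: "padic_in p k x \<Longrightarrow> padic_in p k y \<Longrightarrow> padic_in p k (\<lambda>n. x n + y n)"
  unfolding padic_in_iff
proof -
  assume "\<forall>\<^sub>F n in sequentially. D k (x n)" "\<forall>\<^sub>F n in sequentially. D k (y n)"
  thus "\<forall>\<^sub>F n in sequentially. D k (x n + y n)" by eventually_elim (rule pclose_add)
qed

lemma padic_in_minus: "padic_in p k (\<lambda>n. - x n) \<longleftrightarrow> padic_in p k x"
  by (simp add: padic_in_iff)

lemma padic_in_add_cancel: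
  assumes "padic_in p k x"
  shows "padic_in p k (\<lambda>n. x n + y n) \<longleftrightarrow> padic_in p k y"
proof -
  have "\<forall>\<^sub>F n in sequentially. D k (x n + y n) \<longleftrightarrow> D k (y n)"
    using assms unfolding padic_in_iff by eventually_elim (rule pclose_add_cancel)
  thus ?thesis unfolding padic_in_iff by (rule eventually_subst)
qed

lemma padic_in_const: "padic_in p k (\<lambda>n. c) \<longleftrightarrow> D k c"
  by (simp add: padic_in_iff)

text \<open>Integral closedness in degree two: a pole of \<open>x\<close> would also be a pole of
  \<open>x + b\<close>, hence of the product.\<close>

lemma monic_quadratic_integral:
  assumes "D 0 b" "D 0 (x * (x + b))"
  shows "D 0 x"
proof (rule ccontr)
  assume n: "\<not> D 0 x"
  hence "\<not> D 0 (x + b)" using pclose_add_cancel[OF assms(1), of x] by (simp add: add.commute)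
  from not_pclose_mult[OF n this] assms(2) show False by auto
qed

text \<open>If the line of slope \<open>l\<close> passes through a point reducing to the singular point, whose
  \<open>x\<close>-coordinate is \<open>z\<close>, and \<open>z + s\<close>, \<open>z + t\<close> are the other two abscissas on it, then a second
  intersection point reduces to the singular point.\<close>

lemma second_singular_intersection:
  assumes "D 0 a1" "D 0 a2" "D 1 z" "D 1 A" "D 1 B"
    and sum: "s + t = l ^ 2 + a1 * l - a2 - 3 * z" and prod: "D 1 (s * t + l * A - B)"
  shows "(D 1 s \<and> D 1 (l * s)) \<or> (D 1 t \<and> D 1 (l * t))"
proof (cases "D 0 l")
  case True
  have "D 1 (B - l * A)" by (intro pclose_diff assms(5) pclose_0_mult(1) True assms(4))
  from pclose_add[OF prod this] have st: "D 1 (s * t)" by simp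
  have "D 0 (l * (l + a1) - a2 - 3 * z)"
    by (intro pclose_diff pclose_0_mult(1) pclose_add True assms(1,2) pclose_numeral pclose_mono[OF assms(3)]) simp
  hence st': "D 0 (s + t)" unfolding sum by (simp add: algebra_simps power2_eq_square)
  have "D 0 (s * (s + (- (s + t))))"
    using pclose_mono[OF st, of 0] by simp
  hence s: "D 0 s" by (rule monic_quadratic_integral[OF pclose_minus[THEN iffD2, OF st']])
  have t: "D 0 t" using pclose_add_cancel[OF s, of t] st' by simp
  have "D 1 s \<or> D 1 t" using st not_pclose_mult[of 1 s 1 t 1] by auto
  thus ?thesis using pclose_0_mult(1)[OF True, of 1 s] pclose_0_mult(1)[OF True, of 1 t] by auto
next
  case False
  \<comment> \<open>If \<open>l\<close> has a pole of order \<open>d\<close>, the sum of the two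
    roots has a pole of order \<open>2 * d\<close>, so one root has valuation at most
    \<open>- 2 * d\<close>. Their product has valuation at least \<open>1 - d\<close>, which gives
    the other root valuation at least \<open>d + 1\<close>, enough to absorb the factor
    \<open>l\<close>.\<close>
  define d where "d = - vrat p l"
  have l: "l \<noteq> 0" "vrat p l = - d" and d: "d \<ge> 1" using False by (auto simp: pclose_def d_def)
  have Dl: "D (- d) l" "\<not> D (- d + 1) l" using l by (auto simp: pclose_def)
  have lA: "D (1 - d) (l * A)" using Dl(1) assms(4) by (rule pclose_mult') simp
  have "D (1 - d) (s * t + l * A - B + (B - l * A))"
    using d lA by (intro pclose_add pclose_diff pclose_mono[OF prod] pclose_mono[OF assms(5)]) simp_all
  hence st: "D (1 - d) (s * t)" by simp
  have l2: "\<not> D (- 2 * d + 1) (l ^ 2)"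
    unfolding power2_eq_square by (rule not_pclose_mult[OF Dl(2) Dl(2)]) simp
  have "D (- 2 * d + 1) (a1 * l - a2 - 3 * z)"
    by (intro pclose_diff pclose_mult'[OF assms(1) Dl(1)] pclose_mult'[OF _ assms(3), of 0]
        pclose_numeral pclose_mono[OF assms(2)]) (use d in auto)
  hence "\<not> D (- 2 * d + 1) (s + t)"
    using l2 pclose_add_cancel[of "- 2 * d + 1" "a1 * l - a2 - 3 * z" "l ^ 2"] unfolding sum
    by (simp add: algebra_simps)
  hence "\<not> D (- 2 * d + 1) s \<or> \<not> D (- 2 * d + 1) t" using pclose_add[of "- 2 * d + 1" s t] by blast
  moreover have "D 1 t \<and> D 1 (l * t)" if "\<not> D (- 2 * d + 1) s" "D (1 - d) (s * t)" for s t :: rat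
  proof -
    have "D (d + 1) t"
    proof (rule ccontr)
      assume "\<not> D (d + 1) t"
      from not_pclose_mult[OF that(1) this] that(2) show False by simp
    qed
    thus ?thesis using d pclose_mult'[OF Dl(1), of "d + 1" t 1] pclose_mono[of "d + 1" t 1] by simp
  qed
  from this[of s t] this[of t s] have "\<not> D (- 2 * d + 1) s \<Longrightarrow> D 1 t \<and> D 1 (l * t)"
    "\<not> D (- 2 * d + 1) t \<Longrightarrow> D 1 s \<and> D 1 (l * s)"
    using st by (simp_all add: mult.commute[of t s])
  ultimately show ?thesis by blast
qed

end

section \<open>Reductions with their singular point at the origin\<close>

locale singular_at_origin = padic +
  fixes E :: wcurve
  assumes a1: "D 0 (wa1 E)" and a2: "D 0 (wa2 E)"
    and a3: "D 1 (wa3 E)" and a4: "D 1 (wa4 E)" and a6: "D 1 (wa6 E)"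
begin

definition pnode :: "qseq \<Rightarrow> qseq \<Rightarrow> bool" where
  "pnode x y \<longleftrightarrow> padic_in p 1 x \<and> padic_in p 1 y"

definition node :: "qp_point \<Rightarrow> bool" where
  "node P \<longleftrightarrow> (case P of None \<Rightarrow> False | Some (x, y) \<Rightarrow> pnode x y)"

lemma node_simps [simp]: "\<not> node None" "node (Some (x, y)) \<longleftrightarrow> pnode x y"
  by (simp_all add: node_def)

lemma integral_y:
  assumes "D 0 x" "D 0 (weq E x y)"
  shows "D 0 y"
proof -
  have "D 0 (weq E x y + (x * (x * x) + wa2 E * (x * x) + wa4 E * x + wa6 E))"
    by (intro pclose_add pclose_0_mult(1) assms a2 pclose_mono[OF a4] pclose_mono[OF a6]) simp_all
  also have "weq E x y + (x * (x * x) + wa2 E * (x * x) + wa4 E * x + wa6 E) = y * (y + (wa1 E * x + wa3 E))"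
    by (simp add: weq_def algebra_simps power2_eq_square power3_eq_cube)
  finally show ?thesis
    by (rule monic_quadratic_integral[rotated])
      (intro pclose_add pclose_0_mult(1) assms(1) a1 pclose_mono[OF a3], simp)
qed

text \<open>A variant of Euler's relation: twice the equation minus x and y times its partial
  derivatives kills the quadratic part and leaves \<open>x ^ 3\<close>, up to terms containing a3,
  a4 and a6. Once \<open>x\<close> vanishes modulo \<open>p\<close>, the equation itself leaves
  \<open>y ^ 2\<close>.\<close>

lemma singular_point_unique:
  assumes x: "D 0 x" and F: "D 1 (weq E x y)" and dy: "D 1 (weq_dy E x y)" and dx: "D 1 (weq_mdx E x y)"
  shows "D 1 x \<and> D 1 y"
proof -
  have y: "D 0 y" using x pclose_mono[OF F, of 0] by (rule integral_y) auto
  have x1: "D 1 x"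
  proof (rule ccontr)
    assume n: "\<not> D 1 x"
    have "D 1 (x * weq_mdx E x y - y * weq_dy E x y + 2 * weq E x y - y * wa3 E + x * wa4 E + 2 * wa6 E)"
      by (intro pclose_add pclose_diff pclose_0_mult(1) x y F dy dx a3 a4 a6 pclose_numeral)
    also have "x * weq_mdx E x y - y * weq_dy E x y + 2 * weq E x y - y * wa3 E + x * wa4 E + 2 * wa6 E = x ^ 3"
      by (simp add: weq_def weq_dy_def weq_mdx_def algebra_simps power2_eq_square power3_eq_cube)
    finally show False using not_pclose_power[OF n, of 3 1] by simp
  qed
  have "D 1 y"
  proof (rule ccontr)
    assume n: "\<not> D 1 y"
    have "D 1 (weq E x y + (x * (x * x) + wa2 E * (x * x) + wa4 E * x + wa6 E) - y * (wa1 E * x + wa3 E))"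
      by (intro pclose_add pclose_diff pclose_0_mult(1)[of y] pclose_0_mult(1)[of x] pclose_0_mult(1)[OF a1]
          pclose_0_mult(1)[OF a2] pclose_0_mult(2)[OF x a4] x x1 y F a3 a6)
    also have "weq E x y + (x * (x * x) + wa2 E * (x * x) + wa4 E * x + wa6 E) - y * (wa1 E * x + wa3 E) = y ^ 2"
      by (simp add: weq_def algebra_simps power2_eq_square power3_eq_cube)
    finally show False using not_pclose_power[OF n, of 2 1] by simp
  qed
  with x1 show ?thesis by simp
qed

lemma singular_point_partials:
  assumes "D 1 x" "D 1 y"
  shows "D 1 (weq_dy E x y)" "D 1 (weq_mdx E x y)"
proof -
  have "D 1 (2 * y + wa1 E * x + wa3 E)" "D 1 (3 * (x * x) + 2 * (wa2 E * x) + wa4 E - wa1 E * y)"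
    by (intro pclose_add pclose_diff pclose_0_mult(1) assms a1 a2 a3 a4 pclose_numeral
        pclose_mono[OF assms(1), of 0]; simp)+
  thus "D 1 (weq_dy E x y)" "D 1 (weq_mdx E x y)"
    by (simp_all add: weq_dy_def weq_mdx_def power2_eq_square mult.assoc)
qed

text \<open>Uniqueness of the singular point condenses the definition of E_0 into one condition;
  points with nonintegral abscissa reduce to infinity and fall on the nonsingular side.\<close>

lemma qp_points0_iff:
  assumes "P \<in> qp_points p E"
  shows "P \<in> qp_points0 p E \<longleftrightarrow> \<not> node P"
proof (cases P)
  case None
  thus ?thesis by (simp add: qp_points0_def)
next
  case (Some xy)
  then obtain x y where P: "P = Some (x, y)" by (cases xy) auto
  have F: "padic_null p (\<lambda>n. weq E (x n) (y n))" using assms by (simp add: P on_curve_def)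
  have "node P \<longleftrightarrow> padic_in p 0 x \<and> padic_in p 1 (\<lambda>n. weq_dy E (x n) (y n))
      \<and> padic_in p 1 (\<lambda>n. weq_mdx E (x n) (y n))" (is "_ \<longleftrightarrow> ?R")
  proof
    assume "node P"
    hence n: "padic_in p 1 x" "padic_in p 1 y" by (simp_all add: P pnode_def)
    have "\<forall>\<^sub>F n in sequentially. D 1 (weq_dy E (x n) (y n)) \<and> D 1 (weq_mdx E (x n) (y n))"
      using n unfolding padic_in_iff by eventually_elim (simp add: singular_point_partials)
    thus ?R using padic_in_mono[OF n(1), of 0] by (simp add: padic_in_iff eventually_conj_iff)
  next
    assume r: ?R
    have F1: "\<forall>\<^sub>F n in sequentially. D 1 (weq E (x n) (y n))"
      using F by (simp add: padic_null_iff)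
    have "\<forall>\<^sub>F n in sequentially. D 1 (x n) \<and> D 1 (y n)"
      using r[THEN conjunct1, unfolded padic_in_iff] r[THEN conjunct2, THEN conjunct1, unfolded padic_in_iff]
        r[THEN conjunct2, THEN conjunct2, unfolded padic_in_iff] F1
      by eventually_elim (rule singular_point_unique)
    thus "node P" by (simp add: P pnode_def padic_in_iff eventually_conj_iff)
  qed
  thus ?thesis using assms by (auto simp: P qp_points0_def weq_dy_def weq_mdx_def)
qed

lemma pnode_neg: "pnode x (\<lambda>n. - y n - wa1 E * x n - wa3 E) \<longleftrightarrow> pnode x y"
proof -
  have "padic_in p 1 (\<lambda>n. - y n - wa1 E * x n - wa3 E) \<longleftrightarrow> padic_in p 1 y" if x: "padic_in p 1 x"
  proof -
    have "\<forall>\<^sub>F n in sequentially. D 1 (- y n - wa1 E * x n - wa3 E) \<longleftrightarrow> D 1 (y n)"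
      using x unfolding padic_in_iff
    proof eventually_elim
      case (elim n)
      have "D 1 (- wa1 E * x n - wa3 E)"
        using elim a1 a3 by (intro pclose_diff pclose_0_mult(1)) auto
      from pclose_add_cancel[OF this, of "- y n"] show ?case by (simp add: algebra_simps)
    qed
    thus ?thesis unfolding padic_in_iff by (rule eventually_subst)
  qed
  thus ?thesis by (auto simp: pnode_def)
qed

lemma node_neg [simp]: "node (qp_neg E P) \<longleftrightarrow> node P"
  by (cases P) (auto simp: pnode_neg)

lemma slope_pnode:
  assumes c: "padic_cauchy p x1" "padic_cauchy p y1" "padic_cauchy p x2" "padic_cauchy p y2"
    and sl: "is_slope E l x1 y1 x2 y2" and t: "third_point E l x1 y1 x2 = Some (x3, y3)"
    and n: "pnode x1 y1"
  shows "pnode x2 y2 \<or> pnode x3 y3"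
proof -
  have x3: "x3 n = third_x E (l n) (x1 n) (x2 n)" and y3: "y3 n = y1 n + l n * (x3 n - x1 n)" for n
    using t by (auto simp: third_point_def Let_def)
  have cl: "padic_cauchy p l" using sl by (simp add: is_slope_def)
  have cx3: "padic_cauchy p x3" unfolding x3 third_x_def by (intro cauchy_intros c cl)
  have cy3: "padic_cauchy p y3" unfolding y3 by (intro cauchy_intros c cl cx3)
  have e: "padic_null p (\<lambda>n. slope_defect (l n) (x1 n) (y1 n) (x2 n) (y2 n))"
    and e': "padic_null p (\<lambda>n. slope_defect' E (l n) (x1 n) (y1 n) (x2 n) (y2 n))"
    using sl by (auto simp: is_slope_def)
  have e'': "padic_null p (\<lambda>n. slope_defect' E (l n) (x1 n) (y1 n) (x2 n) (y2 n)
      - l n * slope_defect (l n) (x1 n) (y1 n) (x2 n) (y2 n))"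
    by (intro null_intros e e' cl)
  have "\<forall>\<^sub>F n in sequentially. (D 1 (x2 n) \<and> D 1 (y2 n)) \<or> (D 1 (x3 n) \<and> D 1 (y3 n))"
    using e[unfolded padic_null_iff, rule_format, of 1] e''[unfolded padic_null_iff, rule_format, of 1]
      n[unfolded pnode_def padic_in_iff, THEN conjunct1] n[unfolded pnode_def padic_in_iff, THEN conjunct2]
  proof eventually_elim
    case (elim n)
    let ?s = "x2 n - x1 n" and ?t = "x3 n - x1 n"
    have "(D 1 ?s \<and> D 1 (l n * ?s)) \<or> (D 1 ?t \<and> D 1 (l n * ?t))"
    proof (rule second_singular_intersection[OF a1 a2 elim(3)])
      show "D 1 (weq_dy E (x1 n) (y1 n))" "D 1 (weq_mdx E (x1 n) (y1 n))"
        using singular_point_partials[OF elim(3,4)] by auto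
      show "?s + ?t = l n ^ 2 + wa1 E * l n - wa2 E - 3 * x1 n" by (simp add: x3 third_x_def)
      show "D 1 (?s * ?t + l n * weq_dy E (x1 n) (y1 n) - weq_mdx E (x1 n) (y1 n))"
        using elim(2) unfolding x3 third_root_product[of "x2 n" "x1 n" E "l n" "y1 n" "y2 n"] .
    qed
    moreover have "y2 n = y1 n + l n * ?s + slope_defect (l n) (x1 n) (y1 n) (x2 n) (y2 n)"
      by (simp add: slope_defect_def)
    ultimately show ?case
      using pclose_add[OF elim(3), of ?s] pclose_add[OF elim(3), of ?t]
        pclose_add[OF pclose_add[OF elim(4)] elim(1), of "l n * ?s"]
        pclose_add[OF elim(4), of "l n * ?t"] y3[of n] by auto
  qed
  \<comment> \<open>So far the valid alternative might change from one index to the next; stability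
    of membership turns it into an alternative about the limits.\<close>
  moreover note cauchy_stable[OF c(3), of 1] cauchy_stable[OF c(4), of 1]
    cauchy_stable[OF cx3, of 1] cauchy_stable[OF cy3, of 1]
  ultimately have "\<forall>\<^sub>F n in sequentially. pnode x2 y2 \<or> pnode x3 y3"
    by eventually_elim (auto simp: pnode_def)
  thus ?thesis by simp
qed

lemma opposite_pnode:
  assumes "opposite E x1 y1 x2 y2"
  shows "pnode x1 y1 \<longleftrightarrow> pnode x2 y2"
proof -
  have z: "padic_null p (\<lambda>n. x1 n - x2 n)" "padic_null p (\<lambda>n. y1 n + y2 n + wa1 E * x2 n + wa3 E)"
    using assms by (auto simp: opposite_def padic_eq_def)
  have x: "padic_in p 1 x1 \<longleftrightarrow> padic_in p 1 x2"
    using padic_in_add_cancel[OF padic_null_in[OF z(1)], of 1 x2] by simp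
  have y: "padic_in p 1 y1 \<longleftrightarrow> padic_in p 1 (\<lambda>n. - y2 n - wa1 E * x2 n - wa3 E)"
    using padic_in_add_cancel[OF padic_null_in[OF z(2)], of 1 "\<lambda>n. - y2 n - wa1 E * x2 n - wa3 E"]
    by (simp add: algebra_simps)
  have "pnode x1 y1 \<longleftrightarrow> pnode x2 (\<lambda>n. - y2 n - wa1 E * x2 n - wa3 E)" using x y by (simp add: pnode_def)
  thus ?thesis by (simp add: pnode_neg)
qed

text \<open>The chord argument started at the third point, whose companions on the line are the two
  given points.\<close>

lemma node_third_cancel:
  assumes P: "on_curve E x1 y1" and Q: "on_curve E x2 y2" and sl: "is_slope E l x1 y1 x2 y2"
    and n: "node (third_point E l x1 y1 x2)"
  shows "pnode x1 y1 \<or> pnode x2 y2"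
proof -
  obtain x3 y3 where t: "third_point E l x1 y1 x2 = Some (x3, y3)" by (auto simp: third_point_def Let_def)
  have y3: "y3 n = y1 n + l n * (x3 n - x1 n)" for n
    using t by (auto simp: third_point_def Let_def)
  have s: "is_slope E l x3 y3 x1 y1" and x2: "x2 n = third_x E (l n) (x1 n) (x3 n)" for n
    using is_slope_third[OF sl t] is_slope_swap by (auto dest: fun_cong)
  have R: "on_curve E x3 y3" using third_point_on_curve[OF P Q sl] t by simp
  \<comment> \<open>Rereading the line from the third point returns the second abscissa exactly, but
    the second ordinate only up to the slope defect.\<close>
  have "third_point E l x3 y3 x1 = Some (x2, \<lambda>n. y3 n + l n * (x2 n - x3 n))"
    unfolding third_point_def Let_def by (simp add: fun_eq_iff x2 third_x_def)
  from slope_pnode[OF _ _ _ _ s this] P R n t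
  consider "pnode x1 y1" | "pnode x2 (\<lambda>n. y3 n + l n * (x2 n - x3 n))" by (auto simp: on_curve_def)
  thus ?thesis
  proof cases
    case 2
    have "padic_in p 1 (\<lambda>n. slope_defect (l n) (x1 n) (y1 n) (x2 n) (y2 n) + (y3 n + l n * (x2 n - x3 n)))"
      using 2 sl by (auto simp: is_slope_def pnode_def intro: padic_in_add[OF padic_null_in])
    also have "(\<lambda>n. slope_defect (l n) (x1 n) (y1 n) (x2 n) (y2 n) + (y3 n + l n * (x2 n - x3 n))) = y2"
      by (simp add: fun_eq_iff slope_defect_def y3 algebra_simps)
    finally show ?thesis using 2 by (simp add: pnode_def)
  qed auto
qed

lemma node_add_mixed:
  assumes P: "P \<in> qp_points p E" and Q: "Q \<in> qp_points p E" and n: "node P \<noteq> node Q"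
  shows "node (qp_add p E P Q)"
proof (cases "P = None \<or> Q = None")
  case True
  thus ?thesis using n by auto
next
  case False
  then obtain x1 y1 x2 y2 where PQ: "P = Some (x1, y1)" "Q = Some (x2, y2)" by auto
  have no: "\<not> opposite E x1 y1 x2 y2" using n opposite_pnode by (auto simp: PQ)
  have P: "on_curve E x1 y1" and Q: "on_curve E x2 y2" using P Q by (simp_all add: PQ)
  obtain l where sl: "is_slope E l x1 y1 x2 y2"
    and add: "qp_add p E (Some (x1, y1)) (Some (x2, y2)) = qp_neg E (third_point E l x1 y1 x2)"
    using qp_add_slope[OF P Q no] by blast
  obtain x3 y3 where t: "third_point E l x1 y1 x2 = Some (x3, y3)" by (auto simp: third_point_def Let_def)
  show ?thesis
  proof (cases "node P")
    case True
    thus ?thesis using slope_pnode[OF _ _ _ _ sl t] P Q n PQ add t by (auto simp: on_curve_def pnode_neg)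
  next
    case False
    hence n2: "pnode x2 y2" and n1: "\<not> pnode x1 y1" using n PQ by auto
    \<comment> \<open>\<open>slope_pnode\<close> wants the singular point first. Exchanging the
      points keeps the third abscissa and moves the third ordinate by a null sequence.\<close>
    obtain x4 y4 where t': "third_point E l x2 y2 x1 = Some (x4, y4)" by (auto simp: third_point_def Let_def)
    have "pnode x4 y4"
      using slope_pnode[OF _ _ _ _ is_slope_swap[OF sl] t' n2] P Q n1 by (auto simp: on_curve_def)
    moreover have "x4 = x3" and y4: "y4 = (\<lambda>n. slope_defect (l n) (x1 n) (y1 n) (x2 n) (y2 n) + y3 n)"
      using t t' by (auto simp: third_point_def Let_def third_x_def slope_defect_def algebra_simps)
    moreover have "padic_in p 1 y4 \<longleftrightarrow> padic_in p 1 y3"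
      unfolding y4 using sl by (intro padic_in_add_cancel padic_null_in) (simp add: is_slope_def)
    ultimately have "pnode x3 y3" by (simp add: pnode_def)
    thus ?thesis using add t by (simp add: PQ pnode_neg)
  qed
qed

lemma node_add_smooth:
  assumes P: "P \<in> qp_points p E" and Q: "Q \<in> qp_points p E" and n: "\<not> node P" "\<not> node Q"
  shows "\<not> node (qp_add p E P Q)"
proof (cases "P = None \<or> Q = None")
  case True
  thus ?thesis using n by auto
next
  case False
  then obtain x1 y1 x2 y2 where PQ: "P = Some (x1, y1)" "Q = Some (x2, y2)" by auto
  have P: "on_curve E x1 y1" and Q: "on_curve E x2 y2" using P Q by (simp_all add: PQ)
  show ?thesis
  proof (cases "opposite E x1 y1 x2 y2")
    case True
    thus ?thesis by (simp add: PQ qp_add_opposite)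
  next
    case no: False
    obtain l where sl: "is_slope E l x1 y1 x2 y2"
      and add: "qp_add p E (Some (x1, y1)) (Some (x2, y2)) = qp_neg E (third_point E l x1 y1 x2)"
      using qp_add_slope[OF P Q no] by blast
    show ?thesis using node_third_cancel[OF P Q sl] n PQ add by auto
  qed
qed

text \<open>Modulo \<open>p\<close>, the direction (1, l) lies on the tangent cone y^2 + a1 x y - a2
  x^2 of the singular point.\<close>

definition tangent :: "qseq \<Rightarrow> bool" where
  "tangent l \<longleftrightarrow> padic_in p 1 (\<lambda>n. l n ^ 2 + wa1 E * l n - wa2 E)"

text \<open>With both abscissas vanishing modulo \<open>p\<close>, \<open>third_x\<close> reduces to
  the tangent cone form in \<open>l\<close>. A tangent slope is integral, so the third ordinate then
  vanishes as well.\<close>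

lemma node_third_iff:
  assumes "pnode x1 y1" "pnode x2 y2"
  shows "node (third_point E l x1 y1 x2) \<longleftrightarrow> tangent l"
proof -
  define x3 where "x3 n = third_x E (l n) (x1 n) (x2 n)" for n
  have "padic_in p 1 (\<lambda>n. - x1 n + - x2 n)"
    using assms by (intro padic_in_add) (simp_all add: padic_in_minus pnode_def)
  hence x3_in: "padic_in p 1 x3 \<longleftrightarrow> tangent l"
    using padic_in_add_cancel[of 1 "\<lambda>n. - x1 n + - x2 n" "\<lambda>n. l n ^ 2 + wa1 E * l n - wa2 E"]
    by (simp add: tangent_def x3_def[abs_def] third_x_def algebra_simps)
  have "padic_in p 1 (\<lambda>n. y1 n + l n * (x3 n - x1 n))" if tg: "tangent l"
  proof -
    have "padic_in p 1 x3" using tg by (simp add: x3_in)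
    hence "\<forall>\<^sub>F n in sequentially. D 1 (x3 n)" "\<forall>\<^sub>F n in sequentially. D 1 (x1 n)"
      "\<forall>\<^sub>F n in sequentially. D 1 (y1 n)"
      "\<forall>\<^sub>F n in sequentially. D 1 (l n ^ 2 + wa1 E * l n - wa2 E)"
      using assms(1) tg by (simp_all add: pnode_def tangent_def padic_in_iff)
    thus ?thesis
      unfolding padic_in_iff
    proof eventually_elim
      case (elim n)
      have "D 0 (l n ^ 2 + wa1 E * l n - wa2 E + wa2 E)"
        by (intro pclose_add a2 pclose_mono[OF elim(4)]) simp
      hence "D 0 (l n * (l n + wa1 E))" by (simp add: algebra_simps power2_eq_square)
      from monic_quadratic_integral[OF a1 this] have "D 0 (l n)" .
      thus ?case using elim by (intro pclose_add pclose_0_mult(1) pclose_diff) auto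
    qed
  qed
  thus ?thesis using x3_in by (auto simp: third_point_def Let_def pnode_def x3_def[abs_def])
qed

text \<open>\<open>opp\<close> is a case of its own, since the sum is then \<open>None\<close> and
  \<open>qp_add_slope\<close> supplies no slope. The inequality in \<open>tan\<close> appears
  because a tangent slope makes the third point singular, that is, the difference lies outside
  E_0.\<close>

lemma index_E0_invariant:
  fixes \<phi> :: "qp_point \<Rightarrow> 'a"
  assumes node: "\<And>P Q. P \<in> qp_points p E \<Longrightarrow> Q \<in> qp_points p E \<Longrightarrow> \<not> node Q \<Longrightarrow> \<phi> P = \<phi> Q \<longleftrightarrow> \<not> node P"
    and opp: "\<And>x1 y1 x2 y2. on_curve E x1 y1 \<Longrightarrow> on_curve E x2 y2 \<Longrightarrow> pnode x1 y1 \<Longrightarrow> pnode x2 y2 \<Longrightarrow>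
       opposite E x1 y1 x2 y2 \<Longrightarrow> \<phi> (Some (x1, y1)) = \<phi> (qp_neg E (Some (x2, y2)))"
    and tan: "\<And>x1 y1 x2 y2 l. on_curve E x1 y1 \<Longrightarrow> on_curve E x2 y2 \<Longrightarrow> pnode x1 y1 \<Longrightarrow> pnode x2 y2 \<Longrightarrow>
       is_slope E l x1 y1 x2 y2 \<Longrightarrow> tangent l \<longleftrightarrow> \<phi> (Some (x1, y1)) \<noteq> \<phi> (qp_neg E (Some (x2, y2)))"
  shows "index_E0 p E = card (\<phi> ` qp_points p E)"
proof (rule index_E0_eq_card)
  fix P Q assume P: "P \<in> qp_points p E" and Q: "Q \<in> qp_points p E"
  define Q' where "Q' = qp_neg E Q"
  have Q': "Q' \<in> qp_points p E" "Q = qp_neg E Q'" and nQ: "node Q' \<longleftrightarrow> node Q" using Q by (simp_all add: Q'_def)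
  have "qp_add p E P Q' \<in> qp_points0 p E \<longleftrightarrow> \<not> node (qp_add p E P Q')"
    by (rule qp_points0_iff[OF qp_add_points[OF P Q'(1)]])
  also have "\<dots> \<longleftrightarrow> \<phi> P = \<phi> Q"
  proof (cases "node P \<and> node Q'")
    case False
    thus ?thesis
      using node_add_mixed[OF P Q'(1)] node_add_smooth[OF P Q'(1)] node[OF P Q] node[OF Q P] nQ by metis
  next
    case True
    then obtain x1 y1 x2 y2 where PQ: "P = Some (x1, y1)" "Q' = Some (x2, y2)"
      by (cases P; cases Q') auto
    have P: "on_curve E x1 y1" and Q: "on_curve E x2 y2" using P Q' by (simp_all add: PQ)
    have n: "pnode x1 y1" "pnode x2 y2" using True by (simp_all add: PQ)
    show ?thesis
    proof (cases "opposite E x1 y1 x2 y2")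
      case o: True
      thus ?thesis using opp[OF P Q n o] PQ Q'(2) by (simp add: qp_add_opposite)
    next
      case no: False
      obtain l where sl: "is_slope E l x1 y1 x2 y2"
        and add: "qp_add p E (Some (x1, y1)) (Some (x2, y2)) = qp_neg E (third_point E l x1 y1 x2)"
        using qp_add_slope[OF P Q no] by blast
      show ?thesis using tan[OF P Q n sl] node_third_iff[OF n, of l] add PQ Q'(2) by auto
    qed
  qed
  finally show "qp_add p E P (qp_neg E Q) \<in> qp_points0 p E \<longleftrightarrow> \<phi> P = \<phi> Q" by (simp add: Q'_def)
qed

lemma index_E0_eq_1:
  assumes "\<And>x y. on_curve E x y \<Longrightarrow> \<not> pnode x y"
  shows "index_E0 p E = 1"
proof -
  have n: "\<not> node P" if "P \<in> qp_points p E" for P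
  proof (cases P)
    case (Some xy)
    thus ?thesis using assms[of "fst xy" "snd xy"] that by (cases xy) simp
  qed simp
  have "index_E0 p E = card ((\<lambda>P. ()) ` qp_points p E)"
  proof (rule index_E0_invariant[of "\<lambda>P. ()"])
    show "() = () \<longleftrightarrow> \<not> node P" if "P \<in> qp_points p E" for P using n[OF that] by simp
    show "tangent l \<longleftrightarrow> () \<noteq> ()" if "on_curve E x1 y1" "pnode x1 y1" for x1 y1 l
      using assms[OF that(1)] that(2) by contradiction
  qed (rule refl)
  also have "(\<lambda>P. ()) ` qp_points p E = {()}" by (rule image_constant[OF qp_points_None])
  finally show ?thesis by simp
qed

text \<open>If no slope between singular points is tangent, two such points always add to a
  nonsingular one, so \<open>node\<close> itself is a complete invariant.\<close>

lemma index_E0_eq_2: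
  assumes "on_curve E x y" "pnode x y"
    and tan: "\<And>x1 y1 x2 y2 l. on_curve E x1 y1 \<Longrightarrow> on_curve E x2 y2 \<Longrightarrow> pnode x1 y1 \<Longrightarrow> pnode x2 y2 \<Longrightarrow>
       is_slope E l x1 y1 x2 y2 \<Longrightarrow> \<not> tangent l"
  shows "index_E0 p E = 2"
proof -
  have "index_E0 p E = card (node ` qp_points p E)"
  proof (rule index_E0_invariant)
    show "tangent l \<longleftrightarrow> node (Some (x1, y1)) \<noteq> node (qp_neg E (Some (x2, y2)))"
      if "on_curve E x1 y1" "on_curve E x2 y2" "pnode x1 y1" "pnode x2 y2" "is_slope E l x1 y1 x2 y2"
      for x1 y1 x2 y2 l
      using tan[OF that] that by (simp add: pnode_neg)
  qed (simp_all add: pnode_neg)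
  also have "node ` qp_points p E = UNIV"
  proof -
    have "node (Some (x, y)) \<in> node ` qp_points p E" "node None \<in> node ` qp_points p E"
      using assms by (intro imageI; simp)+
    hence "True \<in> node ` qp_points p E" "False \<in> node ` qp_points p E" using assms by simp_all
    thus ?thesis by (auto simp: UNIV_bool)
  qed
  finally show ?thesis by simp
qed

end

section \<open>Changes of variables and minimal models\<close>

definition wc4 :: "wcurve \<Rightarrow> rat" where "wc4 E = wb2 E ^ 2 - 24 * wb4 E"
definition wc6 :: "wcurve \<Rightarrow> rat" where "wc6 E = - (wb2 E ^ 3) + 36 * wb2 E * wb4 E - 216 * wb6 E"

lemma wtransform_sel [simp]:
  "wa1 (wtransform u r s t E) = (wa1 E + 2 * s) / u"
  "wa2 (wtransform u r s t E) = (wa2 E - s * wa1 E + 3 * r - s ^ 2) / u ^ 2"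
  "wa3 (wtransform u r s t E) = (wa3 E + r * wa1 E + 2 * t) / u ^ 3"
  "wa4 (wtransform u r s t E) = (wa4 E - s * wa3 E + 2 * r * wa2 E - (t + r * s) * wa1 E + 3 * r ^ 2 - 2 * s * t) / u ^ 4"
  "wa6 (wtransform u r s t E) = (wa6 E + r * wa4 E + r ^ 2 * wa2 E + r ^ 3 - t * wa3 E - t ^ 2 - r * t * wa1 E) / u ^ 6"
  by (simp_all add: wtransform_def)

lemma wb8_rel: "4 * wb8 E = wb2 E * wb6 E - wb4 E ^ 2"
  by (simp add: wb2_def wb4_def wb6_def wb8_def algebra_simps power2_eq_square)

text \<open>Reduces the transformation rule of the discriminant to those of \<open>wc4\<close> and
  \<open>wc6\<close>. It also makes c6 a unit whenever c4 is one and \<open>p\<close> divides the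
  discriminant.\<close>

lemma wdisc_c4_c6: "1728 * wdisc E = wc4 E ^ 3 - wc6 E ^ 2"
proof -
  have b8: "wb8 E = (wb2 E * wb6 E - wb4 E ^ 2) / 4" using wb8_rel[of E] by simp
  show ?thesis unfolding wdisc_def wc4_def wc6_def b8
    by (simp add: field_simps power2_eq_square power3_eq_cube)
qed

context
  fixes u r s t :: rat and E :: wcurve
  assumes u: "u \<noteq> 0"
begin

lemma wb2_transform: "wb2 (wtransform u r s t E) = (wb2 E + 12 * r) / u ^ 2"
  using u by (simp add: wb2_def field_simps power2_eq_square)

lemma wb4_transform: "wb4 (wtransform u r s t E) = (wb4 E + r * wb2 E + 6 * r ^ 2) / u ^ 4"
proof -
  have e: "x / u * (y / u ^ 3) = x * y / u ^ 4" for x y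
    using u by (simp add: power_numeral_reduce)
  show ?thesis
    unfolding wb4_def wtransform_sel e unfolding times_divide_eq_right add_divide_distrib[symmetric]
    by (simp add: wb2_def algebra_simps power2_eq_square)
qed

lemma wb6_transform:
  "wb6 (wtransform u r s t E) = (wb6 E + 2 * r * wb4 E + r ^ 2 * wb2 E + 4 * r ^ 3) / u ^ 6"
proof -
  have "wa3 (wtransform u r s t E) ^ 2 = (wa3 E + r * wa1 E + 2 * t) ^ 2 / u ^ 6"
    using u by (simp add: power_divide flip: power_mult)
  thus ?thesis using u
    unfolding wb6_def by (simp add: add_divide_distrib[symmetric])
      (simp add: wb2_def wb4_def algebra_simps power2_eq_square power3_eq_cube)
qed

lemma wb8_transform:
  "wb8 (wtransform u r s t E)
     = (wb8 E + 3 * r * wb6 E + 3 * r ^ 2 * wb4 E + r ^ 3 * wb2 E + 3 * r ^ 4) / u ^ 8"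
proof -
  have "4 * wb8 (wtransform u r s t E)
    = ((wb2 E + 12 * r) * (wb6 E + 2 * r * wb4 E + r ^ 2 * wb2 E + 4 * r ^ 3)
       - (wb4 E + r * wb2 E + 6 * r ^ 2) ^ 2) / u ^ 8"
    using u unfolding wb8_rel wb2_transform wb4_transform wb6_transform
    by (simp add: power_divide diff_divide_distrib flip: power_add power_mult)
  also have "\<dots> = 4 * (wb8 E + 3 * r * wb6 E + 3 * r ^ 2 * wb4 E + r ^ 3 * wb2 E + 3 * r ^ 4) / u ^ 8"
  proof -
    have "(wb2 E + 12 * r) * (wb6 E + 2 * r * wb4 E + r ^ 2 * wb2 E + 4 * r ^ 3)
       - (wb4 E + r * wb2 E + 6 * r ^ 2) ^ 2
      = 4 * wb8 E + 4 * (3 * r * wb6 E + 3 * r ^ 2 * wb4 E + r ^ 3 * wb2 E + 3 * r ^ 4)"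
      unfolding wb8_rel by (simp add: algebra_simps power_numeral_reduce)
    thus ?thesis by simp
  qed
  finally have "4 * wb8 (wtransform u r s t E)
    = 4 * ((wb8 E + 3 * r * wb6 E + 3 * r ^ 2 * wb4 E + r ^ 3 * wb2 E + 3 * r ^ 4) / u ^ 8)"
    by (simp only: times_divide_eq_right)
  thus ?thesis by (simp only: mult_cancel_left) simp
qed

lemma wc4_transform: "wc4 (wtransform u r s t E) = wc4 E / u ^ 4"
  using u unfolding wc4_def wb2_transform wb4_transform
  by (simp add: power_divide flip: power_mult)
    (simp add: field_simps power2_eq_square)

lemma wc6_transform: "wc6 (wtransform u r s t E) = wc6 E / u ^ 6"
proof -
  have "wc6 (wtransform u r s t E) = (- ((wb2 E + 12 * r) ^ 3) + 36 * (wb2 E + 12 * r) * (wb4 E + r * wb2 E + 6 * r ^ 2)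
      - 216 * (wb6 E + 2 * r * wb4 E + r ^ 2 * wb2 E + 4 * r ^ 3)) / u ^ 6"
  proof -
    have e: "36 * (x / u ^ 2) * (y / u ^ 4) = 36 * x * y / u ^ 6" "(x / u ^ 2) ^ 3 = x ^ 3 / u ^ 6" for x y
      using u by (simp_all add: power_numeral_reduce)
    show ?thesis
      unfolding wc6_def wb2_transform wb4_transform wb6_transform e unfolding times_divide_eq_right
      by (simp only: add_divide_distrib diff_divide_distrib minus_divide_left)
  qed
  also have "\<dots> = wc6 E / u ^ 6"
    unfolding wc6_def by (simp add: algebra_simps power2_eq_square power3_eq_cube)
  finally show ?thesis .
qed

lemma wdisc_transform: "wdisc (wtransform u r s t E) = wdisc E / u ^ 12"
proof -
  have "1728 * wdisc (wtransform u r s t E) = (wc4 E ^ 3 - wc6 E ^ 2) / u ^ 12"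
    using u unfolding wdisc_c4_c6 wc4_transform wc6_transform
    by (simp add: power_divide diff_divide_distrib flip: power_mult)
  thus ?thesis by (simp flip: wdisc_c4_c6)
qed

end

lemma wtransform_id: "wtransform 1 0 0 0 E = E"
  by (cases E) (simp add: wtransform_def)

lemma wtransform_comp:
  assumes "u \<noteq> 0" "v \<noteq> 0"
  shows "wtransform v r' s' t' (wtransform u r s t E)
    = wtransform (u * v) (r + u ^ 2 * r') (s + u * s') (t + u ^ 3 * t' + u ^ 2 * s * r') E"
proof (rule wcurve.expand, intro conjI)
  let ?L = "wtransform v r' s' t' (wtransform u r s t E)"
    and ?R = "wtransform (u * v) (r + u ^ 2 * r') (s + u * s') (t + u ^ 3 * t' + u ^ 2 * s * r') E"
  show "wa1 ?L = wa1 ?R" "wa2 ?L = wa2 ?R" "wa3 ?L = wa3 ?R" "wa4 ?L = wa4 ?R" "wa6 ?L = wa6 ?R"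
    using assms by (simp_all add: field_simps power_numeral_reduce)
qed

lemma q_isomorphic_refl: "q_isomorphic E E"
  unfolding q_isomorphic_def by (metis wtransform_id one_neq_zero)

lemma q_isomorphic_trans: "q_isomorphic E E' \<Longrightarrow> q_isomorphic E' E'' \<Longrightarrow> q_isomorphic E E''"
  unfolding q_isomorphic_def using wtransform_comp by (metis mult_eq_0_iff)

lemma wtransform_inverse:
  assumes "u \<noteq> 0"
  shows "wtransform (1 / u) (- r / u ^ 2) (- s / u) ((r * s - t) / u ^ 3) (wtransform u r s t E) = E"
proof -
  have "t + u ^ 3 * ((r * s - t) / u ^ 3) + u ^ 2 * s * (- r / u ^ 2) = 0"
    using assms by (simp add: field_simps)
  thus ?thesis using assms by (subst wtransform_comp) (simp_all add: wtransform_id)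
qed

lemma q_isomorphic_sym: "q_isomorphic E E' \<Longrightarrow> q_isomorphic E' E"
  unfolding q_isomorphic_def using wtransform_inverse
  by (metis divide_eq_0_iff one_neq_zero)

text \<open>Stated for arbitrary relations because \<open>coset_rel\<close> is not known to be an
  equivalence: its classes are merely the image sets of single elements, and \<open>f\<close>
  carries these over.\<close>

lemma card_quotient_bij:
  assumes f: "bij_betw f A B" and R: "R \<subseteq> A \<times> A" and S: "S \<subseteq> B \<times> B"
    and RS: "\<And>x y. x \<in> A \<Longrightarrow> y \<in> A \<Longrightarrow> (x, y) \<in> R \<longleftrightarrow> (f x, f y) \<in> S"
  shows "card (A // R) = card (B // S)"
proof -
  have B: "B = f ` A" and inj: "inj_on f A" using f by (auto simp: bij_betw_def)
  have cls: "S `` {f x} = f ` (R `` {x})" if "x \<in> A" for x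
    using that R S RS unfolding B by auto
  have "B // S = (\<lambda>X. f ` X) ` (A // R)"
    unfolding quotient_def B using cls by auto
  moreover have "inj_on (\<lambda>X. f ` X) (A // R)"
  proof (rule inj_onI)
    fix X Y assume "X \<in> A // R" "Y \<in> A // R" "f ` X = f ` Y"
    thus "X = Y" using inj_on_image_eq_iff[OF inj, of X Y] R by (auto simp: quotient_def)
  qed
  ultimately show ?thesis by (simp add: card_image)
qed

section \<open>Integral changes of variables preserve the index\<close>

context padic
begin

definition smooth :: "wcurve \<Rightarrow> qseq \<Rightarrow> qseq \<Rightarrow> bool" where
  "smooth E x y \<longleftrightarrow> \<not> padic_in p 0 x \<or>
     \<not> (padic_in p 1 (\<lambda>n. weq_dy E (x n) (y n)) \<and> padic_in p 1 (\<lambda>n. weq_mdx E (x n) (y n)))"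

lemma qp_points0_Some: "Some (x, y) \<in> qp_points0 p E \<longleftrightarrow> on_curve E x y \<and> smooth E x y"
  by (simp add: qp_points0_def smooth_def weq_dy_def weq_mdx_def)

lemma qp_points0_None: "None \<in> qp_points0 p E"
  by (simp add: qp_points0_def)

lemma smooth_cong:
  assumes "\<forall>\<^sub>F n in sequentially. x n = x' n" "\<forall>\<^sub>F n in sequentially. y n = y' n"
  shows "smooth E x y \<longleftrightarrow> smooth E x' y'"
proof -
  have "padic_in p k (\<lambda>n. f (x n) (y n)) \<longleftrightarrow> padic_in p k (\<lambda>n. f (x' n) (y' n))" for f :: "rat \<Rightarrow> rat \<Rightarrow> rat" and k
  proof (rule padic_in_cong)
    show "\<forall>\<^sub>F n in sequentially. f (x n) (y n) = f (x' n) (y' n)"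
      using assms by eventually_elim simp
  qed
  from this[of _ "\<lambda>x y. x"] this[of _ "weq_dy E"] this[of _ "weq_mdx E"] show ?thesis
    unfolding smooth_def by simp
qed

context
  fixes u r s t :: rat and E E' :: wcurve
  assumes u: "punit u" and r: "D 0 r" and s: "D 0 s" and t: "D 0 t"
    and E': "E' = wtransform u r s t E"
begin

definition tx :: "rat \<Rightarrow> rat" where "tx x = (x - r) / u ^ 2"
definition ty :: "rat \<Rightarrow> rat \<Rightarrow> rat" where "ty x y = (y - s * (x - r) - t) / u ^ 3"

definition tpoint :: "qp_point \<Rightarrow> qp_point" where
  "tpoint P = map_option (\<lambda>(x, y). (\<lambda>n. tx (x n), \<lambda>n. ty (x n) (y n))) P"

lemma u_nz: "u \<noteq> 0" using u by (simp add: punit_nz)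

lemma weq_tx: "weq E' (tx x) (ty x y) = weq E x y / u ^ 6"
proof -
  define X Y where "X = tx x" and "Y = ty x y"
  have x: "x = u ^ 2 * X + r" using u_nz by (simp add: X_def tx_def)
  have y: "y = u ^ 3 * Y + s * u ^ 2 * X + t"
    using u_nz by (simp add: X_def Y_def tx_def ty_def)
  have "weq E' X Y * u ^ 6 = weq E x y"
    unfolding weq_def E' x y wtransform_sel using u_nz
    by (simp add: field_simps power_numeral_reduce)
  thus ?thesis using u_nz by (simp add: X_def Y_def field_simps)
qed

lemma weq_dy_tx: "weq_dy E' (tx x) (ty x y) = weq_dy E x y / u ^ 3"
  using u_nz by (simp add: weq_dy_def E' tx_def ty_def field_simps power_numeral_reduce)

lemma weq_mdx_tx: "weq_mdx E' (tx x) (ty x y) = (weq_mdx E x y - s * weq_dy E x y) / u ^ 4"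
  using u_nz by (simp add: weq_mdx_def weq_dy_def E' tx_def ty_def field_simps power_numeral_reduce)

lemma third_x_tx: "third_x E' ((l - s) / u) (tx x1) (tx x2) = tx (third_x E l x1 x2)"
  using u_nz by (simp add: third_x_def E' tx_def field_simps power_numeral_reduce)

lemma ty_neg: "- ty x y - wa1 E' * tx x - wa3 E' = ty x (- y - wa1 E * x - wa3 E)"
  using u_nz by (simp add: E' tx_def ty_def field_simps power_numeral_reduce)

lemma ty_line: "ty x1 y1 + (l - s) / u * (tx x3 - tx x1) = ty x3 (y1 + l * (x3 - x1))"
  using u_nz by (simp add: tx_def ty_def field_simps power_numeral_reduce)

lemma smooth_tx: "smooth E' (\<lambda>n. tx (x n)) (\<lambda>n. ty (x n) (y n)) \<longleftrightarrow> smooth E x y"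
proof -
  have 0: "padic_in p 0 (\<lambda>n. tx (x n)) \<longleftrightarrow> padic_in p 0 x"
    using padic_in_add_cancel[of 0 "\<lambda>n. - r" x] r
    by (simp add: tx_def in_punit_mult_iff(2)[OF punit_power[OF u]] padic_in_const)
  have 1: "padic_in p 1 (\<lambda>n. weq_dy E' (tx (x n)) (ty (x n) (y n))) \<longleftrightarrow> padic_in p 1 (\<lambda>n. weq_dy E (x n) (y n))"
    by (simp add: weq_dy_tx in_punit_mult_iff(2)[OF punit_power[OF u]])
  have 2: "padic_in p 1 (\<lambda>n. weq_mdx E' (tx (x n)) (ty (x n) (y n))) \<longleftrightarrow> padic_in p 1 (\<lambda>n. weq_mdx E (x n) (y n))"
    if a: "padic_in p 1 (\<lambda>n. weq_dy E (x n) (y n))"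
  proof -
    have "\<forall>\<^sub>F n in sequentially. D 1 (- (s * weq_dy E (x n) (y n)))"
      using a unfolding padic_in_iff by eventually_elim (simp add: pclose_0_mult(1)[OF s])
    hence "padic_in p 1 (\<lambda>n. - (s * weq_dy E (x n) (y n)))" by (simp add: padic_in_iff)
    from padic_in_add_cancel[OF this, of "\<lambda>n. weq_mdx E (x n) (y n)"] show ?thesis
      by (simp add: weq_mdx_tx in_punit_mult_iff(2)[OF punit_power[OF u]])
  qed
  show ?thesis unfolding smooth_def 0 1 using 2 by auto
qed

lemma cauchy_tx:
  assumes "padic_cauchy p x" "padic_cauchy p y"
  shows "padic_cauchy p (\<lambda>n. tx (x n))" "padic_cauchy p (\<lambda>n. ty (x n) (y n))"
proof -
  have "padic_cauchy p (\<lambda>n. (1 / u ^ 2) * (x n - r))" "padic_cauchy p (\<lambda>n. (1 / u ^ 3) * (y n - s * (x n - r) - t))"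
    by (intro cauchy_intros assms)+
  thus "padic_cauchy p (\<lambda>n. tx (x n))" "padic_cauchy p (\<lambda>n. ty (x n) (y n))"
    by (simp_all add: tx_def ty_def)
qed

lemma null_divide_const: "c \<noteq> 0 \<Longrightarrow> padic_null p (\<lambda>n. x n / c) \<longleftrightarrow> padic_null p x"
  using null_const_mult_iff[of "1 / c" x] by simp

lemma on_curve_tx: "on_curve E x y \<Longrightarrow> on_curve E' (\<lambda>n. tx (x n)) (\<lambda>n. ty (x n) (y n))"
  using u_nz by (auto simp: on_curve_def cauchy_tx weq_tx null_divide_const)

lemma on_curve_txD:
  assumes "on_curve E' X Y"
  obtains x y where "on_curve E x y" "X = (\<lambda>n. tx (x n))" "Y = (\<lambda>n. ty (x n) (y n))"
proof -
  define x where "x n = u ^ 2 * X n + r" for n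
  define y where "y n = u ^ 3 * Y n + s * u ^ 2 * X n + t" for n
  have c: "padic_cauchy p X" "padic_cauchy p Y" and z: "padic_null p (\<lambda>n. weq E' (X n) (Y n))"
    using assms by (auto simp: on_curve_def)
  have X: "X = (\<lambda>n. tx (x n))" and Y: "Y = (\<lambda>n. ty (x n) (y n))"
    using u_nz by (simp_all add: fun_eq_iff x_def y_def tx_def ty_def)
  have "padic_cauchy p x" "padic_cauchy p y" unfolding x_def y_def by (intro cauchy_intros c)+
  moreover have "padic_null p (\<lambda>n. weq E (x n) (y n))"
    using z u_nz by (simp add: X Y weq_tx null_divide_const)
  ultimately show ?thesis using that X Y by (simp add: on_curve_def)
qed

lemma tpoint_bij: "bij_betw tpoint (qp_points p E) (qp_points p E')"
proof (rule bij_betw_imageI)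
  show "inj_on tpoint (qp_points p E)"
  proof (rule inj_onI)
    fix P Q assume "tpoint P = tpoint Q"
    thus "P = Q" using u_nz
      by (cases P; cases Q) (auto simp: tpoint_def fun_eq_iff tx_def ty_def)
  qed
  show "tpoint ` qp_points p E = qp_points p E'"
  proof (intro equalityI subsetI)
    fix Q assume "Q \<in> tpoint ` qp_points p E"
    then obtain P where P: "P \<in> qp_points p E" "Q = tpoint P" by blast
    show "Q \<in> qp_points p E'"
      using P by (cases P) (auto simp: tpoint_def on_curve_tx)
  next
    fix Q assume Q: "Q \<in> qp_points p E'"
    show "Q \<in> tpoint ` qp_points p E"
    proof (cases Q)
      case None
      hence "Q = tpoint None" by (simp add: tpoint_def)
      thus ?thesis by (rule image_eqI) simp
    next
      case (Some XY)
      then obtain X Y where XY: "Q = Some (X, Y)" by (cases XY) auto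
      then obtain x y where "on_curve E x y" "X = (\<lambda>n. tx (x n))" "Y = (\<lambda>n. ty (x n) (y n))"
        using Q on_curve_txD[of X Y] by auto
      thus ?thesis by (intro image_eqI[of _ _ "Some (x, y)"]) (auto simp: tpoint_def XY)
    qed
  qed
qed

lemma tpoint_neg: "tpoint (qp_neg E P) = qp_neg E' (tpoint P)"
  by (cases P) (auto simp: tpoint_def ty_neg)

lemma opposite_tx:
  "opposite E' (\<lambda>n. tx (x1 n)) (\<lambda>n. ty (x1 n) (y1 n)) (\<lambda>n. tx (x2 n)) (\<lambda>n. ty (x2 n) (y2 n))
     \<longleftrightarrow> opposite E x1 y1 x2 y2"
proof -
  have "tx (x1 n) - tx (x2 n) = (x1 n - x2 n) / u ^ 2" for n
    by (simp add: tx_def diff_divide_distrib)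
  hence 1: "padic_eq p (\<lambda>n. tx (x1 n)) (\<lambda>n. tx (x2 n)) \<longleftrightarrow> padic_eq p x1 x2"
    using u_nz by (simp add: padic_eq_def null_divide_const)
  have e: "ty (x1 n) (y1 n) + ty (x2 n) (y2 n) + wa1 E' * tx (x2 n) + wa3 E'
      = (- s * (x1 n - x2 n) + (y1 n + y2 n + wa1 E * x2 n + wa3 E)) / u ^ 3" for n
    using u_nz by (simp add: E' tx_def ty_def field_simps power_numeral_reduce)
  have 2: "padic_null p (\<lambda>n. - s * (x1 n - x2 n) + (y1 n + y2 n + wa1 E * x2 n + wa3 E))
      \<longleftrightarrow> padic_null p (\<lambda>n. y1 n + y2 n + wa1 E * x2 n + wa3 E)" if "padic_eq p x1 x2"
  proof -
    have z: "padic_null p (\<lambda>n. - s * (x1 n - x2 n))"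
      using that unfolding padic_eq_def by (intro null_mult_cauchy(2) cauchy_intros)
    show ?thesis
      using padic_null_add[OF z, of "\<lambda>n. y1 n + y2 n + wa1 E * x2 n + wa3 E"]
        padic_null_diff[OF _ z, of "\<lambda>n. - s * (x1 n - x2 n) + (y1 n + y2 n + wa1 E * x2 n + wa3 E)"]
      by auto
  qed
  show ?thesis unfolding opposite_def 1 e using 2 u_nz by (auto simp: null_divide_const)
qed

text \<open>Membership in E_0 is compared rather than the sums themselves: termwise slopes may
  divide by zero at finitely many indices, and there the two sums can differ.\<close>

lemma qp_add_points0_tpoint:
  assumes P: "P \<in> qp_points p E" and Q: "Q \<in> qp_points p E"
  shows "qp_add p E' (tpoint P) (tpoint Q) \<in> qp_points0 p E' \<longleftrightarrow> qp_add p E P Q \<in> qp_points0 p E"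
proof -
  have t0: "tpoint P \<in> qp_points0 p E' \<longleftrightarrow> P \<in> qp_points0 p E" if "P \<in> qp_points p E" for P
    using that on_curve_tx
    by (cases P) (auto simp: tpoint_def qp_points0_Some qp_points0_None smooth_tx)
  show ?thesis
  proof (cases "P = None \<or> Q = None")
    case True
    moreover have "tpoint None = None" by (simp add: tpoint_def)
    ultimately show ?thesis using t0 P Q by auto
  next
    case False
    then obtain x1 y1 x2 y2 where PQ: "P = Some (x1, y1)" "Q = Some (x2, y2)" by auto
    have P: "on_curve E x1 y1" and Q: "on_curve E x2 y2" using P Q by (simp_all add: PQ)
    define X1 Y1 X2 Y2 where "X1 = (\<lambda>n. tx (x1 n))" and "Y1 = (\<lambda>n. ty (x1 n) (y1 n))"
      and "X2 = (\<lambda>n. tx (x2 n))" and "Y2 = (\<lambda>n. ty (x2 n) (y2 n))"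
    have TPQ: "tpoint P = Some (X1, Y1)" "tpoint Q = Some (X2, Y2)"
      by (simp_all add: PQ tpoint_def X1_def Y1_def X2_def Y2_def)
    have P': "on_curve E' X1 Y1" and Q': "on_curve E' X2 Y2"
      using on_curve_tx[OF P] on_curve_tx[OF Q] by (simp_all add: X1_def Y1_def X2_def Y2_def)
    have opp: "opposite E' X1 Y1 X2 Y2 \<longleftrightarrow> opposite E x1 y1 x2 y2"
      unfolding X1_def Y1_def X2_def Y2_def by (rule opposite_tx)
    show ?thesis
    proof (cases "opposite E x1 y1 x2 y2")
      case True
      thus ?thesis using opp by (simp add: TPQ) (simp add: PQ qp_add_opposite qp_points0_None)
    next
      case no: False
      define l where "l = (if padic_eq p x1 x2 then (\<lambda>n. weq_mdx E (x1 n) (y1 n) / weq_dy E (x1 n) (y1 n))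
          else (\<lambda>n. (y2 n - y1 n) / (x2 n - x1 n)))"
      define l' where "l' = (if padic_eq p X1 X2 then (\<lambda>n. weq_mdx E' (X1 n) (Y1 n) / weq_dy E' (X1 n) (Y1 n))
          else (\<lambda>n. (Y2 n - Y1 n) / (X2 n - X1 n)))"
      have eq: "padic_eq p X1 X2 \<longleftrightarrow> padic_eq p x1 x2"
      proof -
        have "X1 n - X2 n = (x1 n - x2 n) / u ^ 2" for n
          by (simp add: X1_def X2_def tx_def diff_divide_distrib)
        thus ?thesis using u_nz by (simp add: padic_eq_def null_divide_const)
      qed
      \<comment> \<open>The change of variables acts on slopes by l -> (l - s) / u, once the
        denominators are nonzero.\<close>
      have ll: "\<forall>\<^sub>F n in sequentially. l' n = (l n - s) / u"
      proof (cases "padic_eq p x1 x2")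
        case True
        have "\<forall>\<^sub>F n in sequentially. weq_dy E (x1 n) (y1 n) \<noteq> 0"
          using P by (intro not_null_nonzero same_abscissa_not_opposite(2)[OF P Q no True])
            (auto simp: weq_dy_def on_curve_def intro!: cauchy_intros)
        thus ?thesis
        proof eventually_elim
          case (elim n)
          have "l' n = ((weq_mdx E (x1 n) (y1 n) - s * weq_dy E (x1 n) (y1 n)) / u ^ 4) / (weq_dy E (x1 n) (y1 n) / u ^ 3)"
            using True eq by (simp add: l'_def X1_def Y1_def weq_mdx_tx weq_dy_tx)
          also have "\<dots> = (weq_mdx E (x1 n) (y1 n) - s * weq_dy E (x1 n) (y1 n)) / weq_dy E (x1 n) (y1 n) / u"
            using u_nz by (simp add: power_numeral_reduce)
          also have "\<dots> = (l n - s) / u"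
            using elim True by (simp add: l_def diff_divide_distrib)
          finally show ?case .
        qed
      next
        case False
        have "\<not> padic_null p (\<lambda>n. x1 n - x2 n)" using False by (simp add: padic_eq_def)
        hence "\<forall>\<^sub>F n in sequentially. x1 n - x2 n \<noteq> 0"
          using P Q by (intro not_null_nonzero) (auto simp: on_curve_def intro!: cauchy_intros)
        thus ?thesis
        proof eventually_elim
          case (elim n)
          hence nz: "x2 n - x1 n \<noteq> 0" by simp
          have "l' n = ((y2 n - y1 n - s * (x2 n - x1 n)) / u ^ 3) / ((x2 n - x1 n) / u ^ 2)"
          proof -
            have "Y2 n - Y1 n = (y2 n - y1 n - s * (x2 n - x1 n)) / u ^ 3"
              by (simp add: Y1_def Y2_def ty_def diff_divide_distrib[symmetric] algebra_simps)
            moreover have "X2 n - X1 n = (x2 n - x1 n) / u ^ 2"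
              by (simp add: X1_def X2_def tx_def diff_divide_distrib)
            ultimately show ?thesis using False eq by (simp add: l'_def)
          qed
          also have "\<dots> = (y2 n - y1 n - s * (x2 n - x1 n)) / (x2 n - x1 n) / u"
            using u_nz by (simp add: power_numeral_reduce)
          also have "\<dots> = (l n - s) / u"
            using nz False by (simp add: l_def diff_divide_distrib[of "y2 n - y1 n"])
          finally show ?case .
        qed
      qed
      define x3 where "x3 n = third_x E (l n) (x1 n) (x2 n)" for n
      define y3 where "y3 n = - (y1 n + l n * (x3 n - x1 n)) - wa1 E * x3 n - wa3 E" for n
      define X3 where "X3 n = third_x E' (l' n) (X1 n) (X2 n)" for n
      define Y3 where "Y3 n = - (Y1 n + l' n * (X3 n - X1 n)) - wa1 E' * X3 n - wa3 E'" for n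
      have a: "qp_add p E P Q = Some (x3, y3)"
        unfolding PQ qp_add_eq[OF no, folded l_def] third_point_def Let_def qp_neg_simps
        by (simp add: x3_def[abs_def] y3_def[abs_def])
      have a': "qp_add p E' (tpoint P) (tpoint Q) = Some (X3, Y3)"
        unfolding TPQ qp_add_eq[OF no[folded opp], folded l'_def] third_point_def Let_def qp_neg_simps
        by (simp add: X3_def[abs_def] Y3_def[abs_def])
      have X3: "\<forall>\<^sub>F n in sequentially. X3 n = tx (x3 n)"
        using ll by eventually_elim (simp add: X3_def x3_def X1_def X2_def third_x_tx)
      have Y3: "\<forall>\<^sub>F n in sequentially. Y3 n = ty (x3 n) (y3 n)"
        using X3 ll by eventually_elim (simp only: Y3_def Y1_def X1_def y3_def ty_line ty_neg)
      have "smooth E' X3 Y3 \<longleftrightarrow> smooth E x3 y3"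
        using smooth_cong[OF X3 Y3] smooth_tx by simp
      moreover have "on_curve E x3 y3"
        using qp_add_points[of P E Q] P Q unfolding a by (simp add: PQ)
      moreover have "on_curve E' X3 Y3"
        using qp_add_points[of "tpoint P" E' "tpoint Q"] P' Q' unfolding a' unfolding TPQ by simp
      ultimately show ?thesis unfolding a a' by (simp add: qp_points0_Some)
    qed
  qed
qed

lemma index_E0_transform: "index_E0 p E' = index_E0 p E"
proof -
  have "card (qp_points p E // coset_rel p E) = card (qp_points p E' // coset_rel p E')"
  proof (rule card_quotient_bij[OF tpoint_bij])
    fix P Q assume P: "P \<in> qp_points p E" and Q: "Q \<in> qp_points p E"
    have "tpoint P \<in> qp_points p E'" "tpoint Q \<in> qp_points p E'"
      using tpoint_bij P Q by (auto simp: bij_betw_def)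
    thus "(P, Q) \<in> coset_rel p E \<longleftrightarrow> (tpoint P, tpoint Q) \<in> coset_rel p E'"
      using P Q qp_add_points0_tpoint[of P "qp_neg E Q"]
      by (auto simp: coset_rel_def tpoint_neg)
  qed (auto simp: coset_rel_def)
  thus ?thesis by (simp add: index_E0_def)
qed

end

section \<open>Minimal models and their uniqueness\<close>

lemma p_integral_b:
  assumes "p_integral p E"
  shows "D 0 (wb2 E)" "D 0 (wb4 E)" "D 0 (wb6 E)" "D 0 (wb8 E)" "D 0 (wc4 E)" "D 0 (wc6 E)" "D 0 (wdisc E)"
proof -
  have a: "D 0 (wa1 E)" "D 0 (wa2 E)" "D 0 (wa3 E)" "D 0 (wa4 E)" "D 0 (wa6 E)"
    using assms by (auto simp: p_integral_def)
  note i = pclose_add pclose_diff pclose_0_mult(1) pclose_numeral a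
  have sq: "D 0 (x ^ 2)" if "D 0 x" for x using pclose_power[OF that, of 2] by simp
  have cu: "D 0 (x ^ 3)" if "D 0 x" for x using pclose_power[OF that, of 3] by simp
  show b: "D 0 (wb2 E)" "D 0 (wb4 E)" "D 0 (wb6 E)" "D 0 (wb8 E)"
    unfolding wb2_def wb4_def wb6_def wb8_def by (intro i sq)+
  show "D 0 (wc4 E)" "D 0 (wc6 E)" "D 0 (wdisc E)"
    unfolding wc4_def wc6_def wdisc_def by (intro i b sq cu pclose_minus[THEN iffD2])+
qed

text \<open>The rules for \<open>wb8\<close> and \<open>wb6\<close> make \<open>r\<close> a root of
  polynomials with p-integral coefficients, of degree 4 with leading coefficient 3 and of degree 3
  with leading coefficient 4; the second serves p = 3. A pole of \<open>r\<close> would let the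
  leading term dominate. Then \<open>s\<close> and \<open>t\<close> are roots of monic quadratics
  read off \<open>wa2\<close> and \<open>wa6\<close>.\<close>

lemma integral_isomorphism:
  assumes E: "p_integral p E" and E': "p_integral p (wtransform u r s t E)" and u: "punit u"
  shows "D 0 r" "D 0 s" "D 0 t"
proof -
  let ?E' = "wtransform u r s t E"
  have unz: "u \<noteq> 0" using u by (rule punit_nz)
  note b = p_integral_b(1-4)[OF E] and b' = p_integral_b(1-4)[OF E']
  have a: "D 0 (wa1 E)" "D 0 (wa2 E)" "D 0 (wa3 E)" "D 0 (wa4 E)" "D 0 (wa6 E)"
    using E by (auto simp: p_integral_def)
  have uk: "D 0 (u ^ k)" for k using punit_power[OF u, of k] by (simp add: punit_def)
  show r: "D 0 r"
  proof (rule ccontr)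
    assume nr: "\<not> D 0 r"
    define d where "d = - vrat p r"
    have v: "r \<noteq> 0" "vrat p r = - d" and d: "d \<ge> 1" using nr by (auto simp: pclose_def d_def)
    have Dr: "D (- d) r" "\<not> D (- d + 1) r" using v by (auto simp: pclose_def)
    have Dk: "D (- int k * d) (r ^ k)" for k using pclose_power[OF Dr(1), of k] by simp
    show False
    proof (cases "p = 3")
      case False
      hence "\<not> p dvd 3" using prime_p primes_dvd_imp_eq[of p 3] by auto
      hence 3: "punit 3" using punit_of_int[of 3] by simp
      have "D (- 3 * d) (wb8 ?E' * u ^ 8 - (wb8 E + 3 * r * wb6 E + 3 * r ^ 2 * wb4 E + r ^ 3 * wb2 E))"
        using d Dk[of 2] Dk[of 3] Dr(1) b b'
        by (intro pclose_diff pclose_add pclose_mult'[of "- 3 * d" "r ^ 3" 0] pclose_mult'[of "- d" "3 * r" 0]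
            pclose_mult'[of "- 2 * d" "3 * r ^ 2" 0] pclose_0_mult(1)[of 3]
            pclose_mult'[of 0 "wb8 ?E'" 0] uk pclose_mono[OF b(4)]) simp_all
      also have "wb8 ?E' * u ^ 8 - (wb8 E + 3 * r * wb6 E + 3 * r ^ 2 * wb4 E + r ^ 3 * wb2 E) = 3 * r ^ 4"
        using unz unfolding wb8_transform[OF unz] by simp
      finally have "D (- 3 * d) (r ^ 4)" by (simp add: punit_mult_iff(1)[OF 3])
      thus False using not_pclose_power[OF Dr(2), of 4 "- 3 * d"] d by simp
    next
      case True
      hence "\<not> p dvd 4" by simp
      hence 4: "punit 4" using punit_of_int[of 4] by simp
      have "D (- 2 * d) (wb6 ?E' * u ^ 6 - (wb6 E + 2 * r * wb4 E + r ^ 2 * wb2 E))"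
        using d Dk[of 2] Dr(1) b b'
        by (intro pclose_diff pclose_add pclose_mult'[of "- 2 * d" "r ^ 2" 0] pclose_mult'[of "- d" "2 * r" 0]
            pclose_0_mult(1)[of 2]
            pclose_mult'[of 0 "wb6 ?E'" 0] uk pclose_mono[OF b(3)]) simp_all
      also have "wb6 ?E' * u ^ 6 - (wb6 E + 2 * r * wb4 E + r ^ 2 * wb2 E) = 4 * r ^ 3"
        using unz unfolding wb6_transform[OF unz] by simp
      finally have "D (- 2 * d) (r ^ 3)" by (simp add: punit_mult_iff(1)[OF 4])
      thus False using not_pclose_power[OF Dr(2), of 3 "- 2 * d"] d by simp
    qed
  qed
  have r2: "D 0 (r ^ 2)" "D 0 (r ^ 3)" using pclose_power[OF r, of 2] pclose_power[OF r, of 3] by simp_all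
  note i = pclose_add pclose_diff pclose_0_mult(1) pclose_numeral
  show s: "D 0 s"
  proof -
    have "D 0 (wa2 E + 3 * r - wa2 ?E' * u ^ 2)"
      using E' by (intro i a r uk) (simp add: p_integral_def)
    also have "wa2 E + 3 * r - wa2 ?E' * u ^ 2 = s * (s + wa1 E)"
    proof -
      have "wa2 ?E' * u ^ 2 = wa2 E - s * wa1 E + 3 * r - s ^ 2" using unz by simp
      thus ?thesis by (simp only:) (simp add: power2_eq_square algebra_simps)
    qed
    finally show ?thesis by (rule monic_quadratic_integral[OF a(1)])
  qed
  show "D 0 t"
  proof -
    have "D 0 (wa6 E + r * wa4 E + r ^ 2 * wa2 E + r ^ 3 - wa6 ?E' * u ^ 6)"
      using E' by (intro i a r r2 uk) (simp add: p_integral_def)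
    also have "wa6 E + r * wa4 E + r ^ 2 * wa2 E + r ^ 3 - wa6 ?E' * u ^ 6 = t * (t + (wa3 E + r * wa1 E))"
    proof -
      have "wa6 ?E' * u ^ 6 = wa6 E + r * wa4 E + r ^ 2 * wa2 E + r ^ 3 - t * wa3 E - t ^ 2 - r * t * wa1 E"
        using unz by simp
      thus ?thesis by (simp only:) (simp add: power2_eq_square algebra_simps)
    qed
    finally show ?thesis by (rule monic_quadratic_integral[rotated]) (intro i a r)
  qed
qed

text \<open>Equal valuations of the discriminants force the scaling \<open>u\<close> to be a unit,
  and then the whole change of variables is integral.\<close>

lemma minimal_models_index:
  assumes el: "elliptic E" and M: "p_minimal_model p E M" and N: "p_minimal_model p E N"
  shows "index_E0 p M = index_E0 p N" "vrat p (wdisc M) = vrat p (wdisc N)"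
proof -
  have qM: "q_isomorphic E M" and iM: "p_integral p M" and qN: "q_isomorphic E N" and iN: "p_integral p N"
    using M N by (auto simp: p_minimal_model_def)
  show v: "vrat p (wdisc M) = vrat p (wdisc N)"
    using M N by (intro antisym) (auto simp: p_minimal_model_def)
  have "q_isomorphic N M" by (rule q_isomorphic_trans[OF q_isomorphic_sym[OF qN] qM])
  then obtain u r s t where u: "u \<noteq> 0" and M': "M = wtransform u r s t N" by (auto simp: q_isomorphic_def)
  obtain u' r' s' t' where u': "u' \<noteq> 0" and N': "N = wtransform u' r' s' t' E"
    using qN by (auto simp: q_isomorphic_def)
  have nz: "wdisc N \<noteq> 0" using el u' by (simp add: N' wdisc_transform elliptic_def)
  have "vrat p (wdisc M) = vrat p (wdisc N) - 12 * vrat p u"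
    using nz u by (simp add: M' wdisc_transform vrat_divide vrat_power)
  hence pu: "punit u" using v u by (simp add: punit_iff)
  from integral_isomorphism[OF iN iM[unfolded M'] pu]
  show "index_E0 p M = index_E0 p N" by (intro index_E0_transform[OF pu _ _ _ M'])
qed

text \<open>A model with smaller discriminant would need a scaling with \<open>vrat p u > 0\<close>,
  which divides the discriminant by \<open>u ^ 12\<close> and c4 by \<open>u ^ 4\<close>;
  integrality of both quotients contradicts \<open>small\<close>.\<close>

lemma minimal_modelI:
  assumes el: "elliptic E" and q: "q_isomorphic E N" and i: "p_integral p N"
    and small: "\<not> D 12 (wdisc N) \<or> \<not> D 4 (wc4 N)"
  shows "p_minimal_model p E N"
  unfolding p_minimal_model_def
proof (intro conjI q i allI impI)
  fix M assume M: "q_isomorphic E M \<and> p_integral p M"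
  have "q_isomorphic N M" by (rule q_isomorphic_trans[OF q_isomorphic_sym[OF q] conjunct1[OF M]])
  then obtain u r s t where u: "u \<noteq> 0" and M': "M = wtransform u r s t N" by (auto simp: q_isomorphic_def)
  obtain u' r' s' t' where u': "u' \<noteq> 0" and N': "N = wtransform u' r' s' t' E"
    using q by (auto simp: q_isomorphic_def)
  have nz: "wdisc N \<noteq> 0" using el u' by (simp add: N' wdisc_transform elliptic_def)
  have v: "vrat p (wdisc M) = vrat p (wdisc N) - 12 * vrat p u"
    using nz u by (simp add: M' wdisc_transform vrat_divide vrat_power)
  have "vrat p u \<le> 0"
  proof (rule ccontr)
    assume pos: "\<not> vrat p u \<le> 0"
    have "D 12 (wdisc N)"
    proof -
      have "D 0 (wdisc M)" by (rule p_integral_b(7)[OF conjunct2[OF M]])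
      thus ?thesis using v pos nz u by (auto simp: pclose_def M' wdisc_transform)
    qed
    moreover have "D 4 (wc4 N)"
    proof (cases "wc4 N = 0")
      case False
      have "D 0 (wc4 M)" by (rule p_integral_b(5)[OF conjunct2[OF M]])
      thus ?thesis using pos u False
        by (auto simp: pclose_def M' wc4_transform vrat_divide vrat_power)
    qed simp
    ultimately show False using small by blast
  qed
  thus "vrat p (wdisc N) \<le> vrat p (wdisc M)" using v by simp
qed

text \<open>Makes the choice by \<open>SOME\<close> harmless: all minimal models share the index and
  the valuation of the discriminant.\<close>

lemma tamagawa_eq_index:
  assumes el: "elliptic E" and N: "p_minimal_model p E N"
  shows "tamagawa p E = index_E0 p N" "bad_reduction p E \<longleftrightarrow> D 1 (wdisc N)"
proof -
  have M: "p_minimal_model p E (minimal_model p E)"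
    unfolding minimal_model_def using N by (rule someI)
  note eq = minimal_models_index[OF el M N]
  show "tamagawa p E = index_E0 p N" using eq by (simp add: tamagawa_def)
  obtain u r s t where u: "u \<noteq> 0" and N': "N = wtransform u r s t E"
    using N by (auto simp: p_minimal_model_def q_isomorphic_def)
  have "wdisc N \<noteq> 0" using el u by (simp add: N' wdisc_transform elliptic_def)
  thus "bad_reduction p E \<longleftrightarrow> D 1 (wdisc N)"
    using eq by (auto simp: bad_reduction_def pclose_def)
qed

end

section \<open>Additive and nonsplit multiplicative reduction\<close>

lemma nonresidue_not_dvd: "\<not> QuadRes p a \<Longrightarrow> \<not> p dvd a"
  unfolding QuadRes_def by (auto simp: cong_iff_dvd_diff dest: spec[of _ 0])

lemma QuadRes_mult_nonresidues:
  fixes p a b :: int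
  assumes p: "prime p" "p > 2" and a: "\<not> QuadRes p a" and b: "\<not> QuadRes p b"
  shows "QuadRes p (a * b)"
proof -
  define h where "h = (nat p - 1) div 2"
  have pn: "prime (nat p)" "2 < nat p" "int (nat p) = p" using p by auto
  have euler: "[Legendre x p = x ^ h] (mod p)" for x
    using euler_criterion[OF pn(1,2), of x] pn(3) by (simp add: h_def)
  have "[- 1 = a ^ h] (mod p)"
    using euler[of a] a nonresidue_not_dvd[OF a] by (simp add: Legendre_def cong_0_iff)
  moreover have "[- 1 = b ^ h] (mod p)"
    using euler[of b] b nonresidue_not_dvd[OF b] by (simp add: Legendre_def cong_0_iff)
  ultimately have "[(- 1) * (- 1) = a ^ h * b ^ h] (mod p)" by (rule cong_mult)
  hence 1: "[Legendre (a * b) p = 1] (mod p)"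
    using cong_trans[OF euler[of "a * b"]] by (simp add: power_mult_distrib cong_sym_eq)
  \<comment> \<open>The Legendre symbol takes the values 0, 1 and -1, and \<open>p > 2\<close> keeps
    1 apart from the other two modulo \<open>p\<close>.\<close>
  have "\<not> p dvd 1" "\<not> p dvd - 2" using p zdvd_not_zless[of 2 p] by auto
  thus ?thesis using 1 by (auto simp: Legendre_def cong_iff_dvd_diff split: if_splits)
qed

text \<open>Otherwise, starting from \<open>1\<close>, all of \<open>1, 1 - m, 1 - 2 m, \<dots>\<close> up to the first
  multiple of \<open>p\<close> would be squares, but the last one before it is congruent to \<open>m\<close>.\<close>

lemma ex_square_minus_nonresidue:
  fixes p m :: int
  assumes p: "prime p" and m: "\<not> QuadRes p m"
  obtains y where "\<not> p dvd y" "\<not> QuadRes p (y ^ 2 - m)"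
proof -
  assume *: "\<And>y. \<not> p dvd y \<Longrightarrow> \<not> QuadRes p (y ^ 2 - m) \<Longrightarrow> thesis"
  have "coprime m p" using nonresidue_not_dvd[OF m] p prime_imp_coprime coprime_commute by blast
  then obtain k0 where k0: "[m * k0 = 1] (mod p)" using cong_solve_coprime_int by blast
  have pp: "p > 0" using p by (simp add: prime_gt_0_int)
  define K where "K k \<longleftrightarrow> p dvd 1 - int k * m" for k
  have "K (nat (k0 mod p))"
  proof -
    have "[(k0 mod p) * m = k0 * m] (mod p)" by (intro cong_mult cong_refl) (simp add: cong_def)
    hence "[(k0 mod p) * m = 1] (mod p)" using cong_trans k0 by (simp add: mult.commute)
    hence "p dvd 1 - (k0 mod p) * m" by (simp add: cong_iff_dvd_diff dvd_diff_commute)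
    thus ?thesis using pp by (simp add: K_def)
  qed
  then obtain k where k: "K k" "\<And>j. j < k \<Longrightarrow> \<not> K j" using exists_least_iff[of K] by blast
  have "\<not> K 0" using p by (auto simp: K_def)
  then obtain j where j: "k = Suc j" using k(1) by (cases k) auto
  show ?thesis
  proof (rule ccontr)
    assume "\<not> thesis"
    hence sq: "QuadRes p (y ^ 2 - m)" if "\<not> p dvd y" for y using that *[of y] by blast
    have "QuadRes p (1 - int i * m)" if "i \<le> j" for i
      using that
    proof (induction i)
      case 0
      show ?case unfolding QuadRes_def by (rule exI[of _ 1]) simp
    next
      case (Suc i)
      then obtain y where y: "[y ^ 2 = 1 - int i * m] (mod p)" by (auto simp: QuadRes_def)
      have "\<not> p dvd 1 - int i * m" using k(2)[of i] Suc.prems j by (simp add: K_def)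
      hence "\<not> p dvd y ^ 2" using cong_dvd_iff[OF y] by simp
      hence "\<not> p dvd y" by (metis dvd_mult2 power2_eq_square)
      then obtain z where "[z ^ 2 = y ^ 2 - m] (mod p)" using sq by (auto simp: QuadRes_def)
      also have "[y ^ 2 - m = 1 - int i * m - m] (mod p)" by (intro cong_diff y cong_refl)
      also have "1 - int i * m - m = 1 - int (Suc i) * m" by (simp add: algebra_simps)
      finally show ?case by (auto simp: QuadRes_def)
    qed
    from this[of j] obtain y where "[y ^ 2 = 1 - int j * m] (mod p)" by (auto simp: QuadRes_def)
    moreover have "[1 - int j * m = m] (mod p)"
      using k(1) by (simp add: K_def j cong_iff_dvd_diff algebra_simps)
    ultimately have "[y ^ 2 = m] (mod p)" by (rule cong_trans)
    with m show False by (auto simp: QuadRes_def)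
  qed
qed

text \<open>Surjectivity of the norm from the quadratic extension of the residue field, with the
  extra condition that \<open>y\<close> be nonzero modulo \<open>p\<close>, which lifting in the
  y-direction needs.\<close>

lemma norm_form_represents:
  fixes p m c :: int
  assumes p: "prime p" "p > 2" and m: "\<not> QuadRes p m" and c: "\<not> p dvd c"
  obtains x y where "\<not> p dvd y" "p dvd y ^ 2 - m * x ^ 2 - c"
proof (cases "QuadRes p c")
  case True
  then obtain y where "[y ^ 2 = c] (mod p)" by (auto simp: QuadRes_def)
  hence y: "p dvd y ^ 2 - c" by (simp add: cong_iff_dvd_diff)
  have "\<not> p dvd y"
  proof
    assume "p dvd y"
    hence "p dvd y ^ 2" by (simp add: power2_eq_square)
    from dvd_diff[OF this y] c show False by simp
  qed
  with y that[of y 0] show ?thesis by simp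
next
  case False
  obtain y where y: "\<not> p dvd y" "\<not> QuadRes p (y ^ 2 - m)"
    using ex_square_minus_nonresidue[OF p(1) m] by blast
  \<comment> \<open>The product of the nonresidues \<open>c\<close> and \<open>e\<close> is a
    square, so \<open>c\<close> is congruent to \<open>e\<close> times a square
    \<open>h ^ 2\<close>. Scaling the pair (y, 1) of norm \<open>e\<close> by \<open>h\<close> gives
    norm \<open>c\<close>.\<close>
  define e where "e = y ^ 2 - m"
  obtain g where g: "[g ^ 2 = c * e] (mod p)"
    using QuadRes_mult_nonresidues[OF p False y(2)] by (auto simp: QuadRes_def e_def)
  have "coprime p e" using nonresidue_not_dvd[OF y(2)] p(1) by (intro prime_imp_coprime) (simp_all add: e_def)
  hence "coprime e p" by (simp add: coprime_commute)
  then obtain f where f: "[e * f = 1] (mod p)" using cong_solve_coprime_int by blast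
  define h where "h = g * f"
  have "[h ^ 2 * e = (g ^ 2) * (e * f) * f] (mod p)" by (simp add: h_def power2_eq_square algebra_simps)
  also have "[(g ^ 2) * (e * f) * f = (c * e) * 1 * f] (mod p)" by (intro cong_mult g f cong_refl)
  also have "(c * e) * 1 * f = c * (e * f)" by simp
  also have "[c * (e * f) = c * 1] (mod p)" by (intro cong_mult f cong_refl)
  finally have he: "p dvd h ^ 2 * e - c" by (simp add: cong_iff_dvd_diff)
  have "\<not> p dvd h"
  proof
    assume "p dvd h"
    hence "p dvd h ^ 2 * e" by (simp add: power2_eq_square)
    from dvd_diff[OF this he] c show False by simp
  qed
  hence "\<not> p dvd h * y" using y(1) p(1) by (simp add: prime_dvd_mult_iff)
  moreover have "(h * y) ^ 2 - m * h ^ 2 - c = h ^ 2 * e - c"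
    by (simp add: e_def algebra_simps power_mult_distrib)
  ultimately show ?thesis using that[of "h * y" h] he by simp
qed

section \<open>Kodaira types II, II* and III\<close>

context padic
begin

lemma on_curve_pointwise:
  assumes "on_curve E x y"
  shows "\<forall>\<^sub>F n in sequentially. D k (weq E (x n) (y n))"
  using assms by (simp add: on_curve_def padic_null_iff)

lemma stable_point:
  assumes "on_curve E x y" "padic_in p 1 x" "padic_in p 1 y"
  obtains n where "D k (weq E (x n) (y n))" "D 1 (x n)" "D 1 (y n)"
proof -
  have "\<forall>\<^sub>F n in sequentially. D k (weq E (x n) (y n)) \<and> D 1 (x n) \<and> D 1 (y n)"
    using assms on_curve_pointwise[OF assms(1), of k] by (simp add: eventually_conj_iff padic_in_iff)
  from eventually_happens'[OF sequentially_bot this] show ?thesis using that by blast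
qed

end

text \<open>For a point reducing to the origin every term of the equation other than
  \<open>wa6 E\<close> lies in p^2.\<close>

lemma (in singular_at_origin) index_E0_valuation_a6_eq_1:
  assumes "\<not> D 2 (wa6 E)"
  shows "index_E0 p E = 1"
proof (rule index_E0_eq_1)
  fix x y assume c: "on_curve E x y"
  show "\<not> pnode x y"
  proof
    assume "pnode x y"
    with c obtain n where n: "D 2 (weq E (x n) (y n))" "D 1 (x n)" "D 1 (y n)"
      using stable_point[of E x y 2] by (auto simp: pnode_def)
    have "D 2 (y n ^ 2 + wa1 E * (x n * y n) + wa3 E * y n - x n ^ 3 - wa2 E * x n ^ 2 - wa4 E * x n - weq E (x n) (y n))"
      using pclose_mult'[OF n(2,3), of 2] pclose_mult'[OF a3 n(3), of 2] pclose_mult'[OF a4 n(2), of 2]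
        pclose_power'[OF n(2), of 2 3] pclose_power'[OF n(2), of 2 2] pclose_power'[OF n(3), of 2 2] n(1)
      by (intro pclose_add pclose_diff pclose_0_mult(1)[OF a1] pclose_0_mult(1)[OF a2]) simp_all
    hence "D 2 (wa6 E)" by (simp add: weq_def algebra_simps)
    with assms show False ..
  qed
qed

context padic
begin

lemma singular_at_originI:
  assumes "D 0 (wa1 E)" "D 0 (wa2 E)" "D 1 (wa3 E)" "D 1 (wa4 E)" "D 1 (wa6 E)"
  shows "singular_at_origin p E"
  by unfold_locales (fact assms)+

lemma index_E0_type_II:
  assumes "D 1 A" "D 1 B" "\<not> D 2 B"
  shows "index_E0 p (WC 0 0 0 A B) = 1"
proof -
  interpret singular_at_origin p "WC 0 0 0 A B"
    by (rule singular_at_originI) (use assms in simp_all)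
  show ?thesis using assms by (intro index_E0_valuation_a6_eq_1) simp
qed

text \<open>Parity obstruction: for a point reducing to the origin, \<open>y ^ 2\<close> would have
  valuation 3 if \<open>x\<close> has valuation 1, and valuation 5 otherwise.\<close>

lemma index_E0_type_II_star:
  assumes A: "D 4 A" and B: "D 5 B" "\<not> D 6 B"
  shows "index_E0 p (WC 0 0 0 A B) = 1"
proof -
  interpret singular_at_origin p "WC 0 0 0 A B"
    by (rule singular_at_originI) (use assms pclose_mono in \<open>simp_all\<close>)
  show ?thesis
  proof (rule index_E0_eq_1)
    fix x y assume c: "on_curve (WC 0 0 0 A B) x y"
    show "\<not> pnode x y"
    proof
      assume "pnode x y"
      with c obtain n where n: "D 6 (weq (WC 0 0 0 A B) (x n) (y n))" "D 1 (x n)" "D 1 (y n)"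
        using stable_point[of "WC 0 0 0 A B" x y 6] by (auto simp: pnode_def)
      have y2: "y n ^ 2 = weq (WC 0 0 0 A B) (x n) (y n) + A * x n + B + x n ^ 3"
        by (simp add: weq_def)
      show False
      proof (cases "D 2 (x n)")
        case True
        have d: "D 6 (weq (WC 0 0 0 A B) (x n) (y n) + A * x n + x n ^ 3)"
          using pclose_mult'[OF A True, of 6] pclose_power'[OF True, of 6 3] n(1)
          by (intro pclose_add) simp_all
        have "D 5 (y n ^ 2)" "\<not> D 6 (y n ^ 2)"
          using pclose_add_cancel[OF d, of B] pclose_add[OF pclose_mono[OF d, of 5] B(1)] B
          by (simp_all add: y2 algebra_simps)
        thus False
          using pclose_power'[of 3 "y n" 6 2] not_pclose_power[of 3 "y n" 2 5] by auto
      next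
        case False
        have d: "D 5 (weq (WC 0 0 0 A B) (x n) (y n) + A * x n + B)"
          using pclose_mult'[OF A n(2), of 5] B pclose_mono[OF n(1), of 5]
          by (intro pclose_add) simp_all
        have x3: "D 3 (x n ^ 3)" "\<not> D 4 (x n ^ 3)"
          using pclose_power'[OF n(2), of 3 3] not_pclose_power[OF False, of 3 4] by simp_all
        have "D 3 (y n ^ 2)" "\<not> D 4 (y n ^ 2)"
          unfolding y2
          using pclose_add_cancel[OF pclose_mono[OF d, of 4], of "x n ^ 3"]
            pclose_add[OF pclose_mono[OF d, of 3] x3(1)] x3 by simp_all
        thus False
          using pclose_power'[of 2 "y n" 4 2] not_pclose_power[of 2 "y n" 2 3] by auto
      qed
    qed
  qed
qed

lemma index_E0_type_III:
  assumes A: "D 1 A" "\<not> D 2 A" and B: "D 2 B"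
  shows "index_E0 p (WC 0 0 0 A B) = 2"
proof -
  let ?E = "WC 0 0 0 A B"
  interpret singular_at_origin p ?E
    by (rule singular_at_originI) (use assms pclose_mono[OF B] in simp_all)
  have A0: "A \<noteq> 0" using A by auto
  let ?p = "of_int p :: rat"
  have Dp: "D 1 ?p" by (simp add: pclose_1_of_int)
  have vA: "\<not> D (1 + 1) A" using A by simp
  \<comment> \<open>The condition for (p w, 0) to lie on the curve, divided by \<open>A * p\<close>
    and solved for its linear term.\<close>
  define G where "G w = - (B / A / ?p) - (?p * ?p / A) * w ^ 3" for w
  have c0: "D 0 (B / A / ?p)"
  proof -
    have "D 1 (B / A)" using pclose_divide_iff[OF A(1) vA, of 1 B] B by simp
    moreover have "\<not> D (1 + 1) ?p" using pclose_p_powi[of 2 1] by simp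
    ultimately show ?thesis using pclose_divide_iff[OF Dp, of 0 "B / A"]
      by (simp del: divide_divide_eq_left)
  qed
  have c1: "D 1 (?p * ?p / A)"
    using pclose_divide_iff[OF A(1) vA, of 1 "?p * ?p"] pclose_mult'[OF Dp Dp, of 2] by simp
  have i3: "D 0 (w ^ 3)" if "D 0 w" for w using pclose_power[OF that, of 3] by simp
  obtain w where w: "padic_cauchy p w" "\<And>n. D 0 (w n)" "padic_null p (\<lambda>n. w n - G (w n))"
  proof (rule contraction_fixpoint[of G])
    fix x assume "D 0 x"
    thus "D 0 (G x)" unfolding G_def using c0 c1
      by (intro pclose_diff pclose_minus[THEN iffD2] pclose_0_mult(1) i3) (auto intro: pclose_mono[OF c1])
  next
    fix x y k assume xy: "D 0 x" "D 0 y" "k \<ge> 0" "D k (x - y)"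
    have "D 0 (x ^ 2 + x * y + y ^ 2)" unfolding power2_eq_square
      by (intro pclose_add pclose_0_mult(1) xy)
    hence "D (k + 1) ((- (?p * ?p / A)) * ((x - y) * (x ^ 2 + x * y + y ^ 2)))"
      using c1 by (intro pclose_mult'[of 1 _ k] pclose_0_mult(2)[OF _ xy(4)]) simp_all
    also have "(- (?p * ?p / A)) * ((x - y) * (x ^ 2 + x * y + y ^ 2)) = G x - G y"
      by (simp add: G_def algebra_simps power2_eq_square power3_eq_cube)
    finally show "D (k + 1) (G x - G y)" .
  qed blast
  have pt: "on_curve ?E (\<lambda>n. ?p * w n) (\<lambda>n. 0)"
  proof -
    have "padic_null p (\<lambda>n. (- A * ?p) * (w n - G (w n)))"
      by (intro null_mult_cauchy(2) w cauchy_const)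
    moreover have "(- A * ?p) * (w n - G (w n)) = weq ?E (?p * w n) 0" for n
      using A0 by (simp add: weq_def G_def algebra_simps power3_eq_cube)
    ultimately show ?thesis by (auto simp: on_curve_def intro!: cauchy_intros w)
  qed
  have "pnode (\<lambda>n. ?p * w n) (\<lambda>n. 0)"
    using pclose_0_mult(2)[OF w(2) Dp] by (simp add: pnode_def padic_in_iff)
  with pt show ?thesis
  proof (rule index_E0_eq_2)
    fix x1 y1 x2 y2 l
    assume n: "pnode x1 y1" "pnode x2 y2" and sl: "is_slope ?E l x1 y1 x2 y2"
    show "\<not> tangent l"
    proof
      assume "tangent l"
      hence "\<forall>\<^sub>F n in sequentially. D 1 (l n ^ 2) \<and> D 1 (x1 n) \<and> D 1 (y1 n) \<and> D 1 (x2 n) \<and> D 1 (y2 n)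
          \<and> D 2 (slope_defect' ?E (l n) (x1 n) (y1 n) (x2 n) (y2 n))"
        using n sl by (simp add: eventually_conj_iff pnode_def tangent_def padic_in_iff is_slope_def padic_null_iff)
      from eventually_happens'[OF sequentially_bot this] obtain n where
        h: "D 1 (l n ^ 2)" "D 1 (x1 n)" "D 1 (y1 n)" "D 1 (x2 n)" "D 1 (y2 n)"
          "D 2 (slope_defect' ?E (l n) (x1 n) (y1 n) (x2 n) (y2 n))" by blast
      have l: "D 1 (l n)" using h(1) not_pclose_power[of 1 "l n" 2 1] by auto
      \<comment> \<open>A tangent slope is divisible by \<open>p\<close>, so every term of the
        second defect except \<open>A\<close> lies in p^2.\<close>
      have "D 2 (l n * (y1 n + y2 n) - x1 n * x1 n - x1 n * x2 n - x2 n * x2 n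
          - slope_defect' ?E (l n) (x1 n) (y1 n) (x2 n) (y2 n))"
        using h l pclose_add[OF h(3,5)] by (intro pclose_diff) (auto intro: pclose_mult')
      hence "D 2 A" by (simp add: slope_defect'_def power2_eq_square)
      with A show False by simp
    qed
  qed
qed

end

section \<open>Nodes with irrational tangents\<close>

locale nonsplit_node = padic +
  fixes a2 a4 a6 :: rat and n :: nat
  assumes odd_p: "p > 2" and n: "n \<ge> 1" and a2_int: "D 0 a2"
    and nonsquare: "\<And>s. D 0 s \<Longrightarrow> \<not> D 1 (s ^ 2 - a2)"
    and a4_in: "D (int n) a4" and a6_in: "D (int n) a6" and a6_not: "\<not> D (int n + 1) a6"
begin

abbreviation E where "E \<equiv> WC 0 a2 0 a4 a6"

sublocale singular_at_origin p E
  by (rule singular_at_originI)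
    (use a2_int n pclose_mono[OF a4_in, of 1] pclose_mono[OF a6_in, of 1] in simp_all)

text \<open>y^2 - a2 x^2 is the norm form of an unramified quadratic extension, so its valuation is
  even, namely twice the minimum of those of \<open>x\<close> and \<open>y\<close>.\<close>

lemma anisotropic:
  assumes "D (2 * k + 1) (y ^ 2 - a2 * x ^ 2)"
  shows "D (k + 1) x" "D (k + 1) y"
proof -
  have "D (k + 1) x \<and> D (k + 1) y"
  proof (cases "x = 0")
    case True
    thus ?thesis using assms not_pclose_power[of "k + 1" y 2 "2 * k + 1"] by auto
  next
    case x: False
    show ?thesis
    proof (cases "D 0 (y / x)")
      case True
      have e: "x ^ 2 * ((y / x) ^ 2 - a2) = y ^ 2 - a2 * x ^ 2"
        using x by (simp add: algebra_simps power_divide)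
      have "D (2 * k + 1) (x ^ 2)"
        using not_pclose_mult[OF _ nonsquare[OF True], of "2 * k + 1" "x ^ 2" "2 * k + 1"] assms e by auto
      hence "D (k + 1) x" using not_pclose_power[of "k + 1" x 2 "2 * k + 1"] by auto
      moreover from this have "D (k + 1) y"
        using pclose_mult'[OF \<open>D (k + 1) x\<close> True, of "k + 1"] x by simp
      ultimately show ?thesis ..
    next
      case False
      hence y: "y \<noteq> 0" by auto
      have "D 1 (x / y)" using False x y by (auto simp: pclose_def vrat_divide)
      hence xy: "D 1 (- (a2 * (x / y) ^ 2))"
        using pclose_power'[of 1 "x / y" 1 2] pclose_0_mult(1)[OF a2_int] by simp
      have e: "y ^ 2 * (1 + - (a2 * (x / y) ^ 2)) = y ^ 2 - a2 * x ^ 2"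
        using y by (simp add: algebra_simps power_divide)
      have "D (2 * k + 1) (y ^ 2)"
        using punit_mult_iff(2)[OF punit_add[OF punit_1 xy], of "2 * k + 1" "y ^ 2"] assms e by simp
      hence dy: "D (k + 1) y" using not_pclose_power[of "k + 1" y 2 "2 * k + 1"] by auto
      have "D (k + 1) x" using pclose_mult'[OF dy \<open>D 1 (x / y)\<close>, of "k + 1"] y by simp
      with dy show ?thesis by simp
    qed
  qed
  thus "D (k + 1) x" "D (k + 1) y" by auto
qed

text \<open>As long as 2k < n, only the norm form survives in the equation modulo p^(2k+1), and each
  application of \<open>anisotropic\<close> gains one digit.\<close>

lemma node_divisible:
  assumes "D (int n + 1) (weq E x y)" "D 1 x" "D 1 y" "k \<ge> 1" "2 * k \<le> n + 1"
  shows "D (int k) x \<and> D (int k) y"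
  using assms(4,5)
proof (induction k rule: nat_induct_at_least)
  case base
  thus ?case using assms by simp
next
  case (Suc k)
  hence k: "D (int k) x" "D (int k) y" "2 * k + 1 \<le> n" by auto
  have "D (2 * int k + 1) (weq E x y + x ^ 3 + a4 * x + a6)"
    using Suc.hyps k(3) pclose_power'[OF k(1), of "2 * int k + 1" 3] pclose_mult'[OF a4_in assms(2), of "2 * int k + 1"]
      pclose_mono[OF a6_in, of "2 * int k + 1"] pclose_mono[OF assms(1), of "2 * int k + 1"]
    by (intro pclose_add) simp_all
  also have "weq E x y + x ^ 3 + a4 * x + a6 = y ^ 2 - a2 * x ^ 2" by (simp add: weq_def)
  finally show ?case using anisotropic[of "int k" y x] by (simp add: add.commute)
qed

lemma index_E0_odd:
  assumes "odd n"
  shows "index_E0 p E = 1"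
proof (rule index_E0_eq_1)
  fix x y assume c: "on_curve E x y"
  show "\<not> pnode x y"
  proof
    assume "pnode x y"
    with c obtain m where m: "D (int n + 1) (weq E (x m) (y m))" "D 1 (x m)" "D 1 (y m)"
      using stable_point[of E x y "int n + 1"] by (auto simp: pnode_def)
    \<comment> \<open>For odd \<open>n\<close> the descent reaches 2k = n + 1, one digit beyond the
      valuation of \<open>a6\<close>.\<close>
    define k where "k = (n + 1) div 2"
    have k: "k \<ge> 1" "2 * k = n + 1" using assms n by (auto simp: k_def elim!: oddE)
    have d: "D (int k) (x m)" "D (int k) (y m)" using node_divisible[OF m k(1)] k by auto
    have kn: "int n + 1 = 2 * int k" using k by linarith
    have "D (int n + 1) (y m * y m - a2 * (x m * x m) - x m ^ 3 - a4 * x m - weq E (x m) (y m))"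
      using k kn pclose_mult'[OF d(2,2), of "int n + 1"] pclose_mult'[OF d(1,1), of "int n + 1"]
        pclose_power'[OF d(1), of "int n + 1" 3] pclose_mult'[OF a4_in m(2), of "int n + 1"] m(1)
      by (intro pclose_diff pclose_0_mult(1)[OF a2_int]) simp_all
    hence "D (int n + 1) a6" by (simp add: weq_def power2_eq_square)
    with a6_not show False ..
  qed
qed

lemma ex_pnode:
  assumes "n = 2 * k"
  obtains x y where "on_curve E x y" "pnode x y"
proof -
  have k: "k \<ge> 1" using assms n by simp
  let ?p = "of_int p :: rat"
  \<comment> \<open>Scale by x = q X, y = q Y and divide by \<open>q ^ 2\<close>: modulo
    \<open>p\<close> the equation becomes Y^2 = a2 X^2 + b6 with \<open>b6\<close> a unit, and the
    norm form represents every unit residue.\<close>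
  define q where "q = ?p ^ k"
  have q0: "q \<noteq> 0" by (simp add: q_def)
  have Dp: "D 1 ?p" by (simp add: pclose_1_of_int)
  have "vrat p q = int k" by (simp add: q_def vrat_power)
  hence Dq: "D (int k) q" "\<not> D (int k + 1) q" using q0 by (auto simp: pclose_def)
  have Dq2: "D (int n) (q ^ 2)" "\<not> D (int n + 1) (q ^ 2)"
    using pclose_power'[OF Dq(1), of "int n" 2] not_pclose_power[OF Dq(2), of 2 "int n + 1"] assms by simp_all
  define b4 where "b4 = a4 / q"
  define b6 where "b6 = a6 / q ^ 2"
  have b4: "D 1 b4"
    unfolding b4_def pclose_divide_iff[OF Dq] by (rule pclose_mono[OF a4_in]) (use assms k in simp)
  have b6: "D 0 b6" "\<not> D 1 b6"
    unfolding b6_def pclose_divide_iff[OF Dq2] using a6_in a6_not by (simp_all add: add.commute)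
  obtain m where m: "D 1 (a2 - of_int m)" using int_approx[OF a2_int] .
  obtain c where c: "D 1 (b6 - of_int c)" using int_approx[OF b6(1)] .
  have "\<not> QuadRes p m"
  proof
    assume "QuadRes p m"
    then obtain s where "p dvd s ^ 2 - m" by (auto simp: QuadRes_def cong_iff_dvd_diff)
    hence "D 1 (of_int (s ^ 2 - m))" by (simp only: pclose_1_of_int)
    from pclose_diff[OF this m] have "D 1 (of_int s ^ 2 - a2)" by simp
    with nonsquare[of "of_int s"] show False by simp
  qed
  moreover have "\<not> p dvd c"
  proof
    assume "p dvd c"
    hence "D 1 (of_int c)" by (simp add: pclose_1_of_int)
    from pclose_add[OF c this] b6(2) show False by simp
  qed
  ultimately obtain x0 y0 where xy: "\<not> p dvd y0" "p dvd y0 ^ 2 - m * x0 ^ 2 - c"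
    using norm_form_represents[OF prime_p odd_p] by blast
  define X Y where "X = (of_int x0 :: rat)" and "Y = (of_int y0 :: rat)"
  have X: "D 0 X" by (simp add: X_def)
  have Y: "punit Y" using xy(1) by (simp add: Y_def punit_of_int)
  have "\<not> p dvd 2" using odd_p zdvd_not_zless[of 2 p] by simp
  hence 2: "punit 2" using punit_of_int[of 2] by simp
  have Y2: "punit (2 * Y)" by (rule punit_mult[OF 2 Y])
  have Y0: "Y \<noteq> 0" using Y by (rule punit_nz)
  define R where "R = a2 * X ^ 2 + q * X ^ 3 + b4 * X + b6"
  have R: "D 1 (R - Y ^ 2)"
  proof -
    have 1: "D 1 (of_int (y0 ^ 2 - m * x0 ^ 2 - c))" using xy(2) by (simp only: pclose_1_of_int)
    have 2: "D 1 ((a2 - of_int m) * X ^ 2)" "D 1 (q * X ^ 3)" "D 1 (b4 * X)"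
      using k pclose_power[OF X, of 2] pclose_power[OF X, of 3]
      by (intro pclose_0_mult(2) m b4 X pclose_mono[OF Dq(1)]; simp)+
    from pclose_diff[OF pclose_add[OF pclose_add[OF pclose_add[OF 2(1) 2(2)] 2(3)] c] 1]
    have "D 1 ((a2 - of_int m) * X ^ 2 + q * X ^ 3 + b4 * X + (b6 - of_int c) - (Y ^ 2 - of_int m * X ^ 2 - of_int c))"
      by (simp add: X_def Y_def)
    thus ?thesis by (simp add: R_def algebra_simps power2_eq_square power3_eq_cube)
  qed
  \<comment> \<open>Keep \<open>X\<close> and correct \<open>Y\<close> to Y + p z: the equation (Y +
    p z)^2 = R, divided by 2 Y p, reads z = C - F z^2.\<close>
  define C where "C = (R - Y ^ 2) / ?p / (2 * Y)"
  have C: "D 0 C"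
  proof -
    have "\<not> D (1 + 1) ?p" using pclose_p_powi[of 2 1] by simp
    hence "D 0 ((R - Y ^ 2) / ?p)" using pclose_divide_iff[OF Dp, of 0] R by simp
    thus ?thesis unfolding C_def by (simp only: punit_divide_iff[OF Y2])
  qed
  define F where "F = ?p / (2 * Y)"
  have F: "D 1 F" unfolding F_def by (simp only: punit_divide_iff[OF Y2] Dp)
  define G where "G z = C - F * z ^ 2" for z
  obtain z where z: "padic_cauchy p z" "\<And>n. D 0 (z n)" "padic_null p (\<lambda>n. z n - G (z n))"
  proof (rule contraction_fixpoint[of G])
    fix x assume "D 0 x"
    thus "D 0 (G x)" unfolding G_def power2_eq_square
      by (intro pclose_diff C pclose_0_mult(1) pclose_mono[OF F]) simp_all
  next
    fix x y k assume xy: "D 0 x" "D 0 y" "k \<ge> 0" "D k (x - y)"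
    have "D (k + 1) ((- F) * ((x - y) * (x + y)))"
      using F by (intro pclose_mult'[of 1 _ k] pclose_0_mult(2)[OF _ xy(4)] pclose_add xy) simp_all
    also have "(- F) * ((x - y) * (x + y)) = G x - G y"
      by (simp add: G_def algebra_simps power2_eq_square)
    finally show "D (k + 1) (G x - G y)" .
  qed blast
  have "on_curve E (\<lambda>n. q * X) (\<lambda>n. q * (Y + ?p * z n))"
  proof -
    have "padic_null p (\<lambda>n. (q ^ 2 * ?p * (2 * Y)) * (z n - G (z n)))"
      by (intro null_mult_cauchy(2) z cauchy_const)
    moreover have "(q ^ 2 * ?p * (2 * Y)) * (z n - G (z n)) = weq E (q * X) (q * (Y + ?p * z n))" for n
    proof -
      have "?p * (2 * Y) * C = R - Y ^ 2" "?p * (2 * Y) * F = ?p ^ 2"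
        using Y0 by (simp_all add: C_def F_def power2_eq_square)
      moreover have "?p * (2 * Y) * (z n - G (z n))
          = ?p * (2 * Y) * z n - ?p * (2 * Y) * C + ?p * (2 * Y) * F * z n ^ 2"
        by (simp add: G_def algebra_simps)
      ultimately have "?p * (2 * Y) * (z n - G (z n)) = ?p * (2 * Y) * z n - (R - Y ^ 2) + ?p ^ 2 * z n ^ 2"
        by (simp only:)
      hence "?p * (2 * Y) * (z n - G (z n)) = (Y + ?p * z n) ^ 2 - R"
        by (simp add: algebra_simps power2_eq_square)
      moreover have "q ^ 2 * R = (q * X) ^ 3 + a2 * (q * X) ^ 2 + a4 * (q * X) + a6"
        using q0 by (simp add: R_def b4_def b6_def field_simps power2_eq_square power3_eq_cube)
      moreover from this have "weq E (q * X) (q * (Y + ?p * z n)) = q ^ 2 * ((Y + ?p * z n) ^ 2 - R)"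
        by (simp add: weq_def power_mult_distrib[of q "Y + _"] right_diff_distrib)
      ultimately show ?thesis by (simp add: mult.assoc)
    qed
    ultimately show ?thesis by (auto simp: on_curve_def intro!: cauchy_intros z)
  qed
  moreover have "pnode (\<lambda>n. q * X) (\<lambda>n. q * (Y + ?p * z n))"
  proof -
    have "D 0 Y" using Y by (simp add: punit_def)
    hence "D 1 (q * X)" "D 1 (q * (Y + ?p * z n))" for n
      using k by (intro pclose_0_mult(2) pclose_mono[OF Dq(1)] X pclose_add pclose_0_mult(1) z(2); simp)+
    thus ?thesis by (simp add: pnode_def padic_in_iff)
  qed
  ultimately show ?thesis using that by blast
qed

lemma index_E0_even:
  assumes "even n"
  shows "index_E0 p E = 2"
proof -
  obtain k where "n = 2 * k" using assms by (elim evenE)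
  then obtain x y where "on_curve E x y" "pnode x y" using ex_pnode by blast
  thus ?thesis
  proof (rule index_E0_eq_2)
    fix l
    show "\<not> tangent l"
    proof
      assume "tangent l"
      hence "\<forall>\<^sub>F n in sequentially. D 1 (l n ^ 2 - a2)" by (simp add: tangent_def padic_in_iff)
      from eventually_happens'[OF sequentially_bot this] obtain n where h: "D 1 (l n ^ 2 - a2)" by blast
      from pclose_add[OF pclose_mono[OF h, of 0] a2_int] have "D 0 (l n ^ 2)" by simp
      hence "D 0 (l n)" using not_pclose_power[of 0 "l n" 2 0] by auto
      with h nonsquare show False by blast
    qed
  qed
qed

end

section \<open>Split multiplicative reduction\<close>

text \<open>Near a split node the curve looks like \<open>u * v = a6\<close>, where \<open>u = y\<close> and
  \<open>v = y + a1 * x + a3\<close>, so the components are indexed by the valuation of \<open>u\<close>. The cubic term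
  disturbs the larger of the two valuations, whence the case distinction.\<close>

definition component :: "nat \<Rightarrow> nat \<Rightarrow> nat \<Rightarrow> nat" where
  "component n i j = (if i \<le> j then i else n - j)"

locale split_node = padic +
  fixes E :: wcurve and n :: nat
  assumes n: "n \<ge> 1" and a1_unit: "punit (wa1 E)"
    and a2_in: "D (int n) (wa2 E)" and a3_in: "D (int n) (wa3 E)" and a4_in: "D (int n) (wa4 E)"
    and a6_in: "D (int n) (wa6 E)" and a6_not: "\<not> D (int n + 1) (wa6 E)"
begin

sublocale singular_at_origin p E
  using a1_unit n a2_in a3_in a4_in a6_in
  by unfold_locales (simp_all add: punit_def pclose_mono[of "int n" _ 0] pclose_mono[of "int n" _ 1])

definition vof :: "rat \<Rightarrow> rat \<Rightarrow> rat" where "vof x y = y + wa1 E * x + wa3 E"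

text \<open>Valuation capped at \<open>n\<close>: everything divisible by p^n counts as
  \<open>n\<close>.\<close>

definition has_val :: "nat \<Rightarrow> rat \<Rightarrow> bool" where
  "has_val i u \<longleftrightarrow> i \<le> n \<and> (\<forall>k\<le>n. D (int k) u \<longleftrightarrow> k \<le> i)"

lemma has_valD: "has_val i u \<Longrightarrow> D (int i) u" "has_val i u \<Longrightarrow> i < n \<Longrightarrow> \<not> D (int i + 1) u"
proof -
  assume h: "has_val i u"
  thus "D (int i) u" by (auto simp: has_val_def)
  assume "i < n"
  hence "D (int (Suc i)) u \<longleftrightarrow> Suc i \<le> i" using h unfolding has_val_def by (metis Suc_leI)
  thus "\<not> D (int i + 1) u" by (simp add: add.commute)
qed

text \<open>Snapshot of a point at a late index. The equation is needed modulo p^(n+1), the first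
  power at which \<open>wa6 E\<close> is visibly nonzero.\<close>

definition local_point :: "rat \<Rightarrow> rat \<Rightarrow> nat \<Rightarrow> nat \<Rightarrow> bool" where
  "local_point x y i j \<longleftrightarrow> D (int n + 1) (weq E x y) \<and> D 1 x \<and> D 1 y
     \<and> has_val i y \<and> has_val j (vof x y) \<and> 1 \<le> i \<and> 1 \<le> j"

lemma weq_uv: "weq E x y = y * vof x y - x ^ 3 - wa2 E * x ^ 2 - wa4 E * x - wa6 E"
  by (simp add: weq_def vof_def algebra_simps power2_eq_square)

lemma local_point_x:
  assumes "local_point x y i j"
  shows "D (int (min i j)) x"
proof -
  have h: "has_val i y" "has_val j (vof x y)" using assms by (auto simp: local_point_def)
  have "D (int (min i j)) (vof x y - y - wa3 E)"
    using h pclose_mono[OF has_valD(1)[OF h(1)]] pclose_mono[OF has_valD(1)[OF h(2)]] pclose_mono[OF a3_in]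
    by (intro pclose_diff) (auto simp: has_val_def)
  hence "D (int (min i j)) (wa1 E * x)" by (simp add: vof_def)
  thus ?thesis by (simp only: punit_mult_iff(1)[OF a1_unit])
qed

text \<open>Balance of valuations in y * vof = x^3 + a6 + small terms. If both the product and the
  cube were divisible by p^(n+1), so would a6 be; if the two valuations agreed below n/2, the
  product would have exact valuation 2i, which the right side exceeds. Hence either both equal n/2
  or the smaller one is below n/2 and they differ.\<close>

lemma local_point_shape:
  assumes P: "local_point x y i j"
  shows "2 * min i j \<le> n" "i = j \<Longrightarrow> 2 * i = n" "2 * min i j = n \<Longrightarrow> i = j"
proof -
  define m where "m = min i j"
  have w: "D (int n + 1) (weq E x y)" and x1: "D 1 x" and h: "has_val i y" "has_val j (vof x y)"
    and ij: "1 \<le> i" "1 \<le> j"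
    using P by (auto simp: local_point_def)
  have m: "1 \<le> m" "m \<le> n" using ij h by (auto simp: m_def has_val_def)
  have x: "D (int m) x" using local_point_x[OF P] by (simp add: m_def)
  have x3: "D (3 * int m) (x ^ 3)" using pclose_power[OF x, of 3] by simp
  have x2: "D 1 (x ^ 2)" using pclose_power'[OF x1, of 1 2] by simp
  have small: "D (int n + 1) (wa2 E * x ^ 2 + wa4 E * x + weq E x y)"
    using pclose_mult'[OF a2_in x2, of "int n + 1"] pclose_mult'[OF a4_in x1, of "int n + 1"] w
    by (intro pclose_add) simp_all
  have uv: "D (int i + int j) (y * vof x y)" by (rule pclose_mult[OF has_valD(1)[OF h(1)] has_valD(1)[OF h(2)]])
  have eq: "wa6 E = y * vof x y - x ^ 3 - (wa2 E * x ^ 2 + wa4 E * x + weq E x y)"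
    by (simp add: weq_uv)
  have le: "\<not> (int n + 1 \<le> 3 * int m \<and> int n + 1 \<le> int i + int j)"
  proof
    assume "int n + 1 \<le> 3 * int m \<and> int n + 1 \<le> int i + int j"
    hence "D (int n + 1) (wa6 E)" unfolding eq
      using pclose_mono[OF x3, of "int n + 1"] pclose_mono[OF uv, of "int n + 1"] small
      by (intro pclose_diff) simp_all
    with a6_not show False ..
  qed
  have "m \<le> i" "m \<le> j" "m = i \<or> m = j" by (auto simp: m_def)
  show 1: "2 * min i j \<le> n"
    unfolding m_def[symmetric] using le m \<open>m \<le> i\<close> \<open>m \<le> j\<close> by linarith
  show "i = j" if "2 * min i j = n"
    using le m that \<open>m \<le> i\<close> \<open>m \<le> j\<close> \<open>m = i \<or> m = j\<close> unfolding m_def[symmetric] by linarith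
  show "2 * i = n" if "i = j"
  proof (rule ccontr)
    assume ne: "2 * i \<noteq> n"
    have mi: "m = i" "j = i" using that by (simp_all add: m_def)
    have lt: "2 * i < n" using 1 ne mi m_def by simp
    have nu: "\<not> D (int i + 1) y" "\<not> D (int i + 1) (vof x y)"
      using has_valD(2)[OF h(1)] has_valD(2)[OF h(2)] lt mi by auto
    have "D (2 * int i + 1) (wa6 E + x ^ 3 + (wa2 E * x ^ 2 + wa4 E * x + weq E x y))"
      by (rule pclose_add[OF pclose_add[OF pclose_mono[OF a6_in] pclose_mono[OF x3]] pclose_mono[OF small]])
        (use lt ij(1) mi in simp_all)
    hence "D (2 * int i + 1) (y * vof x y)" by (simp add: weq_uv)
    with not_pclose_mult[OF nu, of "2 * int i + 1"] show False by simp
  qed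
qed

lemma tangent_iff:
  assumes "D 0 a"
  shows "D 1 (l * (l + a)) \<longleftrightarrow> D 1 l \<or> D 1 (l + a)"
proof
  assume "D 1 (l * (l + a))"
  thus "D 1 l \<or> D 1 (l + a)" using not_pclose_mult[of 1 l 1 "l + a" 1] by auto
next
  assume "D 1 l \<or> D 1 (l + a)"
  moreover have "D 0 (l + a)" if "D 1 l" using pclose_add[OF pclose_mono[OF that] assms] by simp
  moreover have "D 0 l" if "D 1 (l + a)" using pclose_diff[OF pclose_mono[OF that, of 0] assms] by simp
  ultimately show "D 1 (l * (l + a))" by (auto intro: pclose_0_mult)
qed

section \<open>Slopes between points at a split node\<close>

context
  fixes x1 y1 x2 y2 l :: rat and i1 j1 i2 j2 :: nat
  assumes P1: "local_point x1 y1 i1 j1" and P2: "local_point x2 y2 i2 j2"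
    and s: "D (int n + 1) (slope_defect l x1 y1 x2 y2)"
begin

text \<open>The less divisible point decides: \<open>x2 - x1\<close> has valuation exactly
  \<open>m\<close>, while the more divisible of \<open>y1\<close> and \<open>vof x1 y1\<close>, and
  the whole second point, are negligible modulo p^(m+1). The chord therefore follows one branch of
  the node.\<close>

lemma chord_valuations:
  assumes "min i1 j1 < min i2 j2"
  shows "i1 < j1 \<Longrightarrow> D 1 (l + wa1 E)" "j1 < i1 \<Longrightarrow> D 1 l"
proof -
  define m where "m = min i1 j1"
  have h: "has_val i1 y1" "has_val j1 (vof x1 y1)" "has_val i2 y2" "has_val j2 (vof x2 y2)"
    using P1 P2 by (auto simp: local_point_def)
  have mn: "m < n" using local_point_shape(1)[OF P2] assms unfolding m_def by linarith
  have s': "D (int m + 1) (slope_defect l x1 y1 x2 y2)" using mn by (intro pclose_mono[OF s]) simp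
  have d2: "D (int m + 1) y2" "D (int m + 1) (vof x2 y2)"
    using assms by (intro pclose_mono[OF has_valD(1)[OF h(3)]] pclose_mono[OF has_valD(1)[OF h(4)]]; simp add: m_def)+
  have dx: "wa1 E * (x2 - x1) = (vof x2 y2 - vof x1 y1) - (y2 - y1)"
    by (simp add: vof_def algebra_simps)
  have l: "l * (x2 - x1) = y2 - y1 - slope_defect l x1 y1 x2 y2"
    "(l + wa1 E) * (x2 - x1) = vof x2 y2 - vof x1 y1 - slope_defect l x1 y1 x2 y2"
    by (simp_all add: slope_defect_def vof_def algebra_simps)
  {
    assume lt: "i1 < j1"
    have d1: "D (int m + 1) (vof x1 y1)" "\<not> D (int m + 1) y1"
      using lt mn has_valD(2)[OF h(1)] by (auto simp: m_def intro: pclose_mono[OF has_valD(1)[OF h(2)]])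
    have e: "D (int m + 1) (vof x2 y2 - vof x1 y1 - y2)" by (intro pclose_diff d1 d2)
    have "\<not> D (int m + 1) (wa1 E * (x2 - x1))"
      using pclose_add_cancel[OF e, of y1] d1(2) unfolding dx by (simp add: algebra_simps)
    hence nd: "\<not> D (int m + 1) (x2 - x1)" unfolding punit_mult_iff(1)[OF a1_unit] .
    have "D (int m + 1) ((l + wa1 E) * (x2 - x1))" unfolding l by (intro pclose_diff d1 d2 s')
    thus "D 1 (l + wa1 E)" using not_pclose_mult[OF _ nd, of 1 "l + wa1 E" "int m + 1"] by auto
  }
  {
    assume lt: "j1 < i1"
    have d1: "D (int m + 1) y1" "\<not> D (int m + 1) (vof x1 y1)"
      using lt mn has_valD(2)[OF h(2)] by (auto simp: m_def intro: pclose_mono[OF has_valD(1)[OF h(1)]])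
    have e: "D (int m + 1) (vof x2 y2 - (y2 - y1))" by (intro pclose_diff d1 d2)
    have "\<not> D (int m + 1) (wa1 E * (x2 - x1))"
      using pclose_diff_cancel[of "int m + 1" "wa1 E * (x2 - x1)" "vof x2 y2 - (y2 - y1)"] 
        pclose_diff[OF e, of "wa1 E * (x2 - x1)"] d1(2) unfolding dx by (auto simp: algebra_simps)
    hence nd: "\<not> D (int m + 1) (x2 - x1)" unfolding punit_mult_iff(1)[OF a1_unit] .
    have "D (int m + 1) (l * (x2 - x1))" unfolding l by (intro pclose_diff d1 d2 s')
    thus "D 1 l" using not_pclose_mult[OF _ nd, of 1 l "int m + 1"] by auto
  }
qed

text \<open>At equal depth \<open>x2 - x1\<close> can be arbitrarily divisible. On the same branch,
  and in the middle component 2m = n, the second defect takes over, with denominator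
  \<open>y1 + vof x2 y2\<close>; on opposite branches the first defect suffices.\<close>

lemma equal_valuations:
  assumes s2: "D (int n + 1) (slope_defect' E l x1 y1 x2 y2)" and eq: "min i1 j1 = m" "min i2 j2 = m"
  shows "2 * m = n \<Longrightarrow> \<not> D 1 l \<and> \<not> D 1 (l + wa1 E)"
    "i1 < j1 \<Longrightarrow> i2 < j2 \<Longrightarrow> D 1 (l + wa1 E)"
    "j1 < i1 \<Longrightarrow> j2 < i2 \<Longrightarrow> D 1 l"
    "i1 < j1 \<Longrightarrow> j2 < i2 \<Longrightarrow> \<not> D 1 l \<and> \<not> D 1 (l + wa1 E)"
    "j1 < i1 \<Longrightarrow> i2 < j2 \<Longrightarrow> \<not> D 1 l \<and> \<not> D 1 (l + wa1 E)"
proof -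
  let ?u1 = y1 and ?v1 = "vof x1 y1" and ?u2 = y2 and ?v2 = "vof x2 y2"
  have h: "has_val i1 ?u1" "has_val j1 ?v1" "has_val i2 ?u2" "has_val j2 ?v2" and ij: "1 \<le> i1" "1 \<le> j1"
    using P1 P2 by (auto simp: local_point_def)
  have m: "1 \<le> m" "2 * m \<le> n" using local_point_shape(1)[OF P1] eq ij by auto
  have mn: "m < n" using m by simp
  have x: "D (int m) x1" "D (int m) x2" using local_point_x[OF P1] local_point_x[OF P2] eq by simp_all
  define S where "S = x1 * x1 + x1 * x2 + x2 * x2 + wa2 E * (x1 + x2) + wa4 E + slope_defect' E l x1 y1 x2 y2"
  have S: "D (int m + 1) S"
    unfolding S_def using m
    by (intro pclose_add pclose_mono[OF a4_in] pclose_mono[OF s2] pclose_mult'[OF x(1,1)]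
        pclose_mult'[OF x(2,2)] pclose_mult'[OF x(1,2)] pclose_mult'[OF a2_in pclose_add[OF x]]) simp_all
  have s': "D (int m + 1) (slope_defect l x1 y1 x2 y2)" using mn by (intro pclose_mono[OF s]) simp
  \<comment> \<open>\<open>S\<close> is negligible modulo p^(m+1), so multiplying the denominator by
    \<open>l\<close> isolates \<open>y1\<close>, and multiplying it by \<open>l + wa1 E\<close>
    isolates \<open>vof x2 y2\<close>.\<close>
  have t: "l * (?u1 + ?v2) = S - wa1 E * ?u1" "(l + wa1 E) * (?u1 + ?v2) = S + wa1 E * ?v2"
    by (simp_all add: S_def slope_defect'_def vof_def algebra_simps power2_eq_square)
  have l: "l * (x2 - x1) = y2 - y1 - slope_defect l x1 y1 x2 y2"
    "(l + wa1 E) * (x2 - x1) = ?v2 - ?v1 - slope_defect l x1 y1 x2 y2"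
    by (simp_all add: slope_defect_def vof_def algebra_simps)
  have big: "D (int m) ?u1" "D (int m) ?v1" "D (int m) ?u2" "D (int m) ?v2"
    using eq by (auto intro: pclose_mono[OF has_valD(1)[OF h(1)]] pclose_mono[OF has_valD(1)[OF h(2)]]
        pclose_mono[OF has_valD(1)[OF h(3)]] pclose_mono[OF has_valD(1)[OF h(4)]])
  have nu: "\<not> D (int m + 1) ?u1" if "i1 = m" using has_valD(2)[OF h(1)] that mn by simp
  have nv: "\<not> D (int m + 1) ?v1" if "j1 = m" using has_valD(2)[OF h(2)] that mn by simp
  have nu2: "\<not> D (int m + 1) ?u2" if "i2 = m" using has_valD(2)[OF h(3)] that mn by simp
  have nv2: "\<not> D (int m + 1) ?v2" if "j2 = m" using has_valD(2)[OF h(4)] that mn by simp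
  have du: "D (int m + 1) ?u1" if "m < i1" using that by (intro pclose_mono[OF has_valD(1)[OF h(1)]]) simp
  have dv: "D (int m + 1) ?v1" if "m < j1" using that by (intro pclose_mono[OF has_valD(1)[OF h(2)]]) simp
  have du2: "D (int m + 1) ?u2" if "m < i2" using that by (intro pclose_mono[OF has_valD(1)[OF h(3)]]) simp
  have dv2: "D (int m + 1) ?v2" if "m < j2" using that by (intro pclose_mono[OF has_valD(1)[OF h(4)]]) simp
  note au = punit_mult_iff(1)[OF a1_unit]
  {
    assume n2: "2 * m = n"
    hence e: "i1 = m" "j2 = m"
      using local_point_shape(3)[OF P1] local_point_shape(3)[OF P2] eq by auto
    have "\<not> D (int m + 1) (l * (?u1 + ?v2))" "\<not> D (int m + 1) ((l + wa1 E) * (?u1 + ?v2))"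
      unfolding t using nu[OF e(1)] nv2[OF e(2)] pclose_add_cancel[OF S] S
        pclose_diff[OF S, of "S - wa1 E * ?u1"] by (auto simp: au)
    thus "\<not> D 1 l \<and> \<not> D 1 (l + wa1 E)"
      using pclose_mult'[OF _ pclose_add[OF big(1) big(4)], of 1 _ "int m + 1"] by auto
  }
  {
    assume lt: "i1 < j1" "i2 < j2"
    hence e: "i1 = m" "m < j2" using eq by auto
    have "\<not> D (int m + 1) (?u1 + ?v2)"
      using pclose_add_cancel[OF dv2[OF e(2)], of ?u1] nu[OF e(1)] by (simp add: add.commute)
    moreover have "D (int m + 1) ((l + wa1 E) * (?u1 + ?v2))"
      unfolding t using dv2[OF e(2)] S by (intro pclose_add) (simp_all add: au)
    ultimately show "D 1 (l + wa1 E)" using not_pclose_mult[of 1 "l + wa1 E" "int m + 1" "?u1 + ?v2" "int m + 1"] by auto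
  }
  {
    assume lt: "j1 < i1" "j2 < i2"
    hence e: "m < i1" "j2 = m" using eq by auto
    have "\<not> D (int m + 1) (?u1 + ?v2)"
      using pclose_add_cancel[OF du[OF e(1)], of ?v2] nv2[OF e(2)] by simp
    moreover have "D (int m + 1) (l * (?u1 + ?v2))"
      unfolding t using du[OF e(1)] S by (intro pclose_diff) (simp_all add: au)
    ultimately show "D 1 l" using not_pclose_mult[of 1 l "int m + 1" "?u1 + ?v2" "int m + 1"] by auto
  }
  have nontangent: "\<not> D 1 l \<and> \<not> D 1 (l + wa1 E)"
    if "\<not> D (int m + 1) (l * (x2 - x1))" "\<not> D (int m + 1) ((l + wa1 E) * (x2 - x1))"
    using that pclose_mult'[OF _ pclose_diff[OF x(2) x(1)], of 1 _ "int m + 1"] by auto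
  have sub: "\<not> D k (a - b - c)" if "D k c" "D k a \<noteq> D k b" for k a b c
    using that pclose_diff_cancel[OF that(1), of "a - b"] pclose_diff_cancel[of k b a]
      pclose_diff[of k a "a - b"] by auto
  {
    assume lt: "i1 < j1" "j2 < i2"
    hence e: "i1 = m" "m < j1" "j2 = m" "m < i2" using eq by auto
    show "\<not> D 1 l \<and> \<not> D 1 (l + wa1 E)"
      by (rule nontangent; unfold l, rule sub[OF s']) (use nu[OF e(1)] dv[OF e(2)] nv2[OF e(3)] du2[OF e(4)] in simp_all)
  }
  {
    assume lt: "j1 < i1" "i2 < j2"
    hence e: "m < i1" "j1 = m" "m < j2" "i2 = m" using eq by auto
    show "\<not> D 1 l \<and> \<not> D 1 (l + wa1 E)"
      by (rule nontangent; unfold l, rule sub[OF s']) (use du[OF e(1)] nv[OF e(2)] dv2[OF e(3)] nu2[OF e(4)] in simp_all)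
  }
qed

end

text \<open>The indices of the second point are swapped because the comparison is with its negative,
  and negation exchanges \<open>y\<close> and \<open>vof\<close> up to sign.\<close>

lemma slope_tangent_component:
  assumes P1: "local_point x1 y1 i1 j1" and P2: "local_point x2 y2 i2 j2"
    and s: "D (int n + 1) (slope_defect l x1 y1 x2 y2)"
    and s2: "D (int n + 1) (slope_defect' E l x1 y1 x2 y2)"
  shows "D 1 l \<or> D 1 (l + wa1 E) \<longleftrightarrow> component n i1 j1 \<noteq> component n j2 i2"
proof -
  note sh1 = local_point_shape[OF P1] and sh2 = local_point_shape[OF P2]
  have s_swap: "D (int n + 1) (slope_defect l x2 y2 x1 y1)"
    using s pclose_minus[of _ "slope_defect l x1 y1 x2 y2"] by (simp add: slope_defect_def algebra_simps)
  consider "min i1 j1 < min i2 j2" | "min i2 j2 < min i1 j1" | "min i1 j1 = min i2 j2" by linarith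
  thus ?thesis
  proof cases
    case 1
    hence "i1 \<noteq> j1" using sh1 sh2 by auto
    thus ?thesis using chord_valuations[OF P1 P2 s 1] 1 sh1 sh2
      by (auto simp: component_def min_def split: if_splits)
  next
    case 2
    hence "i2 \<noteq> j2" using sh1 sh2 by auto
    thus ?thesis using chord_valuations[OF P2 P1 s_swap 2] 2 sh1 sh2
      by (auto simp: component_def min_def split: if_splits)
  next
    case 3
    note ev = equal_valuations[OF P1 P2 s s2 3 refl]
    show ?thesis
    proof (cases "2 * min i1 j1 = n")
      case True
      hence "i1 = j1" "i2 = j2" "i1 = i2" using sh1 sh2 3 by auto
      thus ?thesis using ev(1) True 3 by (simp add: component_def)
    next
      case False
      hence "i1 \<noteq> j1" "i2 \<noteq> j2" using sh1 sh2 3 by auto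
      then consider "i1 < j1" "i2 < j2" | "j1 < i1" "j2 < i2" | "i1 < j1" "j2 < i2" | "j1 < i1" "i2 < j2"
        by linarith
      thus ?thesis using ev(2-5) False 3 sh1 sh2
        by cases (auto simp: component_def min_def)
    qed
  qed
qed

section \<open>The component of a p-adic point\<close>

definition tval :: "qseq \<Rightarrow> nat" where
  "tval x = (GREATEST k. k \<le> n \<and> padic_in p (int k) x)"

lemma tval_iff:
  assumes "padic_in p 0 x"
  shows "tval x \<le> n" "k \<le> n \<Longrightarrow> padic_in p (int k) x \<longleftrightarrow> k \<le> tval x"
proof -
  let ?P = "\<lambda>k. k \<le> n \<and> padic_in p (int k) x"
  have P: "?P (tval x)"
    unfolding tval_def by (rule GreatestI_nat[of ?P 0 n]) (use assms in auto)
  thus "tval x \<le> n" by simp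
  assume k: "k \<le> n"
  have "k \<le> tval x" if "padic_in p (int k) x"
    unfolding tval_def by (rule Greatest_le_nat[of ?P _ n]) (use that k in auto)
  moreover have "padic_in p (int k) x" if "k \<le> tval x"
    using P that by (auto intro: padic_in_mono)
  ultimately show "padic_in p (int k) x \<longleftrightarrow> k \<le> tval x" by blast
qed

lemma tval_minus: "tval (\<lambda>m. - x m) = tval x"
  by (simp add: tval_def padic_in_minus)

lemma tval_cong:
  assumes "padic_null p (\<lambda>m. x m - y m)"
  shows "tval x = tval y"
proof -
  have "padic_in p k x \<longleftrightarrow> padic_in p k y" for k
    using padic_in_add_cancel[OF padic_null_in[OF assms], of k y] by simp
  thus ?thesis by (simp add: tval_def)
qed

lemma tval_has_val:
  assumes "padic_cauchy p x" "padic_in p 0 x"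
  shows "\<forall>\<^sub>F m in sequentially. has_val (tval x) (x m)"
proof -
  have "\<forall>\<^sub>F m in sequentially. \<forall>k\<in>{..n}. D (int k) (x m) \<longleftrightarrow> padic_in p (int k) x"
    by (intro eventually_ball_finite ballI cauchy_stable assms) simp
  thus ?thesis
    by eventually_elim (use tval_iff[OF assms(2)] in \<open>auto simp: has_val_def\<close>)
qed

lemma pnode_vof:
  assumes "pnode x y"
  shows "padic_in p 1 (\<lambda>m. vof (x m) (y m))"
proof -
  have "\<forall>\<^sub>F m in sequentially. D 1 (x m)" "\<forall>\<^sub>F m in sequentially. D 1 (y m)"
    using assms by (simp_all add: pnode_def padic_in_iff)
  thus ?thesis unfolding padic_in_iff vof_def
    by eventually_elim (intro pclose_add pclose_0_mult(1) a1 a3)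
qed

text \<open>The capped valuations of a Cauchy sequence are eventually constant, so one late snapshot
  represents the point.\<close>

lemma on_curve_local_point:
  assumes c: "on_curve E x y" and nd: "pnode x y"
  shows "\<forall>\<^sub>F m in sequentially. local_point (x m) (y m) (tval y) (tval (\<lambda>m. vof (x m) (y m)))"
proof -
  have cx: "padic_cauchy p x" "padic_cauchy p y" using c by (auto simp: on_curve_def)
  have cv: "padic_cauchy p (\<lambda>m. vof (x m) (y m))" unfolding vof_def by (intro cauchy_intros cx)
  have i: "padic_in p 1 x" "padic_in p 1 y" "padic_in p 1 (\<lambda>m. vof (x m) (y m))"
    using nd pnode_vof[OF nd] by (auto simp: pnode_def)
  have i0: "padic_in p 0 y" "padic_in p 0 (\<lambda>m. vof (x m) (y m))"
    using i by (auto intro: padic_in_mono)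
  have t: "1 \<le> tval y" "1 \<le> tval (\<lambda>m. vof (x m) (y m))"
    using tval_iff(2)[OF i0(1), of 1] tval_iff(2)[OF i0(2), of 1] i n by simp_all
  show ?thesis
    using on_curve_pointwise[OF c, of "int n + 1"] i(1)[unfolded padic_in_iff] i(2)[unfolded padic_in_iff]
      tval_has_val[OF cx(2) i0(1)] tval_has_val[OF cv i0(2)]
    by eventually_elim (use t in \<open>simp add: local_point_def\<close>)
qed

definition comp :: "qp_point \<Rightarrow> nat" where
  "comp P = (case P of None \<Rightarrow> 0 | Some (x, y) \<Rightarrow>
     if pnode x y then component n (tval y) (tval (\<lambda>m. vof (x m) (y m))) else 0)"

lemma comp_simps:
  "comp None = 0" "\<not> pnode x y \<Longrightarrow> comp (Some (x, y)) = 0"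
  "pnode x y \<Longrightarrow> comp (Some (x, y)) = component n (tval y) (tval (\<lambda>m. vof (x m) (y m)))"
  by (simp_all add: comp_def)

lemma comp_neg:
  assumes "pnode x y"
  shows "comp (qp_neg E (Some (x, y))) = component n (tval (\<lambda>m. vof (x m) (y m))) (tval y)"
proof -
  have e: "(\<lambda>m. - y m - wa1 E * x m - wa3 E) = (\<lambda>m. - vof (x m) (y m))"
    "(\<lambda>m. vof (x m) (- y m - wa1 E * x m - wa3 E)) = (\<lambda>m. - y m)"
    by (simp_all add: vof_def fun_eq_iff)
  have "pnode x (\<lambda>m. - y m - wa1 E * x m - wa3 E)" using assms by (simp only: pnode_neg)
  from comp_simps(3)[OF this] show ?thesis
    unfolding qp_neg_simps e(2) unfolding e(1) by (simp only: tval_minus)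
qed

lemma comp_pnode:
  assumes "on_curve E x y" "pnode x y"
  shows "1 \<le> comp (Some (x, y))" "comp (Some (x, y)) < n"
proof -
  from eventually_happens'[OF sequentially_bot on_curve_local_point[OF assms]] obtain m where
    P: "local_point (x m) (y m) (tval y) (tval (\<lambda>m. vof (x m) (y m)))" by blast
  have "1 \<le> tval y" "1 \<le> tval (\<lambda>m. vof (x m) (y m))" using P by (auto simp: local_point_def)
  thus "1 \<le> comp (Some (x, y))" "comp (Some (x, y)) < n"
    using local_point_shape(1)[OF P] unfolding comp_simps(3)[OF assms(2)]
    by (auto simp: component_def min_def split: if_splits)
qed

lemma comp_opposite:
  assumes "opposite E x1 y1 x2 y2" "pnode x1 y1" "pnode x2 y2"
  shows "comp (Some (x1, y1)) = comp (qp_neg E (Some (x2, y2)))"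
proof -
  have z: "padic_null p (\<lambda>m. x1 m - x2 m)" "padic_null p (\<lambda>m. y1 m + y2 m + wa1 E * x2 m + wa3 E)"
    using assms(1) by (auto simp: opposite_def padic_eq_def)
  have "tval y1 = tval (\<lambda>m. - vof (x2 m) (y2 m))"
    by (rule tval_cong) (use z(2) in \<open>simp add: vof_def algebra_simps\<close>)
  moreover have "tval (\<lambda>m. vof (x1 m) (y1 m)) = tval (\<lambda>m. - y2 m)"
  proof (rule tval_cong)
    have "padic_null p (\<lambda>m. (y1 m + y2 m + wa1 E * x2 m + wa3 E) + wa1 E * (x1 m - x2 m))"
      by (intro null_intros z cauchy_const)
    thus "padic_null p (\<lambda>m. vof (x1 m) (y1 m) - - y2 m)" by (simp add: vof_def algebra_simps)
  qed
  ultimately show ?thesis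
    unfolding comp_simps(3)[OF assms(2)] comp_neg[OF assms(3)] by (simp add: tval_minus)
qed

lemma comp_tangent:
  assumes c1: "on_curve E x1 y1" and c2: "on_curve E x2 y2" and n1: "pnode x1 y1" and n2: "pnode x2 y2"
    and sl: "is_slope E l x1 y1 x2 y2"
  shows "tangent l \<longleftrightarrow> comp (Some (x1, y1)) \<noteq> comp (qp_neg E (Some (x2, y2)))"
proof -
  have cl: "padic_cauchy p l" using sl by (simp add: is_slope_def)
  have "padic_cauchy p (\<lambda>m. l m ^ 2 + wa1 E * l m - wa2 E)" by (intro cauchy_intros cl)
  from cauchy_stable[OF this, of 1]
  have st: "\<forall>\<^sub>F m in sequentially. D 1 (l m ^ 2 + wa1 E * l m - wa2 E) \<longleftrightarrow> tangent l"
    by (simp add: tangent_def)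
  have "\<forall>\<^sub>F m in sequentially. D (int n + 1) (slope_defect (l m) (x1 m) (y1 m) (x2 m) (y2 m))"
    "\<forall>\<^sub>F m in sequentially. D (int n + 1) (slope_defect' E (l m) (x1 m) (y1 m) (x2 m) (y2 m))"
    using sl by (simp_all add: is_slope_def padic_null_iff)
  with st on_curve_local_point[OF c1 n1] on_curve_local_point[OF c2 n2]
  have "\<forall>\<^sub>F m in sequentially. tangent l \<longleftrightarrow> comp (Some (x1, y1)) \<noteq> comp (qp_neg E (Some (x2, y2)))"
  proof eventually_elim
    case (elim m)
    have a2': "D 1 (wa2 E)" using n by (intro pclose_mono[OF a2_in]) simp
    have "tangent l \<longleftrightarrow> D 1 (l m * (l m + wa1 E))"
      using elim(1) pclose_diff_cancel[OF a2', of "l m * (l m + wa1 E)"]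
      by (simp add: algebra_simps power2_eq_square)
    also have "\<dots> \<longleftrightarrow> D 1 (l m) \<or> D 1 (l m + wa1 E)" by (rule tangent_iff[OF a1])
    also have "\<dots> \<longleftrightarrow> comp (Some (x1, y1)) \<noteq> comp (qp_neg E (Some (x2, y2)))"
      unfolding comp_simps(3)[OF n1] comp_neg[OF n2]
      by (rule slope_tangent_component[OF elim(2-5)])
    finally show ?case .
  qed
  thus ?thesis by simp
qed

text \<open>Prescribing \<open>vof\<close> to be q = p^h and writing y = q w determines x as q X(w).
  Dividing the equation by \<open>q ^ 2\<close> leaves w = G(w), and \<open>G\<close> contracts
  because \<open>q\<close>, \<open>wa2 E\<close> and \<open>b4\<close> are divisible by
  \<open>p\<close>.\<close>

lemma ex_point_on_component:
  assumes h: "1 \<le> h" "2 * h \<le> n"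
  obtains x y where "on_curve E x y" "pnode x y" "tval (\<lambda>m. vof (x m) (y m)) = h"
    "h \<le> tval y" "2 * h < n \<Longrightarrow> h < tval y"
proof -
  let ?p = "of_int p :: rat"
  define q where "q = ?p ^ h"
  have q0: "q \<noteq> 0" by (simp add: q_def)
  have "vrat p q = int h" by (simp add: q_def vrat_power)
  hence Dq: "D k q \<longleftrightarrow> k \<le> int h" for k using q0 by (auto simp: pclose_def)
  have Dq': "D (int h) q" "\<not> D (int h + 1) q" by (simp_all add: Dq)
  have "vrat p (q ^ 2) = 2 * int h" using q0 by (simp add: vrat_power Dq q_def)
  hence Dq2: "D (2 * int h) (q ^ 2)" "\<not> D (2 * int h + 1) (q ^ 2)" using q0 by (auto simp: pclose_def)
  define b3 b4 b6 where "b3 = wa3 E / q" and "b4 = wa4 E / q" and "b6 = wa6 E / q ^ 2"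
  have b3: "D 0 b3" unfolding b3_def pclose_divide_iff[OF Dq'] using h by (intro pclose_mono[OF a3_in]) simp
  have b4: "D 1 b4" unfolding b4_def pclose_divide_iff[OF Dq'] using h by (intro pclose_mono[OF a4_in]) simp
  have b6: "D (int n - 2 * int h) b6" unfolding b6_def pclose_divide_iff[OF Dq2] using a6_in by simp
  have b6': "D 0 b6" using h by (intro pclose_mono[OF b6]) simp
  have q1: "D 1 q" and a2': "D 1 (wa2 E)" using h n by (simp_all add: Dq pclose_mono[OF a2_in])
  define X where "X w = (1 - w - b3) / wa1 E" for w
  define G where "G w = q * X w ^ 3 + wa2 E * X w ^ 2 + b4 * X w + b6" for w
  have X: "D 0 (X w)" if "D 0 w" for w
    unfolding X_def punit_divide_iff[OF a1_unit] by (intro pclose_diff that b3 pclose_numeral)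
  have G1: "D 1 (G w - b6)" if "D 0 w" for w
    using pclose_power[OF X[OF that], of 3] pclose_power[OF X[OF that], of 2]
      pclose_add[OF pclose_add[OF pclose_0_mult(2)[OF _ q1, of "X w ^ 3"] pclose_0_mult(2)[OF _ a2', of "X w ^ 2"]]
        pclose_0_mult(2)[OF X[OF that] b4]]
    by (simp add: G_def)
  obtain w where w: "padic_cauchy p w" "\<And>m. D 0 (w m)" "padic_null p (\<lambda>m. w m - G (w m))"
  proof (rule contraction_fixpoint[of G])
    fix x assume "D 0 x"
    from pclose_add[OF pclose_mono[OF G1[OF this], of 0] b6'] show "D 0 (G x)" by simp
  next
    fix x y k assume xy: "D 0 x" "D 0 y" "k \<ge> 0" "D k (x - y)"
    have "X x - X y = - (x - y) / wa1 E" by (simp add: X_def diff_divide_distrib)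
    hence d: "D k (X x - X y)" using xy(4) by (simp only: punit_divide_iff[OF a1_unit] pclose_minus)
    note Xi = X[OF xy(1)] X[OF xy(2)]
    have "D 1 (q * (X x * X x + X x * X y + X y * X y) + wa2 E * (X x + X y) + b4)"
      by (intro pclose_add b4 pclose_0_mult(2)[OF _ q1] pclose_0_mult(2)[OF _ a2'] pclose_0_mult(1)[OF Xi(1)]
          pclose_0_mult(1)[OF Xi(2)] Xi)
    from pclose_mult'[OF d this, of "k + 1"]
    have "D (k + 1) ((X x - X y) * (q * (X x * X x + X x * X y + X y * X y) + wa2 E * (X x + X y) + b4))" by simp
    also have "(X x - X y) * (q * (X x * X x + X x * X y + X y * X y) + wa2 E * (X x + X y) + b4) = G x - G y"
      by (simp add: G_def algebra_simps power2_eq_square power3_eq_cube)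
    finally show "D (k + 1) (G x - G y)" .
  qed blast
  define x y where "x m = q * X (w m)" and "y m = q * w m" for m
  have v: "vof (x m) (y m) = q" for m
    using q0 punit_nz[OF a1_unit] by (simp add: vof_def x_def y_def X_def b3_def field_simps)
  have cx: "padic_cauchy p x"
  proof -
    have "padic_cauchy p (\<lambda>m. q / wa1 E * (1 - w m - b3))" by (intro cauchy_intros w)
    thus ?thesis by (simp add: x_def[abs_def] X_def)
  qed
  have cy: "padic_cauchy p y" unfolding y_def by (intro cauchy_intros w)
  have "padic_null p (\<lambda>m. q ^ 2 * (w m - G (w m)))" by (intro null_mult_cauchy(2) w cauchy_const)
  moreover have "weq E (x m) (y m) = q ^ 2 * (w m - G (w m))" for m
    using q0 unfolding weq_uv v
    by (simp add: x_def y_def G_def b4_def b6_def field_simps power2_eq_square power3_eq_cube)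
  ultimately have c: "on_curve E x y" using cx cy by (simp add: on_curve_def)
  have nd: "pnode x y"
    using pclose_0_mult(2)[OF X[OF w(2)] q1] pclose_0_mult(2)[OF w(2) q1]
    by (simp add: pnode_def padic_in_iff x_def y_def)
  have tv: "tval (\<lambda>m. vof (x m) (y m)) = h"
  proof -
    have i0: "padic_in p 0 (\<lambda>m. q)" by (simp add: padic_in_const Dq)
    have "k \<le> tval (\<lambda>m. q) \<longleftrightarrow> k \<le> h" if "k \<le> n" for k
      using tval_iff(2)[OF i0 that] by (simp add: padic_in_const Dq)
    from this[of "tval (\<lambda>m. q)"] this[of h] show ?thesis using tval_iff(1)[OF i0] h by (simp add: v)
  qed
  have iy: "padic_in p 0 y" using nd by (auto simp: pnode_def intro: padic_in_mono)
  have "padic_in p (int h) y" using pclose_0_mult(2)[OF w(2) Dq'(1)] by (simp add: padic_in_iff y_def)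
  hence ty: "h \<le> tval y" using tval_iff(2)[OF iy, of h] h by simp
  \<comment> \<open>Below the middle component \<open>b6\<close> is divisible by \<open>p\<close>,
    hence so is \<open>w\<close>.\<close>
  have "h < tval y" if lt: "2 * h < n"
  proof -
    have "\<forall>\<^sub>F m in sequentially. D 1 (w m - G (w m))" using w(3) by (simp add: padic_null_iff)
    hence "\<forall>\<^sub>F m in sequentially. D (int (Suc h)) (y m)"
    proof eventually_elim
      case (elim m)
      have "D 1 b6" using lt by (intro pclose_mono[OF b6]) simp
      from pclose_add[OF elim pclose_add[OF G1[OF w(2)[of m]] this]] have "D 1 (w m)" by simp
      from pclose_mult[OF Dq'(1) this] show ?case by (simp add: y_def add.commute)
    qed
    hence "padic_in p (int (Suc h)) y" by (simp add: padic_in_iff)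
    thus ?thesis using tval_iff(2)[OF iy, of "Suc h"] lt by simp
  qed
  with c nd tv ty that show ?thesis by blast
qed

lemma comp_image: "comp ` qp_points p E = {..<n}"
proof (intro equalityI subsetI)
  fix h assume "h \<in> comp ` qp_points p E"
  then obtain P where P: "P \<in> qp_points p E" "h = comp P" by blast
  show "h \<in> {..<n}"
  proof (cases P)
    case None
    thus ?thesis using P n by (simp add: comp_simps)
  next
    case (Some xy)
    then obtain x y where xy: "P = Some (x, y)" by (cases xy) auto
    hence "on_curve E x y" using P by simp
    thus ?thesis using P n comp_pnode[of x y] by (cases "pnode x y") (simp_all add: xy comp_simps(2))
  qed
next
  fix h assume "h \<in> {..<n}"
  hence hn: "h < n" by simp
  consider "h = 0" | "1 \<le> h" "2 * h \<le> n" | "n < 2 * h" by linarith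
  thus "h \<in> comp ` qp_points p E"
  proof cases
    case 1
    thus ?thesis by (intro image_eqI[of _ _ None]) (simp_all add: comp_simps)
  next
    case 2
    then obtain x y where P: "on_curve E x y" "pnode x y" "tval (\<lambda>m. vof (x m) (y m)) = h" "h \<le> tval y"
      using ex_point_on_component by blast
    have "h = comp (qp_neg E (Some (x, y)))"
      unfolding comp_neg[OF P(2)] P(3) using P(4) by (simp add: component_def)
    moreover have "qp_neg E (Some (x, y)) \<in> qp_points p E" unfolding qp_neg_points using P(1) by simp
    ultimately show ?thesis by (rule image_eqI)
  next
    \<comment> \<open>In the upper half the constructed point itself serves, and the strict
      inequality selects the value \<open>n - j\<close> of \<open>component\<close>; in the lower
      half its negative served.\<close>
    case 3
    have "1 \<le> n - h" "2 * (n - h) \<le> n" "2 * (n - h) < n" using 3 hn by auto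
    then obtain x y where P: "on_curve E x y" "pnode x y" "tval (\<lambda>m. vof (x m) (y m)) = n - h" "n - h < tval y"
      using ex_point_on_component[of "n - h"] by blast
    have "h = comp (Some (x, y))"
      unfolding comp_simps(3)[OF P(2)] P(3) using P(4) hn by (simp add: component_def)
    moreover have "Some (x, y) \<in> qp_points p E" using P(1) by simp
    ultimately show ?thesis by (rule image_eqI)
  qed
qed

lemma index_E0_eq: "index_E0 p E = n"
proof -
  have "index_E0 p E = card (comp ` qp_points p E)"
  proof (rule index_E0_invariant)
    fix P Q assume PQ: "P \<in> qp_points p E" "Q \<in> qp_points p E" "\<not> node Q"
    have "comp Q = 0" using PQ(3) by (cases Q) (auto simp: comp_simps)
    moreover have "comp P = 0 \<longleftrightarrow> \<not> node P"
      using PQ(1) comp_pnode[of "fst (the P)" "snd (the P)"] by (cases P) (auto simp: comp_simps)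
    ultimately show "comp P = comp Q \<longleftrightarrow> \<not> node P" by simp
  qed (rule comp_opposite comp_tangent; assumption)+
  thus ?thesis by (simp add: comp_image)
qed

end

section \<open>Reduction to normal forms\<close>

lemma wcurve_eqI:
  "wa1 E = wa1 E' \<Longrightarrow> wa2 E = wa2 E' \<Longrightarrow> wa3 E = wa3 E' \<Longrightarrow> wa4 E = wa4 E' \<Longrightarrow> wa6 E = wa6 E' \<Longrightarrow> E = E'"
  by (cases E; cases E') simp

lemma complete_square:
  fixes E :: wcurve and r :: rat
  defines "s \<equiv> - wa1 E / 2" and "t \<equiv> - (wa3 E + r * wa1 E) / 2"
  shows "wtransform 1 r s t E = WC 0 ((wb2 E + 12 * r) / 4) 0 ((wb4 E + r * wb2 E + 6 * r ^ 2) / 2)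
     ((wb6 E + 2 * r * wb4 E + r ^ 2 * wb2 E + 4 * r ^ 3) / 4)"
proof -
  let ?E' = "wtransform 1 r s t E"
  have 0: "wa1 ?E' = 0" "wa3 ?E' = 0" by (simp_all add: s_def t_def field_simps)
  have "wb2 ?E' = 4 * wa2 ?E'" "wb4 ?E' = 2 * wa4 ?E'" "wb6 ?E' = 4 * wa6 ?E'"
    unfolding wb2_def wb4_def wb6_def 0 by simp_all
  thus ?thesis
    using 0 wb2_transform[of 1 r s t E] wb4_transform[of 1 r s t E] wb6_transform[of 1 r s t E]
    by (intro wcurve_eqI) simp_all
qed

lemma short_weierstrass:
  "wtransform 1 (- wb2 E / 12) (- wa1 E / 2) (- (wa3 E + (- wb2 E / 12) * wa1 E) / 2) E
     = WC 0 0 0 (- wc4 E / 48) (- wc6 E / 864)"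
  unfolding complete_square
  by (simp add: wc4_def wc6_def field_simps power2_eq_square power3_eq_cube)

text \<open>If \<open>c4\<close> is a unit then \<open>- c6 / (12 c4)\<close> is congruent to the abscissa of the node of the
  short model, with an error of the order of the discriminant.\<close>

definition node_model :: "wcurve \<Rightarrow> wcurve" where
  "node_model E = WC 0 (- wc6 E / (4 * wc4 E)) 0 (- 36 * wdisc E / wc4 E ^ 2) (wc6 E * wdisc E / wc4 E ^ 3)"

lemma node_model_eq:
  assumes "wc4 E \<noteq> 0"
  shows "node_model E = wtransform 1 (- wc6 E / (12 * wc4 E)) 0 0 (WC 0 0 0 (- wc4 E / 48) (- wc6 E / 864))"
proof -
  have disc: "wdisc E = (wc4 E ^ 3 - wc6 E ^ 2) / 1728" using wdisc_c4_c6[of E] by simp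
  show ?thesis
    using assms unfolding disc node_model_def
    by (intro wcurve_eqI) (simp_all add: field_simps power2_eq_square power3_eq_cube)
qed

lemma wdisc_node_model:
  assumes "wc4 E \<noteq> 0"
  shows "wdisc (node_model E) = wdisc E"
  unfolding node_model_eq[OF assms] short_weierstrass[symmetric] by (simp add: wdisc_transform)

context padic
begin

text \<open>One Newton step towards a2 = a3 = a4 = 0. As a1 is a unit, \<open>t\<close>,
  \<open>r\<close> and \<open>s\<close> can be chosen to cancel in turn the linear parts of a4, a3
  and a2; what remains is at least quadratic in quantities divisible by p^k.\<close>

lemma tate_form_step:
  assumes k: "k \<ge> 1" and a1: "punit (wa1 E)" and a2: "D k (wa2 E)" and a3: "D k (wa3 E)"
    and a4: "D k (wa4 E)" and a6: "D 1 (wa6 E)"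
  obtains r s t where "D 0 r" "D 0 s" "D 0 t" "punit (wa1 (wtransform 1 r s t E))"
    "D (k + 1) (wa2 (wtransform 1 r s t E))" "D (k + 1) (wa3 (wtransform 1 r s t E))"
    "D (k + 1) (wa4 (wtransform 1 r s t E))" "D 1 (wa6 (wtransform 1 r s t E))"
proof -
  define t where "t = wa4 E / wa1 E"
  define r where "r = - (wa3 E + 2 * t) / wa1 E"
  define s where "s = (wa2 E + 3 * r) / wa1 E"
  let ?E' = "wtransform 1 r s t E"
  have nz: "wa1 E \<noteq> 0" using a1 by (rule punit_nz)
  have a10: "D 0 (wa1 E)" using a1 by (simp add: punit_def)
  have t: "D k t" unfolding t_def punit_divide_iff[OF a1] by (rule a4)
  have r: "D k r" unfolding r_def punit_divide_iff[OF a1] pclose_minus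
    by (intro pclose_add a3 pclose_0_mult(1) t pclose_numeral)
  have s: "D k s" unfolding s_def punit_divide_iff[OF a1]
    by (intro pclose_add a2 pclose_0_mult(1) r pclose_numeral)
  have 0: "D 0 r" "D 0 s" "D 0 t" using r s t k by (auto intro: pclose_mono)
  have 1: "D 1 r" "D 1 s" "D 1 t" "D 1 (wa4 E)" using r s t a4 k by (auto intro: pclose_mono)
  have ta: "t * wa1 E = wa4 E" and ra: "r * wa1 E = - (wa3 E + 2 * t)" and sa: "s * wa1 E = wa2 E + 3 * r"
    using nz by (simp_all add: t_def r_def s_def)
  have 2: "D (k + 1) (x * y)" if "D k x" "D k y" for x y
    using k by (intro pclose_mult'[OF that]) simp
  have "wa1 ?E' = wa1 E + 2 * s" by simp
  hence A1: "punit (wa1 ?E')" using punit_add[OF a1 pclose_0_mult(1)[OF _ 1(2), of 2]] by simp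
  have "wa2 ?E' = - (s * s)" using sa by (simp add: power2_eq_square)
  hence A2: "D (k + 1) (wa2 ?E')" using 2[OF s s] by simp
  have "wa3 ?E' = 0" using ra by simp
  hence A3: "D (k + 1) (wa3 ?E')" by simp
  have "wa4 ?E' = - (s * wa3 E) + 2 * (r * wa2 E) - wa1 E * (r * s) + 3 * (r * r) - 2 * (s * t)"
    using ta by (simp add: algebra_simps power2_eq_square)
  moreover have "D (k + 1) (- (s * wa3 E) + 2 * (r * wa2 E) - wa1 E * (r * s) + 3 * (r * r) - 2 * (s * t))"
    by (intro pclose_add pclose_diff pclose_0_mult(1)[OF pclose_numeral(1)] pclose_0_mult(1)[OF a10]
        pclose_minus[THEN iffD2] 2 r s t a2 a3)
  ultimately have A4: "D (k + 1) (wa4 ?E')" by (simp only:)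
  have "wa6 ?E' = wa6 E + r * wa4 E + r * (r * wa2 E) + r * (r * r) - t * wa3 E - t * t - r * (t * wa1 E)"
    by (simp add: algebra_simps power2_eq_square power3_eq_cube)
  moreover have "D 1 (wa6 E + r * wa4 E + r * (r * wa2 E) + r * (r * r) - t * wa3 E - t * t - r * (t * wa1 E))"
    unfolding ta
    by (intro pclose_add pclose_diff a6 pclose_0_mult(1)[OF 0(1)] pclose_0_mult(1)[OF 0(3)]
        1 pclose_mono[OF a2 k] pclose_mono[OF a3 k])
  ultimately have A6: "D 1 (wa6 ?E')" by (simp only:)
  show ?thesis by (rule that[OF 0 A1 A2 A3 A4 A6])
qed

lemma tate_form:
  assumes "punit (wa1 E)" "D 1 (wa2 E)" "D 1 (wa3 E)" "D 1 (wa4 E)" "D 1 (wa6 E)" "k \<ge> 1"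
  obtains E' where "index_E0 p E' = index_E0 p E" "wdisc E' = wdisc E" "punit (wa1 E')"
    "D (int k) (wa2 E')" "D (int k) (wa3 E')" "D (int k) (wa4 E')" "D 1 (wa6 E')"
proof -
  have "\<exists>E'. index_E0 p E' = index_E0 p E \<and> wdisc E' = wdisc E \<and> punit (wa1 E') \<and>
    D (int k) (wa2 E') \<and> D (int k) (wa3 E') \<and> D (int k) (wa4 E') \<and> D 1 (wa6 E')"
    using assms(6)
  proof (induction k rule: nat_induct_at_least)
    case base
    show ?case using assms by (intro exI[of _ E]) simp
  next
    case (Suc k)
    then obtain E' where E': "index_E0 p E' = index_E0 p E" "wdisc E' = wdisc E" "punit (wa1 E')"
      "D (int k) (wa2 E')" "D (int k) (wa3 E')" "D (int k) (wa4 E')" "D 1 (wa6 E')" by blast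
    have k: "int k \<ge> 1" using Suc.hyps by simp
    obtain r s t where rst: "D 0 r" "D 0 s" "D 0 t" and new: "punit (wa1 (wtransform 1 r s t E'))"
      "D (int k + 1) (wa2 (wtransform 1 r s t E'))" "D (int k + 1) (wa3 (wtransform 1 r s t E'))"
      "D (int k + 1) (wa4 (wtransform 1 r s t E'))" "D 1 (wa6 (wtransform 1 r s t E'))"
      by (rule tate_form_step[OF k E'(3-7)])
    have "index_E0 p (wtransform 1 r s t E') = index_E0 p E'"
      by (rule index_E0_transform[OF punit_1 rst refl])
    thus ?case using E' new wdisc_transform[of 1 r s t E']
      by (intro exI[of _ "wtransform 1 r s t E'"]) (simp add: add.commute del: wtransform_sel)
  qed
  thus ?thesis using that by blast
qed

text \<open>In this form the discriminant is a unit times a6, up to an error in p^(n+1): the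
  coefficient \<open>U\<close> of a6 reduces to \<open>- (wb2 E ^ 3)\<close>.\<close>

lemma valuation_tate_disc:
  assumes n: "n \<ge> 1" and a1: "punit (wa1 E)" and a2: "D 1 (wa2 E)" and a3: "D n (wa3 E)"
    and a4: "D n (wa4 E)" and a6: "D 1 (wa6 E)" and k: "k \<le> n + 1"
  shows "D k (wdisc E) \<longleftrightarrow> D k (wa6 E)"
proof -
  define U where "U = - (wb2 E ^ 3) + (- 27 * (8 * (wa3 E * wa3 E) + 16 * wa6 E) + 36 * (wb2 E * wb4 E))"
  define c8 where "c8 = - (wa1 E * (wa3 E * wa4 E)) + wa2 E * (wa3 E * wa3 E) - wa4 E * wa4 E"
  define V where "V = - (wb2 E ^ 2 * c8) - 8 * (wb4 E * (wb4 E * wb4 E)) - 27 * ((wa3 E * wa3 E) * (wa3 E * wa3 E))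
    + 9 * (wb2 E * (wb4 E * (wa3 E * wa3 E)))"
  have b6: "wb6 E = wa3 E * wa3 E + 4 * wa6 E" by (simp add: wb6_def power2_eq_square)
  have b8: "wb8 E = wb2 E * wa6 E + c8"
    by (simp add: wb8_def wb2_def c8_def algebra_simps power2_eq_square)
  have disc: "wdisc E = V + U * wa6 E"
    unfolding wdisc_def b6 b8 U_def V_def by (simp add: algebra_simps power2_eq_square power3_eq_cube)
  have a10: "D 0 (wa1 E)" using a1 by (simp add: punit_def)
  have a30: "D 0 (wa3 E)" "D 1 (wa3 E)" using n by (auto intro: pclose_mono[OF a3])
  have a20: "D 0 (wa2 E)" by (rule pclose_mono[OF a2]) simp
  note num = pclose_0_mult(1)[OF pclose_numeral(1)]
  have b2: "punit (wb2 E)"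
    unfolding wb2_def by (intro punit_add punit_power a1 num a2)
  hence b20: "D 0 (wb2 E)" by (simp add: punit_def)
  have b4: "D n (wb4 E)" unfolding wb4_def
    by (intro pclose_add num a4 pclose_0_mult(1)[OF a10] a3)
  hence b41: "D 1 (wb4 E)" "D 0 (wb4 E)" using n by (auto intro: pclose_mono)
  have m27: "D 0 (- 27)" by simp
  have U: "punit U" unfolding U_def
    by (intro punit_add punit_minus[THEN iffD2] punit_power b2 pclose_add pclose_0_mult(1)[OF m27] num a6
        pclose_0_mult(1)[OF b20] pclose_0_mult(1)[OF a30(1)] a30(2) b41)
  have 2: "D (n + 1) (x * y)" if "D n x" "D n y" for x y
    using n by (intro pclose_mult'[OF that]) simp
  have c8: "D (n + 1) c8" unfolding c8_def
    by (intro pclose_add pclose_diff pclose_minus[THEN iffD2] pclose_0_mult(1)[OF a10]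
        pclose_0_mult(1)[OF a20] 2 a3 a4)
  have b22: "D 0 (wb2 E ^ 2)" using pclose_power[OF b20, of 2] by simp
  have a33: "D 0 (wa3 E * wa3 E)" using pclose_0_mult(1)[OF a30(1) a30(1)] .
  have "D (n + 1) V" unfolding V_def
    by (intro pclose_add pclose_diff pclose_minus[THEN iffD2] pclose_0_mult(1)[OF b22] c8 num
        pclose_0_mult(1)[OF b41(2)] 2 b4 pclose_0_mult(1)[OF a33] pclose_0_mult(1)[OF b20] a3)
  hence "D k V" using k by (rule pclose_mono)
  thus ?thesis unfolding disc using pclose_add_cancel punit_mult_iff(1)[OF U] by simp
qed

lemma split_multiplicative:
  assumes a: "punit (wa1 E)" "D 1 (wa2 E)" "D 1 (wa3 E)" "D 1 (wa4 E)" "D 1 (wa6 E)"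
    and n: "n \<ge> 1" and disc: "D (int n) (wdisc E)" "\<not> D (int n + 1) (wdisc E)"
  shows "index_E0 p E = n" "\<not> D 4 (wc4 E)"
proof -
  obtain E' where E': "index_E0 p E' = index_E0 p E" "wdisc E' = wdisc E" "punit (wa1 E')"
    "D (int n) (wa2 E')" "D (int n) (wa3 E')" "D (int n) (wa4 E')" "D 1 (wa6 E')"
    using tate_form[OF a n] by blast
  have "D k (wdisc E') \<longleftrightarrow> D k (wa6 E')" if "k \<le> int n + 1" for k
    using n by (intro valuation_tate_disc[of "int n"] E' that pclose_mono[OF E'(4)]) simp_all
  hence a6: "D (int n) (wa6 E')" "\<not> D (int n + 1) (wa6 E')" using disc E'(2) by simp_all
  interpret split_node p E' n
    by unfold_locales (fact n E' a6)+
  show "index_E0 p E = n" using index_E0_eq E'(1) by simp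
  note num = pclose_0_mult(1)[OF pclose_numeral(1)]
  \<comment> \<open>c4 is congruent to \<open>wa1 E ^ 4\<close>, hence a unit; this is what the
    minimality criterion will consume.\<close>
  have "punit (wb2 E)" unfolding wb2_def by (intro punit_add punit_power a num)
  moreover have "D 1 (- 24 * wb4 E)" unfolding wb4_def
    using a by (intro pclose_0_mult(1) pclose_add) (simp_all add: punit_def)
  ultimately have "punit (wb2 E ^ 2 + - 24 * wb4 E)" by (intro punit_add punit_power)
  hence "punit (wc4 E)" by (simp add: wc4_def)
  thus "\<not> D 4 (wc4 E)" by (auto simp: punit_def intro: pclose_mono)
qed

end

section \<open>Multiplicative reduction for primes at least 5\<close>

locale padic_ge5 = padic +
  assumes p_ge5: "p \<ge> 5"
begin

lemma punit_small_primes: "punit 2" "punit 3" "punit 4" "punit 12" "punit 36" "punit 48" "punit 864" "punit 1728"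
proof -
  have "\<not> p dvd 2" "\<not> p dvd 3" using p_ge5 zdvd_not_zless[of 2 p] zdvd_not_zless[of 3 p] by auto
  hence 23: "punit 2" "punit 3" using punit_of_int[of 2] punit_of_int[of 3] by auto
  have "punit (2 ^ i * 3 ^ j)" for i j by (intro punit_mult punit_power 23)
  from this[of 1 0] this[of 0 1] this[of 2 0] this[of 2 1] this[of 2 2] this[of 4 1] this[of 5 3] this[of 6 3]
  show "punit 2" "punit 3" "punit 4" "punit 12" "punit 36" "punit 48" "punit 864" "punit 1728" by simp_all
qed

lemma index_E0_short:
  assumes "p_integral p E"
  shows "index_E0 p E = index_E0 p (WC 0 0 0 (- wc4 E / 48) (- wc6 E / 864))"
proof -
  have a: "D 0 (wa1 E)" "D 0 (wa3 E)" using assms by (auto simp: p_integral_def)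
  have r: "D 0 (- wb2 E / 12)"
    unfolding punit_divide_iff[OF punit_small_primes(4)] pclose_minus by (rule p_integral_b[OF assms])
  have s: "D 0 (- wa1 E / 2)" and t: "D 0 (- (wa3 E + (- wb2 E / 12) * wa1 E) / 2)"
    unfolding punit_divide_iff[OF punit_small_primes(1)] pclose_minus
    by (intro pclose_add pclose_0_mult(1) r a)+
  show ?thesis by (rule index_E0_transform[OF punit_1 r s t, symmetric]) (simp only: short_weierstrass)
qed

lemma index_E0_node_model:
  assumes "p_integral p E" and c4: "punit (wc4 E)"
  shows "index_E0 p E = index_E0 p (node_model E)"
proof -
  have x: "D 0 (- wc6 E / (12 * wc4 E))"
    unfolding punit_divide_iff[OF punit_mult[OF punit_small_primes(4) c4]] pclose_minus
    by (rule p_integral_b[OF assms(1)])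
  from index_E0_transform[OF punit_1 x pclose_0 pclose_0 node_model_eq] index_E0_short[OF assms(1)]
  show ?thesis using punit_nz[OF c4] by simp
qed

text \<open>Modulo \<open>p\<close> the tangent slopes at the node are the square roots of
  \<open>A2\<close>, which equals - c4 c6 divided by the square of 2 c4. The hypothesis on
  \<open>e\<close> puts it in the square class of \<open>e\<close>, so the Legendre symbol separates
  split from nonsplit.\<close>

lemma multiplicative:
  fixes e :: int and n :: nat
  assumes i: "p_integral p E" and c4: "punit (wc4 E)" and n: "n \<ge> 1"
    and disc: "D (int n) (wdisc E)" "\<not> D (int n + 1) (wdisc E)"
    and e: "D 1 (- wc6 E * wc4 E - of_int e * g ^ 2)" and g: "punit g"
  shows "Legendre e p = 1 \<Longrightarrow> index_E0 p E = n"
    "Legendre e p = - 1 \<Longrightarrow> even n \<Longrightarrow> index_E0 p E = 2"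
    "Legendre e p = - 1 \<Longrightarrow> odd n \<Longrightarrow> index_E0 p E = 1"
proof -
  define A2 where "A2 = - wc6 E / (4 * wc4 E)"
  define A4 where "A4 = - 36 * wdisc E / wc4 E ^ 2"
  define A6 where "A6 = wc6 E * wdisc E / wc4 E ^ 3"
  let ?N = "WC 0 A2 0 A4 A6"
  have N: "node_model E = ?N" by (simp add: node_model_def A2_def A4_def A6_def)
  have idx: "index_E0 p E = index_E0 p ?N"
    unfolding N[symmetric] by (rule index_E0_node_model[OF i c4])
  have nz: "wc4 E \<noteq> 0" using c4 by (rule punit_nz)
  have n1: "D 1 (wdisc E)" using n by (intro pclose_mono[OF disc(1)]) simp
  have c6: "punit (wc6 E)"
  proof -
    have "punit (wc4 E ^ 3 + - (1728 * wdisc E))"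
      using n1 by (intro punit_add punit_power c4) (simp add: pclose_0_mult(1))
    also have "wc4 E ^ 3 + - (1728 * wdisc E) = wc6 E ^ 2" by (simp add: wdisc_c4_c6)
    finally have "\<not> D 1 (wc6 E ^ 2)" by (simp add: punit_def)
    thus ?thesis using p_integral_b(6)[OF i] pclose_power'[of 1 "wc6 E" 1 2] by (auto simp: punit_def)
  qed
  have A4: "D (int n) A4"
    unfolding A4_def punit_divide_iff[OF punit_power[OF c4]] by (rule pclose_0_mult(1)[OF _ disc(1)]) simp
  have A6: "D k A6 \<longleftrightarrow> D k (wdisc E)" for k
    unfolding A6_def punit_divide_iff[OF punit_power[OF c4]] punit_mult_iff(1)[OF c6] ..
  have A2: "punit A2"
    unfolding A2_def by (intro punit_divide punit_mult punit_small_primes c4 punit_minus[THEN iffD2] c6)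
  define h where "h = g / (2 * wc4 E)"
  have c2: "punit (2 * wc4 E)" by (intro punit_mult punit_small_primes c4)
  have h: "punit h" unfolding h_def by (intro punit_divide g c2)
  have h0: "h \<noteq> 0" "D 0 h" using h punit_nz by (auto simp: punit_def)
  have A2e: "D 1 (A2 - of_int e * h ^ 2)"
  proof -
    have "A2 - of_int e * h ^ 2 = (- wc6 E * wc4 E - of_int e * g ^ 2) / (2 * wc4 E) ^ 2"
      using nz by (simp add: A2_def h_def field_simps power2_eq_square)
    thus ?thesis using e by (simp only: punit_divide_iff[OF punit_power[OF c2]])
  qed
  {
    assume "Legendre e p = 1"
    then obtain y where "p dvd y ^ 2 - e"
      by (auto simp: Legendre_def QuadRes_def cong_iff_dvd_diff split: if_splits)
    hence "D 1 (of_int (y ^ 2 - e))" by (simp only: pclose_1_of_int)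
    hence y: "D 1 ((of_int y ^ 2 - of_int e) * h ^ 2)"
      using pclose_power[OF h0(2), of 2] by (intro pclose_0_mult(2)) simp_all
    define \<sigma> where "\<sigma> = of_int y * h"
    have \<sigma>0: "D 0 \<sigma>" unfolding \<sigma>_def by (intro pclose_0_mult(1) h0) simp
    have "A2 - \<sigma> ^ 2 = (A2 - of_int e * h ^ 2) - (of_int y ^ 2 - of_int e) * h ^ 2"
      by (simp add: \<sigma>_def algebra_simps power_mult_distrib)
    hence \<sigma>: "D 1 (A2 - \<sigma> ^ 2)" using pclose_diff[OF A2e y] by (simp only:)
    have "punit \<sigma>"
    proof (rule ccontr)
      assume "\<not> punit \<sigma>"
      hence "D 1 \<sigma>" using \<sigma>0 by (simp add: punit_def)
      hence "D 1 (\<sigma> ^ 2)" by (rule pclose_power') simp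
      from pclose_add[OF \<sigma> this] A2 show False by (simp add: punit_def)
    qed
    \<comment> \<open>Shearing by a tangent slope makes a2 divisible by \<open>p\<close> and turns
      a1 into the unit \<open>2 * \<sigma>\<close>.\<close>
    define M where "M = wtransform 1 0 \<sigma> 0 ?N"
    have "wdisc M = wdisc E"
    proof -
      have "wdisc ?N = wdisc E" using wdisc_node_model[OF nz] unfolding N .
      thus ?thesis by (simp add: M_def wdisc_transform)
    qed
    hence d: "D (int n) (wdisc M)" "\<not> D (int n + 1) (wdisc M)" using disc by simp_all
    have "index_E0 p M = n"
    proof (rule split_multiplicative(1)[OF _ _ _ _ _ n d])
      show "punit (wa1 M)" using \<open>punit \<sigma>\<close> punit_small_primes(1) by (simp add: M_def punit_mult)
      show "D 1 (wa2 M)" using \<sigma> by (simp add: M_def)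
      show "D 1 (wa3 M)" by (simp add: M_def)
      show "D 1 (wa4 M)" using n by (simp add: M_def pclose_mono[OF A4])
      show "D 1 (wa6 M)" using n1 by (simp add: M_def A6)
    qed
    moreover have "index_E0 p M = index_E0 p ?N"
      by (rule index_E0_transform[OF punit_1 pclose_0 \<sigma>0 pclose_0 M_def])
    ultimately show "index_E0 p E = n" using idx by simp
  }
  {
    assume L: "Legendre e p = - 1"
    have ns: "\<not> D 1 (s ^ 2 - A2)" if "D 0 s" for s
    proof
      assume s: "D 1 (s ^ 2 - A2)"
      \<comment> \<open>Dividing by \<open>h\<close> and rounding to an integer turns a square root
        of \<open>A2\<close> modulo \<open>p\<close> into one of \<open>e\<close>.\<close>
      define z where "z = s / h"
      have z: "D 0 z" unfolding z_def punit_divide_iff[OF h] by (rule that)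
      obtain m where m: "D 1 (z - of_int m)" using int_approx[OF z] .
      have "D 1 ((s ^ 2 - A2) + (A2 - of_int e * h ^ 2))" by (intro pclose_add s A2e)
      moreover have "z ^ 2 - of_int e = ((s ^ 2 - A2) + (A2 - of_int e * h ^ 2)) / h ^ 2"
        using h0 by (simp add: z_def power_divide diff_divide_distrib)
      ultimately have "D 1 (z ^ 2 - of_int e)" by (simp only: punit_divide_iff[OF punit_power[OF h]])
      moreover have "D 1 ((z - of_int m) * (z + of_int m))"
        by (intro pclose_0_mult(2)[OF _ m] pclose_add z) simp
      ultimately have "D 1 (z ^ 2 - of_int e - (z - of_int m) * (z + of_int m))" by (rule pclose_diff)
      also have "z ^ 2 - of_int e - (z - of_int m) * (z + of_int m) = of_int (m ^ 2 - e)"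
        by (simp add: algebra_simps power2_eq_square)
      finally have "p dvd m ^ 2 - e" by (simp only: pclose_1_of_int)
      hence "QuadRes p e" by (auto simp: QuadRes_def cong_iff_dvd_diff)
      with L show False by (auto simp: Legendre_def split: if_splits)
    qed
    interpret N: nonsplit_node p A2 A4 A6 n
      using p_ge5 n A2 A4 disc ns by unfold_locales (simp_all add: punit_def A6)
    show "even n \<Longrightarrow> index_E0 p E = 2" "odd n \<Longrightarrow> index_E0 p E = 1"
      using N.index_E0_even N.index_E0_odd idx by simp_all
  }
qed

end

section \<open>The curves with a point of order 5 and their quotients\<close>

definition quad :: "int \<Rightarrow> int \<Rightarrow> int" where "quad a b = a ^ 2 + 11 * a * b - b ^ 2"

lemma EC5_sel [simp]:
  "wa1 (EC5 a b) = of_int (a - b)" "wa2 (EC5 a b) = of_int (- a * b)"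
  "wa3 (EC5 a b) = of_int (- (a ^ 2 * b))" "wa4 (EC5 a b) = 0" "wa6 (EC5 a b) = 0"
  by (simp_all only: EC5_def wcurve.sel)

lemma EC5t_sel [simp]:
  "wa1 (EC5t a b) = of_int (a - b)" "wa2 (EC5t a b) = of_int (- a * b)"
  "wa3 (EC5t a b) = of_int (- (a ^ 2 * b))"
  "wa4 (EC5t a b) = of_int (5 * a * b * (a ^ 2 - 2 * a * b - b ^ 2))"
  "wa6 (EC5t a b) = of_int (a * b * (a ^ 4 - 15 * a ^ 3 * b + 5 * a ^ 2 * b ^ 2 - 10 * a * b ^ 3 - b ^ 4))"
  by (simp_all only: EC5t_def wcurve.sel)

text \<open>The invariants of both curves are arranged around multiples of \<open>quad\<close>.
  Modulo it, c4 and c6 become 5 a^2 b^2 and (a^2 + b^2) a^2 b^2; for the quotient curve, 5^5 a^2 b^2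
  and 5^6 (a^2 + b^2) a^2 b^2.\<close>

lemma wc4_EC5: "wc4 (EC5 a b) = of_int (quad a b * (a ^ 2 + a * b - b ^ 2) + 5 * a ^ 2 * b ^ 2)"
  by (simp add: wc4_def wb2_def wb4_def quad_def algebra_simps power_numeral_reduce)

lemma wc6_EC5:
  "wc6 (EC5 a b) = of_int (- (a ^ 2 + b ^ 2) * (quad a b * (a ^ 2 + 7 * a * b - b ^ 2) - a ^ 2 * b ^ 2))"
  by (simp add: wc6_def wb2_def wb4_def wb6_def quad_def algebra_simps power_numeral_reduce)

lemma wdisc_EC5: "wdisc (EC5 a b) = of_int (- ((a * b) ^ 5 * quad a b))"
  by (simp add: wdisc_def wb2_def wb4_def wb6_def wb8_def quad_def algebra_simps power_numeral_reduce)

lemma wc4_EC5t: "wc4 (EC5t a b) = of_int (quad a b * (quad a b - 250 * a * b) + 3125 * a ^ 2 * b ^ 2)"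
  by (simp add: wc4_def wb2_def wb4_def quad_def algebra_simps power_numeral_reduce)

lemma wc6_EC5t:
  "wc6 (EC5t a b) = of_int (- (a ^ 2 + b ^ 2) * (quad a b * (quad a b + 500 * a * b) - 15625 * a ^ 2 * b ^ 2))"
  by (simp add: wc6_def wb2_def wb4_def wb6_def quad_def algebra_simps power_numeral_reduce)

lemma wdisc_EC5t: "wdisc (EC5t a b) = of_int (- (a * b * quad a b ^ 5))"
  by (simp add: wdisc_def wb2_def wb4_def wb6_def wb8_def quad_def algebra_simps power_numeral_reduce)

lemma (in padic) p_integral_EC5: "p_integral p (EC5 a b)" "p_integral p (EC5t a b)"
  unfolding p_integral_def EC5_sel EC5t_sel by (simp_all only: pclose_of_int pclose_0 simp_thms)

section \<open>Primes dividing the quadratic factor\<close>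

lemma coprime_prime_not_both:
  fixes a b p :: int
  shows "coprime a b \<Longrightarrow> prime p \<Longrightarrow> p dvd a \<Longrightarrow> p dvd b \<Longrightarrow> False"
  using coprime_common_divisor not_prime_unit by blast

lemma quad_odd:
  assumes "coprime a b"
  shows "odd (quad a b)"
proof -
  have "\<not> (even a \<and> even b)" using assms by (auto dest: coprime_common_divisor)
  thus ?thesis by (auto simp: quad_def)
qed

lemma quad_nonzero: "coprime a b \<Longrightarrow> quad a b \<noteq> 0"
  using quad_odd by fastforce

text \<open>Modulo 3 the form is (a + b)^2 - 2 b^2, and 2 is not a square there; the proof simply
  runs through the residues.\<close>

lemma quad_not_dvd_3:
  assumes "coprime a b"
  shows "\<not> 3 dvd quad a b"
proof
  assume d: "3 dvd quad a b"
  have c: "[a = a mod 3] (mod 3)" "[b = b mod 3] (mod 3)" by (simp_all add: cong_def)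
  have "[quad a b = quad (a mod 3) (b mod 3)] (mod 3)"
    unfolding quad_def by (intro cong_add cong_diff cong_mult cong_pow cong_refl c)
  from cong_dvd_iff[OF this] d have z: "3 dvd quad (a mod 3) (b mod 3)" by (simp only:)
  have "a mod 3 = 0 \<or> a mod 3 = 1 \<or> a mod 3 = 2" "b mod 3 = 0 \<or> b mod 3 = 1 \<or> b mod 3 = 2"
    using pos_mod_sign[of 3 a] pos_mod_bound[of 3 a] pos_mod_sign[of 3 b] pos_mod_bound[of 3 b] by linarith+
  hence "a mod 3 = 0 \<and> b mod 3 = 0" using z by (elim disjE) (simp_all add: quad_def)
  hence "3 dvd a" "3 dvd b" by auto
  with assms show False by (auto dest: coprime_common_divisor)
qed

text \<open>Origin of the 18: the form has discriminant 125, so it is a square modulo 5, and the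
  square of a + 18 b agrees with it even modulo 25.\<close>

lemma quad_dvd_5: "5 dvd quad a b \<longleftrightarrow> 5 dvd a + 18 * b"
proof -
  have "quad a b = (a + 18 * b) ^ 2 + 5 * (- 5 * a * b - 65 * b ^ 2)"
    by (simp add: quad_def algebra_simps power2_eq_square)
  hence "5 dvd quad a b \<longleftrightarrow> 5 dvd (a + 18 * b) ^ 2"
    by (simp only: dvd_add_left_iff[OF dvd_triv_left])
  also have "\<dots> \<longleftrightarrow> 5 dvd a + 18 * b"
    using prime_dvd_power_iff[of "5::int" 2 "a + 18 * b"] by simp
  finally show ?thesis .
qed

lemma prime_dvd_quad:
  assumes "coprime a b" "prime p" "p dvd quad a b"
  shows "p \<ge> 7 \<or> p = 5 \<and> 5 dvd a + 18 * b"
proof (cases "p \<ge> 7")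
  case False
  have "p > 1" using assms(2) by (simp add: prime_gt_1_int)
  hence "p = 2 \<or> p = 3 \<or> p = 4 \<or> p = 5 \<or> p = 6" using False by linarith
  moreover have "\<not> prime (4 :: int)" "\<not> prime (6 :: int)"
    using primes_dvd_imp_eq[of 2 "4::int"] primes_dvd_imp_eq[of 2 "6::int"] by auto
  ultimately show ?thesis using assms quad_odd quad_not_dvd_3 quad_dvd_5 by auto
qed simp

locale coprime_parameters = padic +
  fixes a b :: int
  assumes cop: "coprime a b" and nz: "a * b \<noteq> 0"
begin

lemma nonzero: "a \<noteq> 0" "b \<noteq> 0" "quad a b \<noteq> 0"
  using nz quad_nonzero[OF cop] by auto

lemma pclose_wdisc_EC5:
  "D k (wdisc (EC5 a b)) \<longleftrightarrow> k \<le> 5 * int (multiplicity p (a * b)) + int (multiplicity p (quad a b))"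
proof -
  have e: "wdisc (EC5 a b) = - (of_int (a * b) ^ 5 * of_int (quad a b))" by (simp add: wdisc_EC5)
  have "vrat p (of_int (a * b) ^ 5 * of_int (quad a b)) = 5 * vrat p (of_int (a * b)) + vrat p (of_int (quad a b))"
    using nz nonzero by (subst vrat_mult) (simp_all add: vrat_power del: of_int_mult)
  thus ?thesis
    using nz nonzero unfolding e pclose_minus by (simp add: pclose_def vrat_of_int del: of_int_mult)
qed

lemma pclose_wdisc_EC5t:
  "D k (wdisc (EC5t a b)) \<longleftrightarrow> k \<le> int (multiplicity p (a * b)) + 5 * int (multiplicity p (quad a b))"
proof -
  have e: "wdisc (EC5t a b) = - (of_int (a * b) * of_int (quad a b) ^ 5)" by (simp add: wdisc_EC5t)
  have "vrat p (of_int (a * b) * of_int (quad a b) ^ 5) = vrat p (of_int (a * b)) + 5 * vrat p (of_int (quad a b))"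
    using nz nonzero by (subst vrat_mult) (simp_all add: vrat_power del: of_int_mult)
  thus ?thesis
    using nz nonzero unfolding e pclose_minus by (simp add: pclose_def vrat_of_int del: of_int_mult)
qed

lemma elliptic: "elliptic (EC5 a b)" "elliptic (EC5t a b)"
  using nonzero by (simp_all add: elliptic_def wdisc_EC5 wdisc_EC5t)

lemma minimal_self:
  assumes "elliptic E" "p_integral p E" "\<not> D 12 (wdisc E) \<or> \<not> D 4 (wc4 E)"
  shows "p_minimal_model p E E"
  by (rule minimal_modelI[OF assms(1) q_isomorphic_refl assms(2,3)])

lemma quad_not_dvd:
  assumes "p dvd a * b"
  shows "\<not> p dvd quad a b"
proof
  assume q: "p dvd quad a b"
  have "p dvd a \<or> p dvd b" using assms prime_p by (simp add: prime_dvd_mult_iff)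
  moreover have False if "p dvd a"
  proof -
    have "b ^ 2 = a * (a + 11 * b) - quad a b" by (simp add: quad_def algebra_simps power2_eq_square)
    hence "p dvd b ^ 2" using that q by (simp add: dvd_diff)
    hence "p dvd b" using prime_p prime_dvd_power by blast
    with that cop prime_p coprime_prime_not_both show False by blast
  qed
  moreover have False if "p dvd b"
  proof -
    have "a ^ 2 = quad a b - b * (11 * a - b)" by (simp add: quad_def algebra_simps power2_eq_square)
    hence "p dvd a ^ 2" using that q by (simp add: dvd_diff)
    hence "p dvd a" using prime_p prime_dvd_power by blast
    with that cop prime_p coprime_prime_not_both show False by blast
  qed
  ultimately show False by blast
qed

text \<open>The given equations already have a split node at the origin: \<open>p\<close> divides
  exactly one of \<open>a\<close> and \<open>b\<close>, so a1 = a - b is a unit while all other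
  coefficients are divisible by \<open>p\<close>.\<close>

lemma split_case:
  assumes ab: "p dvd a * b"
  defines "n \<equiv> multiplicity p (a * b)"
  shows "n \<ge> 1" "index_E0 p (EC5 a b) = 5 * n" "index_E0 p (EC5t a b) = n"
    "\<not> D 4 (wc4 (EC5 a b))" "\<not> D 4 (wc4 (EC5t a b))"
proof -
  have pe: "prime_elem p" using prime_p by (rule prime_imp_prime_elem)
  show n: "n \<ge> 1" unfolding n_def
    using ab nz prime_p by (metis One_nat_def Suc_leI multiplicity_eq_zero_iff not_prime_unit bot_nat_0.not_eq_extremum)
  have q0: "multiplicity p (quad a b) = 0" using quad_not_dvd[OF ab] by (rule not_dvd_imp_multiplicity_0)
  have pab: "p dvd a \<or> p dvd b" using ab prime_p by (simp add: prime_dvd_mult_iff)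
  have "\<not> p dvd a - b"
  proof
    assume "p dvd a - b"
    hence "p dvd a \<longleftrightarrow> p dvd b" by (metis dvd_diff_right_iff dvd_diffD dvd_diff_commute dvd_minus_iff)
    with pab cop prime_p coprime_prime_not_both show False by blast
  qed
  hence u: "punit (of_int (a - b))" by (simp only: punit_of_int not_False_eq_True simp_thms)
  have d: "p dvd - a * b" "p dvd - (a ^ 2 * b)" "p dvd 5 * a * b * x" "p dvd a * b * x" for x
    using pab by (auto simp: power2_eq_square)
  note s1 = split_multiplicative[of "EC5 a b" "5 * n"] and s2 = split_multiplicative[of "EC5t a b" n]
  show "index_E0 p (EC5 a b) = 5 * n" "\<not> D 4 (wc4 (EC5 a b))"
    using s1 n unfolding EC5_sel pclose_1_of_int pclose_wdisc_EC5 q0 n_def[symmetric]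
    using u d by simp_all
  show "index_E0 p (EC5t a b) = n" "\<not> D 4 (wc4 (EC5t a b))"
    using s2 n unfolding EC5t_sel pclose_1_of_int pclose_wdisc_EC5t q0 n_def[symmetric]
    using u d by simp_all
qed

lemma not_dvd_ab:
  assumes "p dvd quad a b"
  shows "\<not> p dvd a" "\<not> p dvd b" "multiplicity p (a * b) = 0"
proof -
  have "\<not> p dvd a * b" using assms quad_not_dvd by blast
  thus "\<not> p dvd a" "\<not> p dvd b" "multiplicity p (a * b) = 0" by (auto intro: not_dvd_imp_multiplicity_0)
qed

lemma node_case:
  assumes p7: "p \<ge> 7" and q: "p dvd quad a b"
  defines "n \<equiv> multiplicity p (quad a b)" and "e \<equiv> - 5 * (a ^ 2 + b ^ 2)"
  shows "n \<ge> 1" "punit (wc4 (EC5 a b))" "punit (wc4 (EC5t a b))"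
    "Legendre e p = 1 \<Longrightarrow> index_E0 p (EC5 a b) = n \<and> index_E0 p (EC5t a b) = 5 * n"
    "Legendre e p = - 1 \<Longrightarrow> even n \<Longrightarrow> index_E0 p (EC5 a b) = 2 \<and> index_E0 p (EC5t a b) = 2"
    "Legendre e p = - 1 \<Longrightarrow> odd n \<Longrightarrow> index_E0 p (EC5 a b) = 1 \<and> index_E0 p (EC5t a b) = 1"
proof -
  interpret padic_ge5 p by unfold_locales (use p7 in simp)
  show n: "n \<ge> 1" unfolding n_def
    using q nonzero prime_p by (metis One_nat_def Suc_leI multiplicity_eq_zero_iff not_prime_unit bot_nat_0.not_eq_extremum)
  note nd = not_dvd_ab[OF q]
  have "\<not> p dvd 5" using p7 zdvd_not_zless[of 5 p] by simp
  hence u: "punit (of_int (5 ^ i * (a ^ 2 * b ^ 2)))" for i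
    unfolding punit_of_int using nd prime_p prime_dvd_power[OF prime_p, of 5 i]
    by (auto simp: prime_dvd_mult_iff prime_dvd_power_iff)
  have quad: "D 1 (of_int (quad a b * x))" for x using q by (simp only: pclose_1_of_int dvd_mult2)
  have "wc4 (EC5 a b) = of_int (5 ^ 1 * (a ^ 2 * b ^ 2)) + of_int (quad a b * (a ^ 2 + a * b - b ^ 2))"
    by (simp add: wc4_EC5)
  thus c4: "punit (wc4 (EC5 a b))" using punit_add[OF u quad] by (simp only:)
  have "wc4 (EC5t a b) = of_int (5 ^ 5 * (a ^ 2 * b ^ 2)) + of_int (quad a b * (quad a b - 250 * a * b))"
    by (simp add: wc4_EC5t)
  thus c4t: "punit (wc4 (EC5t a b))" using punit_add[OF u quad] by (simp only:)
  \<comment> \<open>\<open>X\<close>, and \<open>Y\<close> below, are the cofactors of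
    \<open>quad\<close> in - c4 c6 minus \<open>e\<close> times a square. The square roots are a^2
    b^2 and 5^5 a^2 b^2, the latter because 5^5 * 5^6 = 5 * (5^5)^2.\<close>
  define X where "X = (a ^ 2 + b ^ 2) * ((a ^ 2 + 7 * a * b - b ^ 2) * (quad a b * (a ^ 2 + a * b - b ^ 2) + 5 * a ^ 2 * b ^ 2)
      - a ^ 2 * b ^ 2 * (a ^ 2 + a * b - b ^ 2))"
  have E: "- wc6 (EC5 a b) * wc4 (EC5 a b) - of_int e * of_int (a ^ 2 * b ^ 2) ^ 2 = of_int (quad a b * X)"
    unfolding wc6_EC5 wc4_EC5 e_def X_def by (simp add: algebra_simps power_numeral_reduce)
  define Y where "Y = (a ^ 2 + b ^ 2) * ((quad a b + 500 * a * b) * (quad a b * (quad a b - 250 * a * b) + 3125 * a ^ 2 * b ^ 2)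
      - 15625 * a ^ 2 * b ^ 2 * (quad a b - 250 * a * b))"
  have Et: "- wc6 (EC5t a b) * wc4 (EC5t a b) - of_int e * of_int (5 ^ 5 * (a ^ 2 * b ^ 2)) ^ 2 = of_int (quad a b * Y)"
    unfolding wc6_EC5t wc4_EC5t e_def Y_def by (simp add: algebra_simps power_numeral_reduce)
  have g: "punit (of_int (a ^ 2 * b ^ 2))" using u[of 0] by simp
  have d: "D (int n) (wdisc (EC5 a b))" "\<not> D (int n + 1) (wdisc (EC5 a b))"
    "D (int (5 * n)) (wdisc (EC5t a b))" "\<not> D (int (5 * n) + 1) (wdisc (EC5t a b))"
    unfolding pclose_wdisc_EC5 pclose_wdisc_EC5t n_def[symmetric] nd(3) by simp_all
  have n5: "5 * n \<ge> 1" using n by simp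
  note m = multiplicative[OF p_integral_EC5(1) c4 n d(1,2) _ g, of e, unfolded E, OF quad]
  note mt = multiplicative[OF p_integral_EC5(2) c4t n5 d(3,4) _ u[of 5], of e, unfolded Et, OF quad]
  show "Legendre e p = 1 \<Longrightarrow> index_E0 p (EC5 a b) = n \<and> index_E0 p (EC5t a b) = 5 * n"
    using m(1) mt(1) by blast
  show "Legendre e p = - 1 \<Longrightarrow> even n \<Longrightarrow> index_E0 p (EC5 a b) = 2 \<and> index_E0 p (EC5t a b) = 2"
    using m(2) mt(2) by simp
  show "Legendre e p = - 1 \<Longrightarrow> odd n \<Longrightarrow> index_E0 p (EC5 a b) = 1 \<and> index_E0 p (EC5t a b) = 1"
    using m(3) mt(3) by simp
qed

end

lemma (in padic) pclose_power_mult: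
  shows "j \<le> int k \<Longrightarrow> D j (of_int (p ^ k * u))"
    and "\<not> p dvd u \<Longrightarrow> D j (of_int (p ^ k * u)) \<longleftrightarrow> j \<le> int k"
proof -
  assume "j \<le> int k"
  thus "D j (of_int (p ^ k * u))" using pclose_of_int_dvd[of k "p ^ k * u"] by (auto intro: pclose_mono)
next
  assume u: "\<not> p dvd u"
  hence "u \<noteq> 0" by auto
  hence "vrat p (of_int (p ^ k) * of_int u) = int k"
    using u by (simp add: vrat_mult vrat_power vrat_of_int not_dvd_imp_multiplicity_0)
  thus "D j (of_int (p ^ k * u)) \<longleftrightarrow> j \<le> int k" using \<open>u \<noteq> 0\<close> by (simp add: pclose_def)
qed

lemma not_dvd_add_mult: "\<not> (p :: int) dvd u \<Longrightarrow> \<not> p dvd u + p * x"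
  by (simp add: dvd_add_left_iff)

section \<open>The prime 5\<close>

locale coprime_parameters_5 = coprime_parameters 5 a b for a b +
  assumes a18b: "5 dvd a + 18 * b"
begin

sublocale padic_ge5 5 by unfold_locales simp

lemma not_dvd: "\<not> 5 dvd a" "\<not> 5 dvd b"
  using not_dvd_ab[of] a18b by (simp_all add: quad_dvd_5)

lemma not_dvd_a2b2: "\<not> 5 dvd a ^ 2 * b ^ 2"
  using not_dvd prime_p by (simp add: prime_dvd_mult_iff prime_dvd_power_iff)

lemma pclose_short: "D k (- x / 48) \<longleftrightarrow> D k x" "D k (- x / 864) \<longleftrightarrow> D k x"
  by (simp_all only: punit_divide_iff[OF punit_small_primes(6)] punit_divide_iff[OF punit_small_primes(7)] pclose_minus)

lemma pclose_1_wdisc: "D 1 (wdisc (EC5 a b))" "D 1 (wdisc (EC5t a b))"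
proof -
  have q: "5 dvd quad a b" using a18b by (simp only: quad_dvd_5)
  have "5 dvd quad a b ^ 5" by (rule dvd_trans[OF q dvd_power]) simp
  thus "D 1 (wdisc (EC5 a b))" "D 1 (wdisc (EC5t a b))"
    using q unfolding wdisc_EC5 wdisc_EC5t pclose_1_of_int by simp_all
qed

text \<open>Substituting a = 5 c - 18 b with \<open>c\<close> prime to 5 gives \<open>quad\<close>
  valuation 2 and a^2 + b^2 valuation 1. Hence c4 and c6 both have valuation 1, which is type II. On
  the quotient curve they have valuations at least 4 and exactly 5, with discriminant of valuation
  10, which is type II*.\<close>

lemma exactly_divisible:
  assumes "\<not> 25 dvd a + 18 * b"
  shows "p_minimal_model 5 (EC5 a b) (EC5 a b)" "p_minimal_model 5 (EC5t a b) (EC5t a b)"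
    "index_E0 5 (EC5 a b) = 1" "index_E0 5 (EC5t a b) = 1"
proof -
  obtain c where c: "a + 18 * b = 5 * c" using a18b by (elim dvdE)
  have a: "a = 5 * c - 18 * b" using c by simp
  have nc: "\<not> 5 dvd c" using assms unfolding c by auto
  define q where "q = c ^ 2 + 5 * (b ^ 2 - b * c)"
  define e where "e = - (b * c) + 5 * (c ^ 2 - 7 * (b * c) + 13 * b ^ 2)"
  have quad: "quad a b = 5 ^ 2 * q" by (simp add: quad_def a q_def algebra_simps power2_eq_square)
  have ab: "a ^ 2 + b ^ 2 = 5 * e" by (simp add: a e_def algebra_simps power2_eq_square)
  have q: "\<not> 5 dvd q" unfolding q_def
    using nc prime_p by (intro not_dvd_add_mult) (simp add: prime_dvd_power_iff)
  have e: "\<not> 5 dvd e" unfolding e_def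
    using nc not_dvd prime_p by (intro not_dvd_add_mult) (simp add: prime_dvd_mult_iff)
  have c4: "wc4 (EC5 a b) = of_int (5 ^ 1 * (a ^ 2 * b ^ 2 + 5 * (q * (a ^ 2 + a * b - b ^ 2))))"
    unfolding wc4_EC5 quad by (simp add: algebra_simps)
  have c6: "wc6 (EC5 a b) = of_int (5 ^ 1 * (e * (a ^ 2 * b ^ 2 + 5 * (- 5 * q * (a ^ 2 + 7 * a * b - b ^ 2)))))"
    unfolding wc6_EC5 quad ab by (simp add: algebra_simps)
  have c4t: "wc4 (EC5t a b) = of_int (5 ^ 4 * (q * (q - 10 * a * b) + 5 * a ^ 2 * b ^ 2))"
    unfolding wc4_EC5t quad by (simp add: algebra_simps)
  have c6t: "wc6 (EC5t a b) = of_int (5 ^ 5 * (- (e * (q ^ 2 + 5 * (4 * q * a * b - 5 * a ^ 2 * b ^ 2)))))"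
    unfolding wc6_EC5t quad ab by (simp add: algebra_simps power2_eq_square)
  have dt: "wdisc (EC5t a b) = of_int (5 ^ 10 * (- (a * b * q ^ 5)))"
    unfolding wdisc_EC5t quad by (simp add: power_mult_distrib)
  have v4: "D j (wc4 (EC5 a b)) \<longleftrightarrow> j \<le> 1" for j
    unfolding c4 by (subst pclose_power_mult(2)) (rule not_dvd_add_mult[OF not_dvd_a2b2], simp)
  have v6: "D j (wc6 (EC5 a b)) \<longleftrightarrow> j \<le> 1" for j
    unfolding c6 using e not_dvd_add_mult[OF not_dvd_a2b2] prime_p
    by (subst pclose_power_mult(2)) (simp_all only: prime_dvd_mult_iff of_nat_1 simp_thms)
  have v4t: "D j (wc4 (EC5t a b))" if "j \<le> 4" for j
    unfolding c4t by (rule pclose_power_mult(1)) (use that in simp)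
  have q2: "\<not> 5 dvd q ^ 2" using q prime_p by (simp add: prime_dvd_power_iff)
  have v6t: "D j (wc6 (EC5t a b)) \<longleftrightarrow> j \<le> 5" for j
    unfolding c6t using e not_dvd_add_mult[OF q2] prime_p
    by (subst pclose_power_mult(2)) (simp_all only: dvd_minus_iff prime_dvd_mult_iff of_nat_numeral simp_thms)
  show "p_minimal_model 5 (EC5 a b) (EC5 a b)"
    by (rule minimal_self) (simp_all add: elliptic p_integral_EC5 v4)
  have "\<not> 5 dvd - (a * b * q ^ 5)"
    using not_dvd q prime_p by (simp add: prime_dvd_mult_iff prime_dvd_power_iff)
  hence "\<not> D 12 (wdisc (EC5t a b))" unfolding dt by (subst pclose_power_mult(2)) simp_all
  thus "p_minimal_model 5 (EC5t a b) (EC5t a b)"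
    by (intro minimal_self elliptic p_integral_EC5 disjI1)
  show "index_E0 5 (EC5 a b) = 1"
    unfolding index_E0_short[OF p_integral_EC5(1)]
    by (rule index_E0_type_II; simp only: pclose_short v4 v6; simp)
  show "index_E0 5 (EC5t a b) = 1"
    unfolding index_E0_short[OF p_integral_EC5(2)]
    by (rule index_E0_type_II_star; simp only: pclose_short v4t v6t; simp)
qed

text \<open>Substituting a = 25 d - 18 b raises the valuation of \<open>quad\<close> to 3 and makes
  a^2 + b^2 divisible by 25. Then c4 and c6 have valuations 1 and at least 2, which is type III. On
  the quotient curve these are 5 and at least 8; scaling by 5 removes 4 and 6, and type III appears
  again.\<close>

lemma divisible_by_25:
  assumes "25 dvd a + 18 * b"
  shows "p_minimal_model 5 (EC5 a b) (EC5 a b)" "index_E0 5 (EC5 a b) = 2"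
    "\<exists>N. p_minimal_model 5 (EC5t a b) N \<and> index_E0 5 N = 2 \<and> D 1 (wdisc N)"
proof -
  obtain d where d: "a + 18 * b = 25 * d" using assms by (elim dvdE)
  have a: "a = 25 * d - 18 * b" using d by simp
  define q where "q = b ^ 2 + 5 * (d ^ 2 - b * d)"
  define e where "e = 25 * d ^ 2 - 36 * b * d + 13 * b ^ 2"
  have quad: "quad a b = 5 ^ 3 * q" by (simp add: quad_def a q_def algebra_simps power2_eq_square)
  have ab: "a ^ 2 + b ^ 2 = 5 ^ 2 * e" by (simp add: a e_def algebra_simps power2_eq_square)
  have q: "\<not> 5 dvd q" unfolding q_def
    using not_dvd prime_p by (intro not_dvd_add_mult) (simp add: prime_dvd_power_iff)
  have c4: "wc4 (EC5 a b) = of_int (5 ^ 1 * (a ^ 2 * b ^ 2 + 5 * (5 * q * (a ^ 2 + a * b - b ^ 2))))"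
    unfolding wc4_EC5 quad by (simp add: algebra_simps)
  have c6: "wc6 (EC5 a b) = of_int (5 ^ 2 * (- e * (quad a b * (a ^ 2 + 7 * a * b - b ^ 2) - a ^ 2 * b ^ 2)))"
    unfolding wc6_EC5 ab by (simp add: algebra_simps)
  have c4t: "wc4 (EC5t a b) = of_int (5 ^ 5 * (a ^ 2 * b ^ 2 + 5 * (q * (q - 2 * a * b))))"
    unfolding wc4_EC5t quad by (simp add: algebra_simps)
  have c6t: "wc6 (EC5t a b) = of_int (5 ^ 8 * (- e * (q * (q + 4 * a * b) - a ^ 2 * b ^ 2)))"
    unfolding wc6_EC5t quad ab by (simp add: algebra_simps)
  have dt: "wdisc (EC5t a b) = of_int (5 ^ 15 * (- (a * b * q ^ 5)))"
    unfolding wdisc_EC5t quad by (simp add: power_mult_distrib)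
  have v4: "D j (wc4 (EC5 a b)) \<longleftrightarrow> j \<le> 1" for j
    unfolding c4 by (subst pclose_power_mult(2)) (rule not_dvd_add_mult[OF not_dvd_a2b2], simp)
  have v6: "D 2 (wc6 (EC5 a b))" unfolding c6 by (rule pclose_power_mult(1)) simp
  have v4t: "D j (wc4 (EC5t a b)) \<longleftrightarrow> j \<le> 5" for j
    unfolding c4t by (subst pclose_power_mult(2)) (rule not_dvd_add_mult[OF not_dvd_a2b2], simp)
  have v6t: "D 8 (wc6 (EC5t a b))" unfolding c6t by (rule pclose_power_mult(1)) simp
  \<comment> \<open>13 = 12 + 1: a factor 5 survives the division by 5^12 in the scaled model, so
    its reduction is still bad.\<close>
  have vd: "D 13 (wdisc (EC5t a b))" unfolding dt by (rule pclose_power_mult(1)) simp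
  show "p_minimal_model 5 (EC5 a b) (EC5 a b)"
    by (rule minimal_self) (simp_all add: elliptic p_integral_EC5 v4)
  show "index_E0 5 (EC5 a b) = 2"
    unfolding index_E0_short[OF p_integral_EC5(1)]
    by (rule index_E0_type_III; simp only: pclose_short v4 v6; simp)
  have pk: "D j (x / 5 ^ k) \<longleftrightarrow> D (j + int k) x" for j x k
    using pclose_divide_iff[of "int k" "5 ^ k" j x] pclose_power_mult(2)[of 1 _ k] by simp
  define S where "S = WC 0 0 0 (- wc4 (EC5t a b) / 48) (- wc6 (EC5t a b) / 864)"
  define A B where "A = - wc4 (EC5t a b) / 48 / 5 ^ 4" and "B = - wc6 (EC5t a b) / 864 / 5 ^ 6"
  have A: "D j A \<longleftrightarrow> j \<le> 1" for j unfolding A_def pk pclose_short v4t by simp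
  have B: "D 2 B" unfolding B_def pk pclose_short using v6t by simp
  let ?N = "WC 0 0 0 A B"
  have N: "?N = wtransform 5 0 0 0 S" by (intro wcurve_eqI) (simp_all add: A_def B_def S_def)
  have S: "S = wtransform 1 (- wb2 (EC5t a b) / 12) (- wa1 (EC5t a b) / 2)
      (- (wa3 (EC5t a b) + (- wb2 (EC5t a b) / 12) * wa1 (EC5t a b)) / 2) (EC5t a b)"
    unfolding short_weierstrass S_def ..
  have "q_isomorphic (EC5t a b) S" "q_isomorphic S ?N"
    unfolding q_isomorphic_def using S N by (metis one_neq_zero zero_neq_numeral)+
  hence iso: "q_isomorphic (EC5t a b) ?N" by (rule q_isomorphic_trans)
  have int: "p_integral 5 ?N" using A B by (simp add: p_integral_def pclose_mono[OF B])
  have cN: "wc4 ?N = wc4 (EC5t a b) / 5 ^ 4" "wdisc ?N = wdisc (EC5t a b) / 5 ^ 12"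
    unfolding N wc4_transform[OF zero_neq_numeral[symmetric]] wdisc_transform[OF zero_neq_numeral[symmetric]]
    unfolding S by (simp_all only: wc4_transform wdisc_transform one_neq_zero not_False_eq_True power_one div_by_1)
  have "p_minimal_model 5 (EC5t a b) ?N"
    by (rule minimal_modelI[OF elliptic(2) iso int]) (simp add: cN(1) pk v4t del: power_numeral)
  moreover have "index_E0 5 ?N = 2" by (rule index_E0_type_III) (use A B in auto)
  moreover have "D 1 (wdisc ?N)" unfolding cN(2) pk using vd by simp
  ultimately show "\<exists>N. p_minimal_model 5 (EC5t a b) N \<and> index_E0 5 N = 2 \<and> D 1 (wdisc N)" by blast
qed

end

section \<open>Minimality, bad primes and Tamagawa numbers\<close>

context coprime_parameters
begin

text \<open>If \<open>p\<close> divides the discriminant then c4 is prime to \<open>p\<close>, and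
  otherwise the discriminant is a unit; either excludes a smaller model.\<close>

lemma minimal:
  assumes "\<not> (p = 5 \<and> 5 dvd a + 18 * b)"
  shows "p_minimal_model p (EC5 a b) (EC5 a b)" "p_minimal_model p (EC5t a b) (EC5t a b)"
proof -
  have "(\<not> D 12 (wdisc (EC5 a b)) \<or> \<not> D 4 (wc4 (EC5 a b)))
    \<and> (\<not> D 12 (wdisc (EC5t a b)) \<or> \<not> D 4 (wc4 (EC5t a b)))"
  proof (cases "p dvd a * b")
    case True
    thus ?thesis using split_case(4,5) by blast
  next
    case ab: False
    show ?thesis
    proof (cases "p dvd quad a b")
      case True
      hence "p \<ge> 7" using prime_dvd_quad[OF cop prime_p] assms by blast
      from node_case(2,3)[OF this True] show ?thesis by (auto simp: punit_def intro: pclose_mono)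
    next
      case False
      hence "multiplicity p (quad a b) = 0" "multiplicity p (a * b) = 0"
        using ab by (simp_all add: not_dvd_imp_multiplicity_0)
      thus ?thesis by (simp add: pclose_wdisc_EC5 pclose_wdisc_EC5t)
    qed
  qed
  thus "p_minimal_model p (EC5 a b) (EC5 a b)" "p_minimal_model p (EC5t a b) (EC5t a b)"
    by (intro minimal_self elliptic p_integral_EC5; blast)+
qed

lemma pclose_1_wdisc:
  "D 1 (wdisc (EC5 a b)) \<longleftrightarrow> p dvd a * b \<or> p dvd quad a b"
  "D 1 (wdisc (EC5t a b)) \<longleftrightarrow> p dvd a * b \<or> p dvd quad a b"
  unfolding wdisc_EC5 wdisc_EC5t pclose_1_of_int dvd_minus_iff
  using prime_p prime_dvd_power[OF prime_p] by (auto simp: prime_dvd_mult_iff prime_dvd_power_iff)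

lemma bad_primes:
  "p dvd a * b \<or> p dvd quad a b \<longleftrightarrow>
     p dvd a * b \<or> p \<ge> 7 \<and> p dvd quad a b \<or> p = 5 \<and> 5 dvd a + 18 * b"
  using prime_dvd_quad[OF cop prime_p] quad_dvd_5 by blast

lemma bad_reduction_iff:
  "bad_reduction p (EC5 a b) \<longleftrightarrow> p dvd a * b \<or> p \<ge> 7 \<and> p dvd quad a b \<or> p = 5 \<and> 5 dvd a + 18 * b"
  "bad_reduction p (EC5t a b) \<longleftrightarrow> p dvd a * b \<or> p \<ge> 7 \<and> p dvd quad a b \<or> p = 5 \<and> 5 dvd a + 18 * b"
proof -
  have "(bad_reduction p (EC5 a b) \<longleftrightarrow> p dvd a * b \<or> p dvd quad a b)
    \<and> (bad_reduction p (EC5t a b) \<longleftrightarrow> p dvd a * b \<or> p dvd quad a b)"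
  proof (cases "p = 5 \<and> 5 dvd a + 18 * b")
    case False
    show ?thesis
      using tamagawa_eq_index(2)[OF elliptic(1) minimal(1)[OF False]]
        tamagawa_eq_index(2)[OF elliptic(2) minimal(2)[OF False]] pclose_1_wdisc by simp
  next
    case True
    \<comment> \<open>The given equation of the quotient curve may be nonminimal here, so the
      minimal models found at 5 are used instead.\<close>
    interpret F: coprime_parameters_5 a b
      using True cop nz by unfold_locales auto
    have "bad_reduction 5 (EC5 a b)" "bad_reduction 5 (EC5t a b)"
      using F.exactly_divisible F.divisible_by_25 F.pclose_1_wdisc
        F.tamagawa_eq_index(2)[OF F.elliptic(1)] F.tamagawa_eq_index(2)[OF F.elliptic(2)]
      by metis+
    thus ?thesis using True quad_dvd_5 by simp
  qed
  thus "bad_reduction p (EC5 a b) \<longleftrightarrow> p dvd a * b \<or> p \<ge> 7 \<and> p dvd quad a b \<or> p = 5 \<and> 5 dvd a + 18 * b"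
    "bad_reduction p (EC5t a b) \<longleftrightarrow> p dvd a * b \<or> p \<ge> 7 \<and> p dvd quad a b \<or> p = 5 \<and> 5 dvd a + 18 * b"
    using bad_primes by simp_all
qed

lemma tamagawa_split:
  assumes "n = multiplicity p (a * b)" "n > 0"
  shows "tamagawa p (EC5 a b) = 5 * n \<and> tamagawa p (EC5t a b) = n"
proof -
  have ab: "p dvd a * b" using assms by (metis not_dvd_imp_multiplicity_0 less_irrefl)
  have "\<not> (p = 5 \<and> 5 dvd a + 18 * b)" using quad_not_dvd[OF ab] quad_dvd_5 by blast
  from minimal[OF this] show ?thesis
    using split_case[OF ab] tamagawa_eq_index(1)[OF elliptic(1)] tamagawa_eq_index(1)[OF elliptic(2)]
    by (simp add: assms(1))
qed

lemma tamagawa_node: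
  assumes p: "p \<ge> 7" and n: "n = multiplicity p (quad a b)" "n > 0"
  shows "Legendre (- 5 * (a ^ 2 + b ^ 2)) p = 1 \<Longrightarrow>
      tamagawa p (EC5 a b) = n \<and> tamagawa p (EC5t a b) = 5 * n"
    "Legendre (- 5 * (a ^ 2 + b ^ 2)) p = - 1 \<Longrightarrow> even n \<Longrightarrow>
      tamagawa p (EC5 a b) = 2 \<and> tamagawa p (EC5t a b) = 2"
    "Legendre (- 5 * (a ^ 2 + b ^ 2)) p = - 1 \<Longrightarrow> odd n \<Longrightarrow>
      tamagawa p (EC5 a b) = 1 \<and> tamagawa p (EC5t a b) = 1"
proof -
  have q: "p dvd quad a b" using n by (metis not_dvd_imp_multiplicity_0 less_irrefl)
  have "\<not> (p = 5 \<and> 5 dvd a + 18 * b)" using p by simp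
  note t = tamagawa_eq_index(1)[OF elliptic(1) minimal(1)[OF this]]
    tamagawa_eq_index(1)[OF elliptic(2) minimal(2)[OF this]]
  note c = node_case(4-6)[OF p q, folded n(1)]
  show "Legendre (- 5 * (a ^ 2 + b ^ 2)) p = 1 \<Longrightarrow>
      tamagawa p (EC5 a b) = n \<and> tamagawa p (EC5t a b) = 5 * n"
    "Legendre (- 5 * (a ^ 2 + b ^ 2)) p = - 1 \<Longrightarrow> even n \<Longrightarrow>
      tamagawa p (EC5 a b) = 2 \<and> tamagawa p (EC5t a b) = 2"
    "Legendre (- 5 * (a ^ 2 + b ^ 2)) p = - 1 \<Longrightarrow> odd n \<Longrightarrow>
      tamagawa p (EC5 a b) = 1 \<and> tamagawa p (EC5t a b) = 1"
    unfolding t by (rule c; assumption)+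
qed

end

lemma (in coprime_parameters_5) tamagawa_5:
  "\<not> 25 dvd a + 18 * b \<Longrightarrow> tamagawa 5 (EC5 a b) = 1 \<and> tamagawa 5 (EC5t a b) = 1"
  "25 dvd a + 18 * b \<Longrightarrow> tamagawa 5 (EC5 a b) = 2 \<and> tamagawa 5 (EC5t a b) = 2"
  using exactly_divisible divisible_by_25
    tamagawa_eq_index(1)[OF elliptic(1)] tamagawa_eq_index(1)[OF elliptic(2)]
  by metis+

theorem theorem3p1:
  fixes a b :: int
  assumes cop: "coprime a b" and nz: "a * b \<noteq> 0"
  shows
    "(\<forall>p::int. prime p \<longrightarrow>
        (bad_reduction p (EC5 a b) \<longleftrightarrow>
           (p dvd a * b \<or> (p \<ge> 7 \<and> p dvd a ^ 2 + 11 * a * b - b ^ 2) \<or> (p = 5 \<and> 5 dvd a + 18 * b))) \<and>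
        (bad_reduction p (EC5t a b) \<longleftrightarrow>
           (p dvd a * b \<or> (p \<ge> 7 \<and> p dvd a ^ 2 + 11 * a * b - b ^ 2) \<or> (p = 5 \<and> 5 dvd a + 18 * b))))
   \<and> (\<forall>p::int. \<forall>n. prime p \<longrightarrow> n = multiplicity p (a * b) \<longrightarrow> n > 0 \<longrightarrow>
        tamagawa p (EC5 a b) = 5 * n \<and> tamagawa p (EC5t a b) = n)
   \<and> (\<forall>p::int. \<forall>n. prime p \<longrightarrow> p \<ge> 7 \<longrightarrow> n = multiplicity p (a ^ 2 + 11 * a * b - b ^ 2) \<longrightarrow> n > 0 \<longrightarrow>
        (Legendre (- 5 * (a ^ 2 + b ^ 2)) p = 1 \<longrightarrow>
           tamagawa p (EC5 a b) = n \<and> tamagawa p (EC5t a b) = 5 * n) \<and>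
        (Legendre (- 5 * (a ^ 2 + b ^ 2)) p = -1 \<longrightarrow>
           (even n \<longrightarrow> tamagawa p (EC5 a b) = 2 \<and> tamagawa p (EC5t a b) = 2) \<and>
           (odd n \<longrightarrow> tamagawa p (EC5 a b) = 1 \<and> tamagawa p (EC5t a b) = 1)))
   \<and> (5 dvd a + 18 * b \<and> \<not> 25 dvd a + 18 * b \<longrightarrow>
        tamagawa 5 (EC5 a b) = 1 \<and> tamagawa 5 (EC5t a b) = 1)
   \<and> (25 dvd a + 18 * b \<longrightarrow>
        tamagawa 5 (EC5 a b) = 2 \<and> tamagawa 5 (EC5t a b) = 2)"
proof -
  have P: "coprime_parameters p a b" if "prime p" for p
    using that cop nz by unfold_locales
  have F: "coprime_parameters_5 a b" if "5 dvd a + 18 * b"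
    using that cop nz by unfold_locales simp_all
  have 25: "5 dvd a + 18 * b" if "25 dvd a + 18 * b"
    using that by (rule dvd_trans[rotated]) simp
  show ?thesis
    unfolding quad_def[symmetric]
  proof (intro conjI allI impI)
    fix p :: int assume "prime p"
    then interpret coprime_parameters p a b by (rule P)
    show "bad_reduction p (EC5 a b) \<longleftrightarrow>
        p dvd a * b \<or> p \<ge> 7 \<and> p dvd quad a b \<or> p = 5 \<and> 5 dvd a + 18 * b"
      "bad_reduction p (EC5t a b) \<longleftrightarrow>
        p dvd a * b \<or> p \<ge> 7 \<and> p dvd quad a b \<or> p = 5 \<and> 5 dvd a + 18 * b"
      by (rule bad_reduction_iff)+
  qed (use coprime_parameters.tamagawa_split[OF P] coprime_parameters.tamagawa_node[OF P]
        coprime_parameters_5.tamagawa_5[OF F] 25 in \<open>simp_all\<close>)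
qed

end
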